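(* Suppose that there is a sequence of time intervals $[n_j,\,n_j+l_j]$, $j\ge1$, with integers $n_1\ge1$, $l_j\ge1$, $n_{j+1}\ge n_j+l_j$, such that: (i) the inequalities $\|K_{n_j}^0\|\le c$ and $\|K_{n_j+l_j}^0\|\le c$, where $c<1$, hold for all $j\ge 1$; (ii) the distributions $\nu_{n_j+1,l_j}$, $j\ge 1$, belong to a weakly compact set $M$ of probability measures on $\mathrm{SL}(m,\mathbb{R})$ such that for every $\nu\in M$ the group $G_\nu$ does not preserve any probability measure on $\mathcal{S}$. Then there is a (non-random) $\lambda>0$ such that with probability $1$ $$\liminf_{j\to\infty}\frac1j \ln\|g_{n_j+l_j}g_{n_j+l_j-1}\cdots g_1\|\ge \lambda ,$$ and $\lambda$ does not depend on the choice of the functions $\{\mathfrak{g}_i(\cdot): i\in\bigcup_{j\ge1}[n_j+l_j+1,\,n_{j+1}]\}$ (that is, the same $\lambda$ works for every choice of these functions).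
   Context: Let $m$ be a positive integer, $\mathcal{S}$ the unit sphere in $\mathbb{R}^m$, and $\|\cdot\|$ the Euclidean norm of vectors and the corresponding operator norm of matrices. Markov chain. Let $(X,\mathcal{B})$ be a measurable space and $\xi=(\xi_n)_{n\ge1}$ a (not necessarily stationary) Markov chain with phase space $X$, initial distribution $\mu_1$ and transition kernels $k_n(x,B)=\mathbb{P}(\xi_{n+1}\in B\mid \xi_n=x)$, $B\in\mathcal{B}$. Let $\mu_n$ be the distribution of $\xi_n$. Let $H_n$ be the Hilbert space of real-valued $\mu_n$-square-integrable functions on $X$, and $H_n^0=\{f\in H_n:\int_X f\,d\mu_n=0\}$. Let $K_n:H_{n+1}\to H_n$, $(K_nf)(x)=\int_X k_n(x,dy)f(y)$. It maps $H_{n+1}^0$ into $H_n^0$, and $K_n^0:H_{n+1}^0\to H_n^0$ denotes its restriction; $\|K_n^0\|$ is its operator norm. Matrices. Let $\mathfrak{g}_n:X\to\mathrm{SL}(m,\mathbb{R})$, $n\ge1$, be $\mathcal{B}$-measurable functions and $g_n=\mathfrak{g}_n(\xi_n)$. For integers $n,l\ge1$, $\nu_{n,l}$ denotes the distribution on $\mathrm{SL}(m,\mathbb{R})$ of the product $\mathfrak{g}_{n+l-1}(\xi_{n+l-1})\cdots\mathfrak{g}_{n}(\xi_{n})$. Groups. For a probability measure $\nu$ on $\mathrm{SL}(m,\mathbb{R})$, $G_\nu$ is the closed group generated by $\{g\tilde g^{-1}: g,\tilde g\in\mathrm{supp}(\nu)\}$. For $g\in\mathrm{SL}(m,\mathbb{R})$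 and $u\in\mathcal{S}$ set $g.u=gu/\|gu\|$; $g$ preserves a probability measure $\kappa$ on $\mathcal{S}$ if the image of $\kappa$ under $u\mapsto g.u$ is $\kappa$, and a group preserves $\kappa$ if each of its elements does. Convention: $[a,b]$ denotes an interval of integers, and if $n_j+l_j=n_{j+1}$ then $[n_j+l_j+1,n_{j+1}]$ is empty. *)

theory Defs
  imports "HOL-Probability.Probability" "HOL-Algebra.Group"
begin

text \<open>
  Time starts at 1; the values at index 0 are irrelevant. The Markov property refers to the whole
  past: for \<open>n \<ge> 1\<close>, the conditional probability of the event that \<open>\<xi> (n + 1)\<close> lies in \<open>B\<close>, given
  the sigma-algebra generated by \<open>\<xi> 1, \<dots>, \<xi> n\<close>, is \<open>k n (\<xi> n) B\<close>. The initial distribution is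
  \<open>distr P X (\<xi> 1)\<close> and is not constrained.
\<close>

definition past_algebra ::
    "'w measure \<Rightarrow> 'x measure \<Rightarrow> (nat \<Rightarrow> 'w \<Rightarrow> 'x) \<Rightarrow> nat \<Rightarrow> 'w measure" where
  "past_algebra P X \<xi> n =
     vimage_algebra (space P) (\<lambda>\<omega>. \<lambda>i\<in>{1..n}. \<xi> i \<omega>) (PiM {1..n} (\<lambda>_. X))"

definition markov_chain ::
    "'w measure \<Rightarrow> 'x measure \<Rightarrow> (nat \<Rightarrow> 'w \<Rightarrow> 'x) \<Rightarrow> (nat \<Rightarrow> 'x \<Rightarrow> 'x measure) \<Rightarrow> bool" where
  "markov_chain P X \<xi> k \<longleftrightarrow>
     prob_space P \<and>
     (\<forall>n\<ge>1. \<xi> n \<in> measurable P X) \<and>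
     (\<forall>n\<ge>1. k n \<in> measurable X (prob_algebra X)) \<and>
     (\<forall>n\<ge>1. \<forall>B\<in>sets X. AE \<omega> in P.
        real_cond_exp P (past_algebra P X \<xi> n)
          (indicator (\<xi> (n + 1) -` B \<inter> space P)) \<omega> = measure (k n (\<xi> n \<omega>)) B)"

text \<open>
  Elements of the Hilbert spaces are represented by functions rather than by classes of functions
  modulo null sets; this does not affect operator norms.
\<close>

definition H_centered :: "'x measure \<Rightarrow> ('x \<Rightarrow> real) set" where
  "H_centered \<mu> = {f \<in> borel_measurable \<mu>. integrable \<mu> (\<lambda>x. (f x)\<^sup>2) \<and> (\<integral>x. f x \<partial>\<mu>) = 0}"

definition H_norm :: "'x measure \<Rightarrow> ('x \<Rightarrow> real) \<Rightarrow> real" where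
  "H_norm \<mu> f = sqrt (\<integral>x. (f x)\<^sup>2 \<partial>\<mu>)"

definition kernel_op :: "('x \<Rightarrow> 'x measure) \<Rightarrow> ('x \<Rightarrow> real) \<Rightarrow> 'x \<Rightarrow> real" where
  "kernel_op \<kappa> f x = (\<integral>y. f y \<partial>\<kappa> x)"

text \<open>
  Operator norm of the kernel operator from the centered functions for \<open>\<mu>'\<close> to those for \<open>\<mu>\<close>. When
  \<open>\<mu>'\<close> is the image of \<open>\<mu>\<close> under the kernel, Jensen's inequality bounds the set below by 1, so the
  supremum is a genuine one.
\<close>

definition centered_op_norm ::
    "'x measure \<Rightarrow> 'x measure \<Rightarrow> ('x \<Rightarrow> 'x measure) \<Rightarrow> real" where
  "centered_op_norm \<mu> \<mu>' \<kappa> =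
     Sup {H_norm \<mu> (kernel_op \<kappa> f) | f. f \<in> H_centered \<mu>' \<and> H_norm \<mu>' f \<le> 1}"

definition SL :: "(real^'m^'m) set" where
  "SL = {A. det A = 1}"

definition SL_group :: "(real^'m^'m) monoid" where
  "SL_group = \<lparr>carrier = SL, monoid.mult = (**), one = mat 1\<rparr>"

lemma group_SL_group: "group (SL_group :: (real^'m^'m) monoid)"
proof (rule groupI)
  fix x :: "real^'m^'m" assume "x \<in> carrier SL_group"
  then have d: "det x = 1" by (simp add: SL_group_def SL_def)
  then have inv: "invertible x" by (simp add: invertible_det_nz)
  have l: "matrix_inv x ** x = mat 1"
    using inv unfolding invertible_def matrix_inv_def by (rule someI2_ex) simp
  have "det (matrix_inv x ** x) = det (matrix_inv x) * det x"
    by (rule det_mul)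
  with l d have "det (matrix_inv x) = 1" by simp
  with l show "\<exists>y\<in>carrier SL_group. y \<otimes>\<^bsub>SL_group\<^esub> x = \<one>\<^bsub>SL_group\<^esub>"
    by (auto simp: SL_group_def SL_def)
qed (auto simp: SL_group_def SL_def det_mul matrix_mul_assoc)

abbreviation SL_borel :: "(real^'m^'m) measure" where
  "SL_borel \<equiv> restrict_space borel SL"

abbreviation sphere_borel :: "(real^'m) measure" where
  "sphere_borel \<equiv> restrict_space borel (sphere 0 1)"

definition sphere_act :: "real^'m^'m \<Rightarrow> real^'m \<Rightarrow> real^'m" where
  "sphere_act g u = (g *v u) /\<^sub>R norm (g *v u)"

definition preserves :: "(real^'m^'m) set \<Rightarrow> (real^'m) measure \<Rightarrow> bool" where
  "preserves G \<kappa> \<longleftrightarrow> (\<forall>g\<in>G. distr \<kappa> sphere_borel (sphere_act g) = \<kappa>)"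

definition supp_SL :: "(real^'m^'m) measure \<Rightarrow> (real^'m^'m) set" where
  "supp_SL \<nu> = {g \<in> SL. \<forall>U. open U \<longrightarrow> g \<in> U \<longrightarrow> emeasure \<nu> (U \<inter> SL) > 0}"

text \<open>
  \<open>SL\<close> is closed in the space of all matrices, so a subset of \<open>SL\<close> is closed in \<open>SL\<close> iff it is
  \<open>closed\<close>.
\<close>

definition closed_group_of :: "(real^'m^'m) measure \<Rightarrow> (real^'m^'m) set" where
  "closed_group_of \<nu> =
     (\<lambda>H. subgroup H SL_group \<and> closed H) hull
       {g ** matrix_inv h | g h. g \<in> supp_SL \<nu> \<and> h \<in> supp_SL \<nu>}"

definition weak_topology :: "'a::topological_space set \<Rightarrow> 'a measure topology" where
  "weak_topology S = topology_generated_by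
     {{\<nu> \<in> space (prob_algebra (restrict_space borel S)). (\<integral>x. f x \<partial>\<nu>) \<in> U} | (f :: 'a \<Rightarrow> real) U.
       continuous_on S f \<and> bounded (f ` S) \<and> open U}"

lemma topspace_weak_topology:
  "topspace (weak_topology S) = space (prob_algebra (restrict_space borel S))"
proof -
  let ?A = "space (prob_algebra (restrict_space borel S))"
  let ?\<A> = "{{\<nu> \<in> ?A. (\<integral>x. f x \<partial>\<nu>) \<in> U} | (f :: 'a \<Rightarrow> real) U.
       continuous_on S f \<and> bounded (f ` S) \<and> open U}"
  have "?A \<in> ?\<A>"
    by (rule CollectI, rule exI[of _ "\<lambda>_. 0"], rule exI[of _ UNIV])
      (auto intro: finite_imp_bounded finite_subset[of _ "{0}"])
  then have "\<Union>?\<A> = ?A" by blast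
  then show ?thesis
    unfolding weak_topology_def topology_generated_by_topspace .
qed

text \<open>\<open>mat_prod h n l = h (n + l - 1) ** \<dots> ** h n\<close>, a product of \<open>l\<close> factors.\<close>

primrec mat_prod :: "(nat \<Rightarrow> real^'m^'m) \<Rightarrow> nat \<Rightarrow> nat \<Rightarrow> real^'m^'m" where
  "mat_prod h n 0 = mat 1"
| "mat_prod h n (Suc l) = h (n + l) ** mat_prod h n l"

definition op_norm :: "real^'m^'m \<Rightarrow> real" where
  "op_norm A = onorm (\<lambda>v. A *v v)"

definition prod_distr ::
    "'w measure \<Rightarrow> (nat \<Rightarrow> 'w \<Rightarrow> 'x) \<Rightarrow> (nat \<Rightarrow> 'x \<Rightarrow> real^'m^'m) \<Rightarrow> nat \<Rightarrow> nat \<Rightarrow> (real^'m^'m) measure" where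
  "prod_distr P \<xi> g n l = distr P SL_borel (\<lambda>\<omega>. mat_prod (\<lambda>i. g i (\<xi> i \<omega>)) n l)"

end

theory Submission
  imports Defs
begin

text \<open>
  Exponential growth of the norm of a product \<open>A\<close> of matrices follows from exponential decay of the
  expectation of \<open>norm A\<close> raised to a negative power. With \<open>m = CARD('m)\<close>, the right power is
  \<open>- m / 2\<close>: a matrix of determinant 1 acts isometrically, by \<open>b \<mapsto> b \<circ> A\<close>, on the functions on
  \<open>\<real>\<^sup>m\<close> that are homogeneous of degree \<open>- m / 2\<close>, with the \<open>L\<^sup>2\<close> norm over the shell
  \<open>1 \<le> norm v < 2\<close> (\<open>half_density_isometry\<close>). Up to a constant,
  \<open>norm A powr (- m / 2)\<close> is at most the integral over the shell of the half-density
  \<open>norm v powr (- m / 2)\<close> composed with \<open>A\<close>. The expectation of that integral along the chain is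
  obtained by alternately composing with a matrix, which is an isometry, and averaging by a
  transition kernel, which is a contraction. It remains to gain a fixed factor from each block.

  The gain has two sources. The first is the absence of invariant measures
  (\<open>uniform_average_contraction\<close>): for \<open>\<nu>\<close> in the compact set \<open>M\<close>, the average of \<open>b \<circ> g\<close> over
  \<open>\<nu>\<close> has squared norm at most \<open>1 - \<epsilon>\<close> times that of \<open>b\<close>. If this failed, there would be unit
  half-densities \<open>b\<close> for which \<open>b \<circ> g\<close> and \<open>b \<circ> h\<close> almost coincide for \<open>\<nu>\<close>-most pairs \<open>g, h\<close>.
  The probability measures on the sphere with density \<open>b\<^sup>2\<close> would then be almost invariant under
  \<open>g h\<^sup>-\<^sup>1\<close>, and a weak limit of them would be invariant under the whole group \<open>G\<^sub>\<nu>\<close>. The limit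
  exists by \<open>prob_compact_weakly_sequentially_compact\<close>.

  The second source is the bound on the kernels (\<open>kernel_contraction\<close>): a transition with
  \<open>norm K\<^sup>0 \<le> c\<close> contracts, in mean square, the deviation of a function from its mean by \<open>c\<close>. At the
  right end of a block, either the deviation carries a fixed part of the norm, and norm is lost
  there, or the function is close to its mean \<open>b\<close>, a deterministic half-density. In the second
  case the mean at the left end of the block is close to the average of \<open>b \<circ> g\<close> over \<open>\<nu>\<close>, which
  is shorter than \<open>b\<close>, and what is not in the mean is contracted by \<open>c\<close>. The estimate
  \<open>block_contraction\<close> makes this quantitative. Adjacent blocks may share a transition,
  so only every other block is used in \<open>energy_decay\<close>; Markov's inequality in
  summed form then gives the almost sure statement (\<open>exponential_growth\<close>). The matrices between
  the blocks enter only through isometries, so the rate depends on \<open>c\<close>, \<open>\<epsilon>\<close> and \<open>m\<close> alone.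
\<close>

section \<open>Linear changes of variables for Lebesgue measure\<close>

lemma Basis_cart: "(Basis :: (real^'m) set) = range (\<lambda>i. axis i 1)"
  by (auto simp: Basis_vec_def)

lemma measurable_matrix_vector [measurable]:
  "(\<lambda>v. g *v v) \<in> borel_measurable (borel :: (real^'m) measure)" for g :: "real^'m^'m"
  by (intro borel_measurable_continuous_onI linear_continuous_on matrix_vector_mul_bounded_linear)

lemma nn_integral_lborel_diagonal:
  fixes A :: "real^'m^'m"
  assumes A: "\<And>i j. i \<noteq> j \<Longrightarrow> A$i$j = 0" "det A \<noteq> 0" and [measurable]: "f \<in> borel_measurable borel"
  shows "ennreal \<bar>det A\<bar> * (\<integral>\<^sup>+v. f (A *v v) \<partial>lborel) = (\<integral>\<^sup>+v. f v \<partial>lborel)"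
proof -
  define c where "c = (\<lambda>j::real^'m. (A *v j) \<bullet> j)"
  have c: "c (axis i 1) = A$i$i" for i
    by (simp add: c_def matrix_vector_mult_basis column_def inner_axis)
  have d: "det A = (\<Prod>i\<in>UNIV. A$i$i)" using A by (intro det_diagonal) auto
  have p: "(\<Prod>j\<in>Basis. \<bar>c j\<bar>) = \<bar>det A\<bar>"
    unfolding Basis_cart d abs_prod by (subst prod.reindex) (auto simp: inj_on_def axis_eq_axis c)
  have s: "(\<Sum>j\<in>Basis. (c j * (x \<bullet> j)) *\<^sub>R j) = A *v x" for x
  proof -
    have "(\<Sum>j\<in>Basis. (c j * (x \<bullet> j)) *\<^sub>R j) = (\<Sum>i\<in>UNIV. (A$i$i * x$i) *\<^sub>R axis i 1)"
      unfolding Basis_cart by (subst sum.reindex) (auto simp: inj_on_def axis_eq_axis c inner_axis)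
    also have "\<dots> = A *v x"
    proof (rule vec_eq_iff[THEN iffD2], rule allI)
      fix k
      have "(A *v x) $ k = (\<Sum>j\<in>UNIV. if j = k then A$k$k * x$k else 0)"
        unfolding matrix_vector_mult_def vec_lambda_beta
        by (rule sum.cong) (use A(1)[of k] in auto)
      then show "(\<Sum>i\<in>UNIV. (A$i$i * x$i) *\<^sub>R axis i 1) $ k = (A *v x) $ k"
        by (simp add: axis_def if_distrib[of "\<lambda>z. _ * z"] cong: if_cong)
    qed
    finally show ?thesis .
  qed
  have nz: "c j \<noteq> 0" if "j \<in> Basis" for j
    using that A(2) d by (auto simp: Basis_cart c)
  have "lborel = density (distr lborel borel (\<lambda>x. 0 + (\<Sum>j\<in>Basis. (c j * (x \<bullet> j)) *\<^sub>R j))) (\<lambda>x. ennreal (\<Prod>j\<in>Basis. \<bar>c j\<bar>))"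
    by (rule lborel_affine_euclidean[OF nz])
  then have l: "lborel = density (distr lborel borel (\<lambda>x. A *v x)) (\<lambda>_. ennreal \<bar>det A\<bar>)"
    unfolding s p by simp
  show ?thesis
    by (subst (2) l) (simp add: nn_integral_density nn_integral_distr nn_integral_cmult)
qed

lemma nn_integral_lborel_swap:
  fixes A :: "real^'m^'m"
  assumes A: "A = (\<chi> i j. mat 1 $ i $ Transposition.transpose m n j)" and [measurable]: "f \<in> borel_measurable borel"
  shows "(\<integral>\<^sup>+v. f (A *v v) \<partial>lborel) = (\<integral>\<^sup>+v. f v \<partial>lborel)"
proof -
  let ?t = "Transposition.transpose m n"
  have Av: "(A *v v) $ i = v $ ?t i" for v i
  proof -
    have "(A *v v) $ i = (\<Sum>j\<in>UNIV. if j = ?t i then v $ j else 0)"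
      unfolding A matrix_vector_mult_def vec_lambda_beta
    proof (rule sum.cong)
      fix j
      have "i = ?t j \<longleftrightarrow> j = ?t i" by (metis transpose_involutory)
      then show "mat 1 $ i $ ?t j * v $ j = (if j = ?t i then v $ j else 0)"
        by (simp add: mat_def)
    qed simp
    then show ?thesis by simp
  qed
  have eq: "lborel = distr lborel borel (\<lambda>v. A *v v)"
  proof (rule lborel_eqI)
    fix a b :: "real^'m"
    assume ab: "\<And>i. i \<in> Basis \<Longrightarrow> a \<bullet> i \<le> b \<bullet> i"
    have ab': "a $ i \<le> b $ i" for i
      using ab[of "axis i 1"] by (simp add: inner_axis)
    have "(\<lambda>v. A *v v) -` box a b = box (A *v a) (A *v b)"
    proof (rule Set.set_eqI)
      fix v
      have "v \<in> (\<lambda>v. A *v v) -` box a b \<longleftrightarrow> (\<forall>i. a $ i < v $ ?t i \<and> v $ ?t i < b $ i)"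
        by (simp add: mem_box_cart Av)
      also have "\<dots> \<longleftrightarrow> (\<forall>i. a $ ?t i < v $ i \<and> v $ i < b $ ?t i)"
      proof (intro iffI allI)
        fix i
        assume "\<forall>i. a $ i < v $ ?t i \<and> v $ ?t i < b $ i"
        from spec[OF this, of "?t i"] show "a $ ?t i < v $ i \<and> v $ i < b $ ?t i" by simp
      next
        fix i
        assume "\<forall>i. a $ ?t i < v $ i \<and> v $ i < b $ ?t i"
        from spec[OF this, of "?t i"] show "a $ i < v $ ?t i \<and> v $ ?t i < b $ i" by simp
      qed
      finally show "v \<in> (\<lambda>v. A *v v) -` box a b \<longleftrightarrow> v \<in> box (A *v a) (A *v b)"
        by (simp add: mem_box_cart Av)
    qed
    moreover have "emeasure lborel (box (A *v a) (A *v b)) = (\<Prod>i\<in>Basis. (A *v b - A *v a) \<bullet> i)"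
      by (subst emeasure_lborel_box) (auto simp: Basis_cart inner_axis Av ab')
    moreover have "(\<Prod>i\<in>Basis. (A *v b - A *v a) \<bullet> i) = (\<Prod>i\<in>Basis. (b - a) \<bullet> i)"
    proof -
      have "(\<Prod>i\<in>Basis. (A *v b - A *v a) \<bullet> i) = (\<Prod>i\<in>UNIV. (b - a) $ ?t i)"
        unfolding Basis_cart by (subst prod.reindex) (auto simp: inj_on_def axis_eq_axis inner_axis Av)
      also have "\<dots> = (\<Prod>i\<in>UNIV. (b - a) $ i)"
        by (rule prod.reindex_bij_betw) simp
      also have "\<dots> = (\<Prod>i\<in>Basis. (b - a) \<bullet> i)"
        unfolding Basis_cart by (subst prod.reindex) (auto simp: inj_on_def axis_eq_axis inner_axis)
      finally show ?thesis .
    qed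
    ultimately show "emeasure (distr lborel borel (\<lambda>v. A *v v)) (box a b) = ennreal (\<Prod>i\<in>Basis. (b - a) \<bullet> i)"
      by (simp add: emeasure_distr)
  qed simp
  show ?thesis
    by (subst (2) eq) (simp add: nn_integral_distr)
qed

text \<open>
  A shear moves one coordinate by a multiple of another one. By Fubini it reduces to translation
  invariance of Lebesgue measure on the line.
\<close>

lemma nn_integral_lborel_shear:
  fixes A :: "real^'m^'m"
  assumes mn: "m \<noteq> n" and A: "A = (\<chi> i j. if i = m \<and> j = n then c else of_bool (i = j))"
    and [measurable]: "f \<in> borel_measurable borel"
  shows "(\<integral>\<^sup>+v. f (A *v v) \<partial>lborel) = (\<integral>\<^sup>+v. f v \<partial>lborel)"
proof -
  let ?a = "\<lambda>i. axis i (1::real) :: real^'m"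
  let ?B = "Basis - {?a m}"
  let ?S = "\<lambda>x::real^'m \<Rightarrow> real. \<Sum>b\<in>Basis. x b *\<^sub>R b"
  interpret product_sigma_finite "\<lambda>b::real^'m. lborel :: real measure" by standard
  have B: "Basis = insert (?a m) ?B" by (auto simp: Basis_cart)
  have S: "?S x $ i = x (?a i)" for x i
  proof -
    have "?S x = (\<Sum>i\<in>UNIV. x (?a i) *\<^sub>R ?a i)"
      unfolding Basis_cart by (subst sum.reindex) (auto simp: inj_on_def axis_eq_axis)
    then show ?thesis by (simp add: axis_def if_distrib[of "\<lambda>z. _ * z"] cong: if_cong)
  qed
  have Av: "(A *v v) $ i = (if i = m then v $ m + c * v $ n else v $ i)" for v i
  proof -
    have "(A *v v) $ i = (\<Sum>j\<in>UNIV. (if j = i then v $ j else 0) + (if j = n then (if i = m then c * v $ n else 0) else 0))"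
      unfolding A matrix_vector_mult_def using mn
      by (auto intro!: sum.cong)
    then show ?thesis by (simp add: sum.distrib)
  qed
  have upd: "A *v ?S (x(?a m := y)) = ?S (x(?a m := c * x (?a n) + 1 * y))" for x y
    by (rule vec_eq_iff[THEN iffD2], rule allI, simp only: Av S) (use mn in \<open>auto simp: axis_eq_axis\<close>)
  have int: "(\<integral>\<^sup>+v. h v \<partial>lborel) = (\<integral>\<^sup>+x. \<integral>\<^sup>+y. h (?S (x(?a m := y))) \<partial>lborel \<partial>Pi\<^sub>M ?B (\<lambda>_. lborel))"
    if [measurable]: "h \<in> borel_measurable borel" for h :: "real^'m \<Rightarrow> ennreal"
  proof -
    have "(\<integral>\<^sup>+v. h v \<partial>lborel) = (\<integral>\<^sup>+x. h (?S x) \<partial>Pi\<^sub>M Basis (\<lambda>_. lborel))"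
      by (subst lborel_eq) (simp add: nn_integral_distr)
    also have "\<dots> = (\<integral>\<^sup>+x. h (?S x) \<partial>Pi\<^sub>M (insert (?a m) ?B) (\<lambda>_. lborel))"
      using B by simp
    also have "\<dots> = (\<integral>\<^sup>+x. \<integral>\<^sup>+y. h (?S (x(?a m := y))) \<partial>lborel \<partial>Pi\<^sub>M ?B (\<lambda>_. lborel))"
    proof (subst product_nn_integral_insert)
      have "(\<lambda>x. h (?S x)) \<in> borel_measurable (Pi\<^sub>M Basis (\<lambda>_. lborel))" by measurable
      then show "(\<lambda>x. h (?S x)) \<in> borel_measurable (Pi\<^sub>M (insert (?a m) ?B) (\<lambda>_. lborel))"
        using B by simp
    qed auto
    finally show ?thesis .
  qed
  have "(\<integral>\<^sup>+v. f (A *v v) \<partial>lborel)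
      = (\<integral>\<^sup>+x. \<integral>\<^sup>+y. f (A *v ?S (x(?a m := y))) \<partial>lborel \<partial>Pi\<^sub>M ?B (\<lambda>_. lborel))"
    by (rule int) measurable
  also have "\<dots> = (\<integral>\<^sup>+x. \<integral>\<^sup>+y. f (?S (x(?a m := y))) \<partial>lborel \<partial>Pi\<^sub>M ?B (\<lambda>_. lborel))"
  proof (rule nn_integral_cong)
    fix x
    have cont: "continuous_on UNIV (\<lambda>y. ?S (x(?a m := y)))"
    proof (intro continuous_intros)
      fix b :: "real^'m"
      show "continuous_on UNIV (\<lambda>y. (x(?a m := y)) b)"
        by (cases "b = ?a m") (auto simp: fun_upd_def intro!: continuous_intros)
    qed
    have [measurable]: "(\<lambda>y. ?S (x(?a m := y))) \<in> borel_measurable borel"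
      by (rule borel_measurable_continuous_onI[OF cont])
    show "(\<integral>\<^sup>+y. f (A *v ?S (x(?a m := y))) \<partial>lborel) = (\<integral>\<^sup>+y. f (?S (x(?a m := y))) \<partial>lborel)"
      unfolding upd
      by (subst (2) nn_integral_real_affine[where c=1 and t="c * x (?a n)"]) (auto simp: mult.commute)
  qed
  also have "\<dots> = (\<integral>\<^sup>+v. f v \<partial>lborel)" by (rule int[symmetric]) measurable
  finally show ?thesis .
qed

text \<open>
  Every matrix is a product of diagonal matrices, coordinate swaps, shears and singular matrices,
  and the formula is multiplicative.
\<close>

theorem nn_integral_lborel_linear:
  fixes A :: "real^'m^'m"
  assumes "det A \<noteq> 0" "f \<in> borel_measurable borel"
  shows "ennreal \<bar>det A\<bar> * (\<integral>\<^sup>+v. f (A *v v) \<partial>lborel) = (\<integral>\<^sup>+v. f v \<partial>lborel)"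
proof -
  have "det A \<noteq> 0 \<longrightarrow> (\<forall>f\<in>borel_measurable borel. ennreal \<bar>det A\<bar> * (\<integral>\<^sup>+v. f (A *v v) \<partial>lborel) = (\<integral>\<^sup>+v. f v \<partial>lborel))"
  proof (induction A rule: induct_matrix_elementary)
    case (1 A B)
    show ?case
    proof (intro impI ballI)
      fix f :: "real^'m \<Rightarrow> ennreal" assume d: "det (A ** B) \<noteq> 0" and f[measurable]: "f \<in> borel_measurable borel"
      from d have "det A \<noteq> 0" "det B \<noteq> 0" by (auto simp: det_mul)
      with 1 have *: "\<And>f. f \<in> borel_measurable borel \<Longrightarrow> ennreal \<bar>det A\<bar> * (\<integral>\<^sup>+v. f (A *v v) \<partial>lborel) = (\<integral>\<^sup>+v. f v \<partial>lborel)"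
        "\<And>f. f \<in> borel_measurable borel \<Longrightarrow> ennreal \<bar>det B\<bar> * (\<integral>\<^sup>+v. f (B *v v) \<partial>lborel) = (\<integral>\<^sup>+v. f v \<partial>lborel)"
        by auto
      have "(\<integral>\<^sup>+v. f v \<partial>lborel) = ennreal \<bar>det A\<bar> * (ennreal \<bar>det B\<bar> * (\<integral>\<^sup>+v. f (A *v (B *v v)) \<partial>lborel))"
        by (subst *(2)[of "\<lambda>v. f (A *v v)"], measurable, rule *(1)[OF f, symmetric])
      then show "ennreal \<bar>det (A ** B)\<bar> * (\<integral>\<^sup>+v. f ((A ** B) *v v) \<partial>lborel) = (\<integral>\<^sup>+v. f v \<partial>lborel)"
        by (simp add: det_mul abs_mult ennreal_mult mult.assoc matrix_vector_mul_assoc)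
    qed
  next
    case (2 A i)
    then show ?case by (simp add: det_zero_row row_def vec_eq_iff)
  next
    case (3 A)
    then show ?case using nn_integral_lborel_diagonal[of A] by blast
  next
    case (4 m n)
    let ?A = "(\<chi> i j. mat 1 $ i $ Transposition.transpose m n j) :: real^'m^'m"
    have "?A = transpose (\<chi> i. mat 1 $ Transposition.transpose m n i)"
      by (simp add: vec_eq_iff transpose_def mat_def)
    then have "det ?A = of_int (sign (Transposition.transpose m n)) * det (mat 1 :: real^'m^'m)"
      by (simp only: det_transpose) (rule det_permute_rows[OF permutes_swap_id], simp_all)
    then have "\<bar>det ?A\<bar> = 1" using 4 by (simp add: sign_swap_id)
    then show ?case by (simp add: nn_integral_lborel_swap[OF refl])
  next
    case (5 m n c)
    let ?A = "(\<chi> i j. if i = m \<and> j = n then c else of_bool (i = j)) :: real^'m^'m"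
    have "?A = (\<chi> k. if k = m then row m (mat 1) + c *s row n (mat 1) else row k (mat 1))"
      using 5 by (auto simp: vec_eq_iff row_def mat_def)
    then have "det ?A = det (mat 1 :: real^'m^'m)"
      using det_row_operation[OF 5, of "mat 1 :: real^'m^'m" c] by simp
    then have "\<bar>det ?A\<bar> = 1" by simp
    then show ?case by (simp add: nn_integral_lborel_shear[OF 5 refl])
  qed
  then show ?thesis using assms by blast
qed

section \<open>Homogeneous functions and the dyadic shell\<close>

definition annulus :: "(real^'m) set" where
  "annulus = {v. 1 \<le> norm v \<and> norm v < 2}"

text \<open>
  The annulus meets every ray from the origin in one fundamental domain for dilation by 2.
\<close>

definition shell :: "(real^'m) measure" where
  "shell = density lborel (indicator annulus)"

text \<open>
  Borel measurability is part of the notion, since such functions are always integrated.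
\<close>

definition homogeneous :: "real \<Rightarrow> (real^'m \<Rightarrow> ennreal) \<Rightarrow> bool" where
  "homogeneous p f \<longleftrightarrow> f \<in> borel_measurable borel \<and>
     (\<forall>t>0. \<forall>v. f (t *\<^sub>R v) = ennreal (t powr p) * f v)"

lemma annulus_borel [measurable]: "annulus \<in> sets borel"
  unfolding annulus_def by measurable

lemma sets_shell [simp, measurable_cong]: "sets shell = sets borel"
  by (simp add: shell_def)

lemma space_shell [simp]: "space shell = UNIV"
  by (simp add: shell_def)

lemma nn_integral_shell:
  assumes [measurable]: "f \<in> borel_measurable borel"
  shows "(\<integral>\<^sup>+v. f v \<partial>shell) = (\<integral>\<^sup>+v. indicator annulus v * f v \<partial>lborel)"
  unfolding shell_def by (subst nn_integral_density) auto

lemma finite_measure_shell: "finite_measure (shell :: (real^'m) measure)"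
proof
  have "bounded (annulus :: (real^'m) set)"
    by (rule bounded_subset[of "cball 0 2"]) (auto simp: annulus_def)
  then have "emeasure lborel (annulus :: (real^'m) set) < \<infinity>"
    by (intro emeasure_bounded_finite)
  then show "emeasure (shell :: (real^'m) measure) (space shell) \<noteq> \<infinity>"
    by (simp add: shell_def emeasure_density)
qed

lemma AE_shell_annulus: "AE v in shell. v \<in> annulus"
  unfolding shell_def by (subst AE_density) (auto simp: indicator_def)

lemma SL_inverse:
  assumes "(g :: real^'m^'m) \<in> SL"
  shows "matrix_inv g ** g = mat 1" "g ** matrix_inv g = mat 1" "matrix_inv g \<in> SL"
    "matrix_inv g *v (g *v v) = v" "g *v (matrix_inv g *v v) = v"
proof -
  have "invertible g" using assms by (simp add: invertible_det_nz SL_def)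
  then have *: "g ** matrix_inv g = mat 1 \<and> matrix_inv g ** g = mat 1"
    unfolding invertible_def matrix_inv_def by (rule someI_ex)
  then show a: "matrix_inv g ** g = mat 1" "g ** matrix_inv g = mat 1" by auto
  have "det (matrix_inv g ** g) = det (matrix_inv g) * det g" by (rule det_mul)
  then show "matrix_inv g \<in> SL" using a assms by (simp add: SL_def)
  show "matrix_inv g *v (g *v v) = v" "g *v (matrix_inv g *v v) = v"
    using a by (simp_all add: matrix_vector_mul_assoc)
qed

lemma nn_integral_lborel_SL:
  assumes "(g :: real^'m^'m) \<in> SL" "f \<in> borel_measurable borel"
  shows "(\<integral>\<^sup>+v. f (g *v v) \<partial>lborel) = (\<integral>\<^sup>+v. f v \<partial>lborel)"
  using nn_integral_lborel_linear[of g f] assms by (simp add: SL_def)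

lemma nn_integral_lborel_scale:
  assumes [measurable]: "f \<in> borel_measurable (borel :: (real^'m) measure)" and c: "c > 0"
  shows "(\<integral>\<^sup>+v. f v \<partial>lborel) = ennreal (c powr real CARD('m)) * (\<integral>\<^sup>+v. f (c *\<^sub>R v) \<partial>lborel)"
proof -
  have "c powr real CARD('m) = \<bar>c\<bar> ^ DIM(real^'m)"
    using c by (simp add: powr_realpow)
  then show ?thesis
    using c by (subst lborel_affine[of c 0]) (simp_all add: nn_integral_density nn_integral_distr nn_integral_cmult)
qed

lemma dyadic_shells_partition:
  fixes v :: "real^'m"
  assumes "v \<noteq> 0"
  shows "(\<integral>\<^sup>+k. indicator annulus ((2 powr real_of_int k) *\<^sub>R v) \<partial>count_space UNIV) = (1::ennreal)"
proof -
  have "((2 powr real_of_int k) *\<^sub>R v \<in> annulus) \<longleftrightarrow> k = - \<lfloor>log 2 (norm v)\<rfloor>" for k :: int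
  proof -
    have n: "2 powr (log 2 (norm v)) = norm v" using assms by simp
    have "(2 powr real_of_int k) *\<^sub>R v \<in> annulus \<longleftrightarrow>
       2 powr 0 \<le> 2 powr (k + log 2 (norm v)) \<and> 2 powr (k + log 2 (norm v)) < 2 powr 1"
      unfolding annulus_def powr_add n by simp
    also have "\<dots> \<longleftrightarrow> 0 \<le> k + log 2 (norm v) \<and> k + log 2 (norm v) < 1"
      by (subst powr_le_cancel_iff, simp, subst powr_less_cancel_iff, simp_all)
    also have "\<dots> \<longleftrightarrow> \<lfloor>log 2 (norm v)\<rfloor> = - k"
      by (subst floor_eq_iff) auto
    finally show ?thesis by auto
  qed
  then have "(indicator annulus ((2 powr real_of_int k) *\<^sub>R v) :: ennreal) = indicator {- \<lfloor>log 2 (norm v)\<rfloor>} k" for k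
    by (simp add: indicator_def)
  then show ?thesis by simp
qed

text \<open>
  For homogeneity of degree \<open>- m\<close>, the measure with density \<open>\<psi>\<close> is invariant under dilations, so its
  mass on a fundamental domain of the dilations by powers of 2 does not depend on the domain. The
  functions \<open>D\<close> and \<open>D'\<close> are (weighted) indicators of two such domains.
\<close>

lemma nn_integral_fundamental_domain:
  fixes \<psi> D D' :: "real^'m \<Rightarrow> ennreal"
  assumes \<psi>: "homogeneous (- real CARD('m)) \<psi>"
    and [measurable]: "D \<in> borel_measurable borel" "D' \<in> borel_measurable borel"
    and D: "\<And>v. v \<noteq> 0 \<Longrightarrow> (\<integral>\<^sup>+k. D ((2 powr real_of_int k) *\<^sub>R v) \<partial>count_space UNIV) = 1"
    and D': "\<And>v. v \<noteq> 0 \<Longrightarrow> (\<integral>\<^sup>+k. D' ((2 powr real_of_int k) *\<^sub>R v) \<partial>count_space UNIV) = 1"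
  shows "(\<integral>\<^sup>+v. D v * \<psi> v \<partial>lborel) = (\<integral>\<^sup>+v. D' v * \<psi> v \<partial>lborel)"
proof -
  have [measurable]: "\<psi> \<in> borel_measurable borel" using \<psi> by (simp add: homogeneous_def)
  let ?s = "\<lambda>k::int. 2 powr real_of_int k"
  have nz: "AE v in lborel. v \<noteq> (0 :: real^'m)" by (rule AE_lborel_singleton)
  \<comment> \<open>Cut the first domain along the dilates of the second one, and move each piece back.\<close>
  have "(\<integral>\<^sup>+v. D v * \<psi> v \<partial>lborel)
      = (\<integral>\<^sup>+v. \<integral>\<^sup>+k. D' (?s k *\<^sub>R v) * (D v * \<psi> v) \<partial>count_space UNIV \<partial>lborel)"
    by (rule nn_integral_cong_AE, use nz in eventually_elim) (simp add: nn_integral_multc D')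
  also have "\<dots> = (\<integral>\<^sup>+k. \<integral>\<^sup>+v. D' (?s k *\<^sub>R v) * (D v * \<psi> v) \<partial>lborel \<partial>count_space UNIV)"
    by (rule nn_integral_count_space_nn_integral) auto
  also have "\<dots> = (\<integral>\<^sup>+k. \<integral>\<^sup>+v. D' v * (D (?s (- k) *\<^sub>R v) * \<psi> v) \<partial>lborel \<partial>count_space UNIV)"
  proof (rule nn_integral_cong)
    fix k :: int
    have "(\<integral>\<^sup>+v. D' (?s k *\<^sub>R v) * (D v * \<psi> v) \<partial>lborel) =
      ennreal (?s (- k) powr real CARD('m)) *
        (\<integral>\<^sup>+v. D' (?s k *\<^sub>R ?s (- k) *\<^sub>R v) * (D (?s (- k) *\<^sub>R v) * \<psi> (?s (- k) *\<^sub>R v)) \<partial>lborel)"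
      by (rule nn_integral_lborel_scale) auto
    also have "\<dots> = (\<integral>\<^sup>+v. D' v * (D (?s (- k) *\<^sub>R v) * \<psi> v) \<partial>lborel)"
    proof (subst nn_integral_cmult[symmetric], measurable, rule nn_integral_cong)
      fix v
      have e: "ennreal (?s (- k) powr real CARD('m)) * ennreal (?s (- k) powr (- real CARD('m))) = 1"
        by (simp add: ennreal_mult[symmetric] powr_add[symmetric] powr_powr)
      have p: "\<psi> (?s (- k) *\<^sub>R v) = ennreal (?s (- k) powr (- real CARD('m))) * \<psi> v"
        using \<psi> unfolding homogeneous_def by (metis powr_gt_zero zero_neq_numeral)
      have s: "?s k *\<^sub>R ?s (- k) *\<^sub>R v = v"
        by (simp add: powr_add[symmetric])
      show "ennreal (?s (- k) powr real CARD('m)) *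
          (D' (?s k *\<^sub>R ?s (- k) *\<^sub>R v) * (D (?s (- k) *\<^sub>R v) * \<psi> (?s (- k) *\<^sub>R v)))
         = D' v * (D (?s (- k) *\<^sub>R v) * \<psi> v)"
        unfolding p s using arg_cong[OF e, of "\<lambda>x. x * (D' v * (D (?s (- k) *\<^sub>R v) * \<psi> v))"]
        by (simp only: ac_simps mult_1)
    qed
    finally show "(\<integral>\<^sup>+v. D' (?s k *\<^sub>R v) * (D v * \<psi> v) \<partial>lborel) = (\<integral>\<^sup>+v. D' v * (D (?s (- k) *\<^sub>R v) * \<psi> v) \<partial>lborel)" .
  qed
  also have "\<dots> = (\<integral>\<^sup>+v. \<integral>\<^sup>+k. D' v * (D (?s (- k) *\<^sub>R v) * \<psi> v) \<partial>count_space UNIV \<partial>lborel)"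
    by (rule nn_integral_count_space_nn_integral[symmetric]) auto
  also have "\<dots> = (\<integral>\<^sup>+v. D' v * \<psi> v \<partial>lborel)"
  proof (rule nn_integral_cong_AE, use nz in eventually_elim)
    fix v :: "real^'m" assume v: "v \<noteq> 0"
    have "(\<integral>\<^sup>+k. D (?s (- k) *\<^sub>R v) \<partial>count_space UNIV) = (\<integral>\<^sup>+k. D (?s k *\<^sub>R v) \<partial>count_space UNIV)"
      by (rule nn_integral_bij_count_space[of uminus UNIV UNIV "\<lambda>k. D (?s k *\<^sub>R v)"])
         (auto intro: bij_uminus)
    then show "(\<integral>\<^sup>+k. D' v * (D (?s (- k) *\<^sub>R v) * \<psi> v) \<partial>count_space UNIV) = D' v * \<psi> v"
      using v by (simp add: nn_integral_cmult nn_integral_multc D)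
  qed
  finally show ?thesis .
qed

text \<open>
  A linear map of determinant 1 preserves Lebesgue measure and commutes with dilations, so it maps
  the annulus to another fundamental domain.
\<close>

lemma nn_integral_shell_SL:
  fixes \<psi> :: "real^'m \<Rightarrow> ennreal"
  assumes \<psi>: "homogeneous (- real CARD('m)) \<psi>" and g: "g \<in> SL"
  shows "(\<integral>\<^sup>+v. \<psi> (g *v v) \<partial>shell) = (\<integral>\<^sup>+v. \<psi> v \<partial>shell)"
proof -
  have [measurable]: "\<psi> \<in> borel_measurable borel" using \<psi> by (simp add: homogeneous_def)
  note gi = SL_inverse[OF g]
  have "(\<integral>\<^sup>+v. \<psi> (g *v v) \<partial>shell)
      = (\<integral>\<^sup>+v. indicator annulus (matrix_inv g *v (g *v v)) * \<psi> (g *v v) \<partial>lborel)"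
    by (subst nn_integral_shell) (auto simp: gi)
  also have "\<dots> = (\<integral>\<^sup>+v. indicator annulus (matrix_inv g *v v) * \<psi> v \<partial>lborel)"
    by (rule nn_integral_lborel_SL[OF g]) measurable
  also have "\<dots> = (\<integral>\<^sup>+v. indicator annulus v * \<psi> v \<partial>lborel)"
  proof (rule nn_integral_fundamental_domain[OF \<psi>])
    fix v :: "real^'m" assume "v \<noteq> 0"
    then have "matrix_inv g *v v \<noteq> 0" using gi(5)[of v] by auto
    from dyadic_shells_partition[OF this]
    show "(\<integral>\<^sup>+k. indicator annulus (matrix_inv g *v (2 powr real_of_int k) *\<^sub>R v) \<partial>count_space UNIV) = (1::ennreal)"
      by (simp add: matrix_vector_mult_scaleR)
  qed (auto intro: dyadic_shells_partition)
  also have "\<dots> = (\<integral>\<^sup>+v. \<psi> v \<partial>shell)" by (subst nn_integral_shell) auto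
  finally show ?thesis .
qed

section \<open>Weak sequential compactness of the probability measures on a compact set\<close>

text \<open>
  Ternary expansions that omit one digit leave gaps: the first place \<open>j\<close> where the digits differ
  contributes \<open>(1/3)^j\<close>, and all later places together at most half of this.
\<close>

lemma ternary_digits_agree:
  fixes d e :: "nat \<Rightarrow> real"
  assumes d: "\<And>n. d n \<in> {0, 1}" and e: "\<And>n. e n \<in> {0, 1}"
    and close: "\<bar>(\<Sum>n. d n * (1/3)^n) - (\<Sum>n. e n * (1/3)^n)\<bar> < (1/3)^N / 2"
    and n: "n \<le> N"
  shows "d n = e n"
proof (rule ccontr)
  assume "d n \<noteq> e n"
  define j where "j = (LEAST j. d j \<noteq> e j)"
  have j: "d j \<noteq> e j" unfolding j_def by (rule LeastI) fact
  have lt: "d i = e i" if "i < j" for i using that not_less_Least unfolding j_def by blast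
  have jN: "j \<le> N" using Least_le[of "\<lambda>j. d j \<noteq> e j" n] \<open>d n \<noteq> e n\<close> n unfolding j_def by simp
  have geo: "summable (\<lambda>n. (1/3::real)^n)" by (rule summable_geometric) simp
  have sm: "summable (\<lambda>n. x n * (1/3)^n)" if "\<And>n. x n \<in> {0, 1}" for x :: "nat \<Rightarrow> real"
  proof (rule summable_comparison_test'[OF geo, of 0])
    fix n show "norm (x n * (1/3)^n) \<le> (1/3)^n" using that[of n] by auto
  qed
  define a where "a n = d n * (1/3)^n - e n * (1/3)^n" for n
  have a: "summable a" unfolding a_def by (intro summable_diff sm d e)
  have bound: "\<bar>a n\<bar> \<le> (1/3)^n" for n
    using d[of n] e[of n] by (auto simp: a_def)
  have aj: "\<bar>a j\<bar> = (1/3)^j" using d[of j] e[of j] j by (auto simp: a_def)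
  have "(\<Sum>n. a n) = (\<Sum>n. a (n + Suc j)) + (\<Sum>n<Suc j. a n)"
    by (rule suminf_split_initial_segment[OF a])
  also have "(\<Sum>n<Suc j. a n) = a j" by (simp add: a_def lt)
  finally have eq: "(\<Sum>n. a n) = (\<Sum>n. a (n + Suc j)) + a j" .
  have geo': "summable (\<lambda>n. (1/3::real)^(n + Suc j))"
    using summable_ignore_initial_segment[OF geo] by simp
  have tail_summable: "summable (\<lambda>n. \<bar>a (n + Suc j)\<bar>)"
    by (rule summable_comparison_test'[OF geo', of 0]) (simp only: real_norm_def abs_abs bound)
  have "\<bar>\<Sum>n. a (n + Suc j)\<bar> \<le> (\<Sum>n. \<bar>a (n + Suc j)\<bar>)"
    by (rule summable_rabs[OF tail_summable])
  also have "\<dots> \<le> (\<Sum>n. (1/3)^(n + Suc j))"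
    by (rule suminf_le[OF _ tail_summable geo']) (rule bound)
  also have "\<dots> = (\<Sum>n. (1/3)^n) * (1/3)^Suc j"
    unfolding power_add by (rule suminf_mult2[symmetric, OF geo])
  also have "\<dots> = (1/3)^j / 2" by (simp add: suminf_geometric)
  finally have "(1/3)^j / 2 \<le> \<bar>\<Sum>n. a n\<bar>" using eq aj by linarith
  moreover have "(1/3::real)^N \<le> (1/3)^j" using jN by (intro power_decreasing) auto
  moreover have "(\<Sum>n. a n) = (\<Sum>n. d n * (1/3)^n) - (\<Sum>n. e n * (1/3)^n)"
    unfolding a_def by (rule suminf_diff[symmetric]) (intro sm d e)+
  ultimately show False using close by linarith
qed

text \<open>
  A point is coded by the list of those balls of a countable family that contain it, read as a
  number with gaps between codes. Close codes agree on the first balls, so the points are close: the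
  decoding map is uniformly continuous, and extends continuously to the line. The coding map is only
  Borel measurable.
\<close>

lemma compact_coding:
  fixes K :: "'a::euclidean_space set"
  assumes K: "compact K"
  obtains s :: "'a \<Rightarrow> real" and p :: "real \<Rightarrow> 'a"
  where "s \<in> borel_measurable borel" "\<And>x. 0 \<le> s x \<and> s x \<le> 2" "continuous_on UNIV p"
    "\<And>x. x \<in> K \<Longrightarrow> p (s x) = x"
proof -
  obtain D :: "'a set" where D: "countable D" "\<And>X. open X \<Longrightarrow> X \<noteq> {} \<Longrightarrow> \<exists>d\<in>D. d \<in> X"
    by (rule countable_dense_setE) blast
  have "D \<noteq> {}" using D(2)[of UNIV] by auto
  define q where "q = from_nat_into D"
  define B where "B n = (case prod_decode n of (i, k) \<Rightarrow> ball (q i) (1 / real (Suc k)))" for n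
  define d where "d x n = (indicator (B n) x :: real)" for x n
  define s where "s x = (\<Sum>n. d x n * (1/3)^n)" for x
  have [measurable]: "B n \<in> sets borel" for n by (auto simp: B_def split: prod.split)
  have d01: "d x n \<in> {0, 1}" for x n by (auto simp: d_def indicator_def)
  have geo: "summable (\<lambda>n. (1/3::real)^n)" by (rule summable_geometric) simp
  have sm: "summable (\<lambda>n. d x n * (1/3)^n)" for x
  proof (rule summable_comparison_test'[OF geo, of 0])
    fix n show "norm (d x n * (1/3)^n) \<le> (1/3)^n" using d01[of x n] by auto
  qed
  have s1: "s \<in> borel_measurable borel" unfolding s_def d_def by measurable
  have s2: "0 \<le> s x \<and> s x \<le> 2" for x
  proof
    show "0 \<le> s x" unfolding s_def by (rule suminf_nonneg[OF sm]) (auto simp: d_def)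
    have "s x \<le> (\<Sum>n. (1/3)^n)" unfolding s_def
      by (rule suminf_le[OF _ sm geo]) (auto simp: d_def indicator_def)
    then show "s x \<le> 2" by (simp add: suminf_geometric)
  qed
  have close: "\<exists>\<delta>>0. \<forall>u\<in>K. \<forall>v\<in>K. \<bar>s u - s v\<bar> < \<delta> \<longrightarrow> dist u v < \<epsilon>" if "\<epsilon> > 0" for \<epsilon>
  proof -
    obtain k where k: "2 / real (Suc k) < \<epsilon>"
      using reals_Archimedean[of "\<epsilon> / 2"] \<open>\<epsilon> > 0\<close> by (auto simp: field_simps)
    have "K \<subseteq> (\<Union>i. ball (q i) (1 / real (Suc k)))"
    proof
      fix x
      obtain y where y: "y \<in> D" "y \<in> ball x (1 / real (Suc k))"
        using D(2)[of "ball x (1 / real (Suc k))"] by auto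
      then obtain i where "q i = y"
        using from_nat_into_surj[OF D(1)] unfolding q_def by blast
      then show "x \<in> (\<Union>i. ball (q i) (1 / real (Suc k)))"
        using y by (auto simp: dist_commute)
    qed
    then obtain I where I: "finite I" "K \<subseteq> (\<Union>i\<in>I. ball (q i) (1 / real (Suc k)))"
      using compactE_image[OF K, of UNIV "\<lambda>i. ball (q i) (1 / real (Suc k))"] by auto
    define N where "N = Max (insert 0 ((\<lambda>i. prod_encode (i, k)) ` I))"
    have N: "prod_encode (i, k) \<le> N" if "i \<in> I" for i
      unfolding N_def using that I(1) by (intro Max_ge) auto
    have "dist u v < \<epsilon>" if "u \<in> K" "v \<in> K" "\<bar>s u - s v\<bar> < (1/3)^N / 2" for u v
    proof -
      obtain i where i: "i \<in> I" "u \<in> ball (q i) (1 / real (Suc k))" using I(2) \<open>u \<in> K\<close> by blast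
      have "d u (prod_encode (i, k)) = d v (prod_encode (i, k))"
        by (rule ternary_digits_agree[of _ _ N, OF d01 d01 _ N[OF i(1)]]) (use that(3) in \<open>simp add: s_def\<close>)
      then have "v \<in> ball (q i) (1 / real (Suc k))"
        using i(2) by (auto simp: d_def B_def indicator_def split: if_splits)
      with i(2) have "dist u v < 1 / real (Suc k) + 1 / real (Suc k)"
        unfolding mem_ball by (metis add_strict_mono dist_commute dist_triangle_less_add)
      then show ?thesis using k by simp
    qed
    then show ?thesis by (intro exI[of _ "(1/3)^N / 2"]) auto
  qed
  have inj: "inj_on s K"
  proof (rule inj_onI, rule ccontr)
    fix u v assume "u \<in> K" "v \<in> K" "s u = s v" "u \<noteq> v"
    with close[of "dist u v"] show False by force
  qed
  define t where "t = the_inv_into K s"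
  have t: "t (s x) = x" if "x \<in> K" for x
    unfolding t_def by (rule the_inv_into_f_f[OF inj that])
  have "uniformly_continuous_on (s ` K) t"
    unfolding uniformly_continuous_on_def
  proof (intro allI impI)
    fix \<epsilon> :: real assume "\<epsilon> > 0"
    from close[OF this] obtain \<delta> where "\<delta> > 0" "\<forall>u\<in>K. \<forall>v\<in>K. \<bar>s u - s v\<bar> < \<delta> \<longrightarrow> dist u v < \<epsilon>" by blast
    then show "\<exists>\<delta>>0. \<forall>x\<in>s ` K. \<forall>x'\<in>s ` K. dist x' x < \<delta> \<longrightarrow> dist (t x') (t x) < \<epsilon>"
      by (intro exI[of _ \<delta>]) (auto simp: t dist_real_def)
  qed
  from uniformly_continuous_on_extension_on_closure[OF this] obtain h
    where h: "uniformly_continuous_on (closure (s ` K)) h" "\<And>x. x \<in> s ` K \<Longrightarrow> t x = h x" by metis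
  obtain p where p: "continuous_on UNIV p" "\<And>x. x \<in> closure (s ` K) \<Longrightarrow> p x = h x"
    using Tietze_unbounded[OF uniformly_continuous_imp_continuous[OF h(1)], of UNIV] by auto
  have "p (s x) = x" if "x \<in> K" for x
    using that p(2)[of "s x"] h(2)[of "s x"] t[OF that] closure_subset[of "s ` K"] by auto
  with s1 s2 p(1) that show thesis by blast
qed

lemma integral_restrict_borel_eq:
  assumes "sets \<kappa> = sets (restrict_space borel K)" "\<And>x. x \<in> K \<Longrightarrow> f x = g x"
  shows "(\<integral>x. f x \<partial>\<kappa>) = (\<integral>x. g x \<partial>\<kappa>)"
  by (rule Bochner_Integration.integral_cong[OF refl])
    (use sets_eq_imp_space_eq[OF assms(1)] assms(2) in \<open>auto simp: space_restrict_space\<close>)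

text \<open>
  The coding transports the measures to the line, where Helly's selection theorem applies; the
  continuous decoding map transports the limit back.
\<close>

theorem prob_compact_weakly_sequentially_compact:
  fixes K :: "'a::euclidean_space set" and \<kappa> :: "nat \<Rightarrow> 'a measure"
  assumes K: "compact K" and \<kappa>: "\<And>i. \<kappa> i \<in> space (prob_algebra (restrict_space borel K))"
  obtains r \<kappa>' where "strict_mono r" "\<kappa>' \<in> space (prob_algebra (restrict_space borel K))"
    "\<And>f :: 'a \<Rightarrow> real. continuous_on K f \<Longrightarrow> (\<lambda>i. \<integral>x. f x \<partial>\<kappa> (r i)) \<longlonglongrightarrow> (\<integral>x. f x \<partial>\<kappa>')"
proof -
  obtain s :: "'a \<Rightarrow> real" and p :: "real \<Rightarrow> 'a"
    where s[measurable]: "s \<in> borel_measurable borel" and s2: "\<And>x. 0 \<le> s x \<and> s x \<le> 2"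
      and p: "continuous_on UNIV p" and ps: "\<And>x. x \<in> K \<Longrightarrow> p (s x) = x"
    using compact_coding[OF K] by metis
  have [measurable]: "p \<in> borel_measurable borel" by (rule borel_measurable_continuous_onI[OF p])
  have [measurable_cong]: "sets (\<kappa> i) = sets (restrict_space borel K)" for i
    using \<kappa>[of i] by (simp add: space_prob_algebra)
  have sp: "space (\<kappa> i) = K" for i
    using sets_eq_imp_space_eq[OF \<open>sets (\<kappa> i) = _\<close>] by (simp add: space_restrict_space)
  interpret \<kappa>: prob_space "\<kappa> i" for i using \<kappa>[of i] by (simp add: space_prob_algebra)
  have [measurable]: "s \<in> borel_measurable (\<kappa> i)" for i
    by (subst measurable_cong_sets[OF \<open>sets (\<kappa> i) = _\<close> refl]) (rule measurable_restrict_space1[OF s])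
  define \<rho> where "\<rho> i = distr (\<kappa> i) borel s" for i
  have rd: "real_distribution (\<rho> i)" for i
    unfolding real_distribution_def real_distribution_axioms_def \<rho>_def
    by (auto intro!: \<kappa>.prob_space_distr)
  have "tight \<rho>"
    unfolding tight_def
  proof (intro conjI allI impI rd)
    fix \<epsilon> :: real assume "\<epsilon> > 0"
    have "measure (\<rho> i) {-1<..2} = 1" for i
    proof -
      have "-1 < s x \<and> s x \<le> 2" for x using s2[of x] by linarith
      then have "s -` {-1<..2} \<inter> space (\<kappa> i) = space (\<kappa> i)" by auto
      then show ?thesis by (simp add: \<rho>_def measure_distr \<kappa>.prob_space)
    qed
    with \<open>\<epsilon> > 0\<close> show "\<exists>a b. a < b \<and> (\<forall>n. 1 - \<epsilon> < measure (\<rho> n) {a<..b})"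
      by (intro exI[of _ "-1"] exI[of _ 2]) auto
  qed
  from tight_imp_convergent_subsubsequence[OF this strict_mono_id] obtain r R
    where r: "strict_mono r" and R: "real_distribution R" and conv: "weak_conv_m (\<rho> \<circ> id \<circ> r) R" by blast
  interpret R: real_distribution R by fact
  have lim: "(\<lambda>i. \<integral>x. f (p x) \<partial>\<rho> (r i)) \<longlonglongrightarrow> (\<integral>x. f (p x) \<partial>R)"
    if f: "continuous_on UNIV f" and B: "\<And>x. norm (f x) \<le> B" for f :: "'a \<Rightarrow> real" and B
  proof -
    have "(\<lambda>n. \<integral>x. f (p x) \<partial>((\<rho> \<circ> id \<circ> r) n)) \<longlonglongrightarrow> (\<integral>x. f (p x) \<partial>R)"
    proof (rule weak_conv_imp_integral_bdd_continuous_conv)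
      show "real_distribution ((\<rho> \<circ> id \<circ> r) n)" for n using rd by simp
      have "continuous_on UNIV (\<lambda>x. f (p x))"
        by (rule continuous_on_compose2[OF f p]) simp
      then show "isCont (\<lambda>x. f (p x)) x" for x by (simp add: continuous_on_eq_continuous_at)
    qed (fact R conv B)+
    then show ?thesis by simp
  qed
  have pull: "(\<integral>x. f (p x) \<partial>\<rho> i) = (\<integral>x. f x \<partial>\<kappa> i)" if f: "continuous_on UNIV f" for f :: "'a \<Rightarrow> real" and i
  proof -
    have [measurable]: "f \<in> borel_measurable borel" by (rule borel_measurable_continuous_onI[OF f])
    have "(\<integral>x. f (p x) \<partial>\<rho> i) = (\<integral>x. f (p (s x)) \<partial>\<kappa> i)"
      unfolding \<rho>_def by (subst integral_distr) auto
    also have "\<dots> = (\<integral>x. f x \<partial>\<kappa> i)"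
      by (rule Bochner_Integration.integral_cong) (auto simp: sp ps)
    finally show ?thesis .
  qed
  have Kne: "K \<noteq> {}" using \<kappa>.not_empty[of 0] sp by simp
  then obtain x0 where x0: "x0 \<in> K" by blast
  have Kc: "closed K" using K by (rule compact_imp_closed)
  have [measurable]: "K \<in> sets borel" using Kc by simp
  \<comment> \<open>The mean distance to the closed set passes to the limit, so the limit lives on the set.\<close>
  have inK: "AE x in R. p x \<in> K"
  proof -
    let ?f = "\<lambda>x. min 1 (infdist x K)"
    have f: "continuous_on UNIV ?f" by (intro continuous_intros)
    have "(\<lambda>i. \<integral>x. ?f (p x) \<partial>\<rho> (r i)) \<longlonglongrightarrow> (\<integral>x. ?f (p x) \<partial>R)"
      by (rule lim[OF f, of 1]) (simp add: infdist_nonneg)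
    moreover have "(\<integral>x. ?f (p x) \<partial>\<rho> i) = 0" for i
      unfolding pull[OF f]
      by (subst integral_restrict_borel_eq[of _ K _ "\<lambda>_. 0"]) (auto simp: \<open>sets (\<kappa> i) = _\<close>)
    ultimately have z: "(\<integral>x. ?f (p x) \<partial>R) = 0" by (simp add: LIMSEQ_const_iff)
    have [measurable]: "?f \<in> borel_measurable borel" by (rule borel_measurable_continuous_onI[OF f])
    have "integrable R (\<lambda>x. ?f (p x))"
      by (rule R.integrable_const_bound[of _ 1]) (auto simp: infdist_nonneg)
    then have "AE x in R. ?f (p x) = 0"
      using z by (subst (asm) integral_nonneg_eq_0_iff_AE) (auto simp: infdist_nonneg)
    then show ?thesis
      by eventually_elim (use in_closed_iff_infdist_zero[OF Kc Kne] in \<open>auto simp: min_def split: if_splits\<close>)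
  qed
  define p' where "p' x = (if p x \<in> K then p x else x0)" for x
  have "p' \<in> borel_measurable borel" unfolding p'_def by measurable
  then have p'[measurable]: "p' \<in> measurable borel (restrict_space borel K)"
    by (rule measurable_restrict_space2[rotated]) (simp add: p'_def x0)
  have [measurable]: "p' \<in> measurable R (restrict_space borel K)"
    using p' by (simp cong: measurable_cong_sets)
  define \<kappa>' where "\<kappa>' = distr R (restrict_space borel K) p'"
  have "prob_space \<kappa>'" unfolding \<kappa>'_def by (rule R.prob_space_distr) measurable
  then have \<kappa>': "\<kappa>' \<in> space (prob_algebra (restrict_space borel K))"
    by (simp add: space_prob_algebra \<kappa>'_def)
  have "(\<lambda>i. \<integral>x. f x \<partial>\<kappa> (r i)) \<longlonglongrightarrow> (\<integral>x. f x \<partial>\<kappa>')" if f: "continuous_on K f" for f :: "'a \<Rightarrow> real"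
  proof -
    have "bounded (f ` K)" using compact_continuous_image[OF f K] by (rule compact_imp_bounded)
    then obtain C where C: "\<And>x. x \<in> K \<Longrightarrow> norm (f x) \<le> C" "C > 0"
      unfolding bounded_pos by auto
    obtain g where g: "continuous_on UNIV g" "\<And>x. x \<in> K \<Longrightarrow> g x = f x" "\<And>x. norm (g x) \<le> C"
      using Tietze[OF f, of UNIV C] C Kc by (auto simp: less_imp_le)
    have [measurable]: "g \<in> borel_measurable borel" by (rule borel_measurable_continuous_onI[OF g(1)])
    have "(\<integral>x. f x \<partial>\<kappa> i) = (\<integral>x. g x \<partial>\<kappa> i)" for i
      by (rule integral_restrict_borel_eq) (auto simp: \<open>sets (\<kappa> i) = _\<close> g)
    moreover have "(\<integral>x. f x \<partial>\<kappa>') = (\<integral>x. g (p x) \<partial>R)"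
    proof -
      have "(\<integral>x. f x \<partial>\<kappa>') = (\<integral>x. g x \<partial>\<kappa>')"
        by (rule integral_restrict_borel_eq[of _ K]) (auto simp: \<kappa>'_def g)
      also have "\<dots> = (\<integral>x. g (p' x) \<partial>R)"
        unfolding \<kappa>'_def by (rule integral_distr) (auto intro: measurable_restrict_space1)
      also have "\<dots> = (\<integral>x. g (p x) \<partial>R)"
        by (rule integral_cong_AE) (use inK in \<open>auto simp: p'_def elim!: eventually_mono\<close>)
      finally show ?thesis .
    qed
    ultimately show ?thesis using lim[OF g(1) g(3)] pull[OF g(1)] by simp
  qed
  with r \<kappa>' that show thesis by blast
qed

text \<open>
  The indicator of a closed set is a decreasing limit of continuous functions, and the closed sets
  are a generator that is stable under intersection.
\<close>

lemma prob_eqI_continuous_integrals: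
  fixes K :: "'a::euclidean_space set"
  assumes K: "closed K"
    and \<kappa>: "\<kappa> \<in> space (prob_algebra (restrict_space borel K))" "\<kappa>' \<in> space (prob_algebra (restrict_space borel K))"
    and eq: "\<And>f :: 'a \<Rightarrow> real. continuous_on UNIV f \<Longrightarrow> (\<And>x. 0 \<le> f x \<and> f x \<le> 1) \<Longrightarrow>
       (\<integral>x. f x \<partial>\<kappa>) = (\<integral>x. f x \<partial>\<kappa>')"
  shows "\<kappa> = \<kappa>'"
proof -
  have [measurable_cong]: "sets \<kappa> = sets (restrict_space borel K)" "sets \<kappa>' = sets (restrict_space borel K)"
    using \<kappa> by (auto simp: space_prob_algebra)
  interpret \<kappa>: prob_space \<kappa> using \<kappa> by (simp add: space_prob_algebra)
  interpret \<kappa>': prob_space \<kappa>' using \<kappa> by (simp add: space_prob_algebra)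
  have sp: "space \<kappa> = K" "space \<kappa>' = K"
    using sets_eq_imp_space_eq[OF \<open>sets \<kappa> = _\<close>] sets_eq_imp_space_eq[OF \<open>sets \<kappa>' = _\<close>]
    by (auto simp: space_restrict_space)
  let ?E = "{C \<inter> K | C. closed C}"
  have gen: "sets (restrict_space borel K) = sigma_sets K ?E"
  proof -
    have "sets (restrict_space (sigma UNIV (Collect closed)) K) = sigma_sets K ((\<inter>) K ` Collect closed)"
      using sigma_sets_Int[of K UNIV "Collect closed"] K
      by (simp add: sets_restrict_space sigma_sets.Basic)
    also have "(\<inter>) K ` Collect closed = ?E" by auto
    finally show ?thesis by (simp add: borel_eq_closed)
  qed
  have closed_eq: "measure \<kappa> (C \<inter> K) = measure \<kappa>' (C \<inter> K)" if C: "closed C" for C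
  proof (cases "C = {}")
    case False
    define f where "f n x = max 0 (1 - real n * infdist x C)" for n x
    have f: "continuous_on UNIV (f n)" for n unfolding f_def by (intro continuous_intros)
    have f01: "0 \<le> f n x \<and> f n x \<le> 1" for n x
      by (auto simp: f_def infdist_nonneg)
    have [measurable]: "f n \<in> borel_measurable borel" for n by (rule borel_measurable_continuous_onI[OF f])
    have [measurable]: "C \<in> sets borel" using C by simp
    have lim: "(\<lambda>n. f n x) \<longlonglongrightarrow> indicator C x" for x
    proof (cases "x \<in> C")
      case False
      then have "infdist x C > 0"
        using in_closed_iff_infdist_zero[OF C \<open>C \<noteq> {}\<close>] infdist_nonneg[of x C] by force
      then obtain N where N: "1 < real N * infdist x C" using ex_less_of_nat_mult by blast
      have "f n x = 0" if "n \<ge> N" for n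
        using mult_right_mono[of "real N" "real n" "infdist x C"] that N infdist_nonneg[of x C]
        by (auto simp: f_def)
      then show ?thesis using False by (auto intro!: tendsto_eventually eventually_sequentiallyI)
    qed (simp add: f_def)
    have *: "(\<lambda>n. \<integral>x. f n x \<partial>M) \<longlonglongrightarrow> measure M (C \<inter> K)"
      if M: "prob_space M" "sets M = sets (restrict_space borel K)" "space M = K" for M
    proof -
      interpret prob_space M by fact
      have mm: "h \<in> borel_measurable M" if "h \<in> borel_measurable borel" for h :: "'a \<Rightarrow> real"
        by (subst measurable_cong_sets[OF M(2) refl]) (rule measurable_restrict_space1[OF that])
      have "(\<lambda>n. \<integral>x. f n x \<partial>M) \<longlonglongrightarrow> (\<integral>x. indicator C x \<partial>M)"
        by (rule integral_dominated_convergence[where w="\<lambda>_. 1"])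
          (use f01 lim in \<open>auto intro!: mm\<close>)
      also have "(\<integral>x. indicator C x \<partial>M) = measure M (C \<inter> K)"
        using M(3) by simp
      finally show ?thesis .
    qed
    have "(\<lambda>n. \<integral>x. f n x \<partial>\<kappa>) \<longlonglongrightarrow> measure \<kappa>' (C \<inter> K)"
      using *[OF \<kappa>'.prob_space_axioms \<open>sets \<kappa>' = _\<close> sp(2)] eq[OF f f01] by simp
    then show ?thesis
      using *[OF \<kappa>.prob_space_axioms \<open>sets \<kappa> = _\<close> sp(1)] LIMSEQ_unique by blast
  qed simp
  show ?thesis
  proof (rule measure_eqI_generator_eq[where E="?E" and \<Omega>=K and A="\<lambda>_. K"])
    show "Int_stable ?E"
    proof (rule Int_stableI)
      fix a b assume "a \<in> ?E" "b \<in> ?E"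
      then obtain C D where "a = C \<inter> K" "b = D \<inter> K" "closed C" "closed D" by blast
      then show "a \<inter> b \<in> ?E" by (intro CollectI exI[of _ "C \<inter> D"]) auto
    qed
    show "emeasure \<kappa> X = emeasure \<kappa>' X" if "X \<in> ?E" for X
      using that closed_eq by (auto simp: \<kappa>.emeasure_eq_measure \<kappa>'.emeasure_eq_measure)
    show "range (\<lambda>_. K) \<subseteq> ?E" by (auto intro!: exI[of _ UNIV])
    show "sets \<kappa> = sigma_sets K ?E" "sets \<kappa>' = sigma_sets K ?E"
      using gen \<open>sets \<kappa> = _\<close> \<open>sets \<kappa>' = _\<close> by simp_all
    show "?E \<subseteq> Pow K" by blast
  qed (simp_all add: \<kappa>.emeasure_eq_measure)
qed

section \<open>The action of SL on the sphere\<close>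

lemma SL_one [simp]: "mat 1 \<in> SL" by (simp add: SL_def)

lemma SL_mult: "g \<in> SL \<Longrightarrow> h \<in> SL \<Longrightarrow> g ** h \<in> SL" by (simp add: SL_def det_mul)

lemma SL_vec_nonzero: "g \<in> SL \<Longrightarrow> v \<noteq> 0 \<Longrightarrow> g *v v \<noteq> 0"
  using SL_inverse(4)[of g v] by auto

lemma SL_vec_sphere_nonzero: "g \<in> SL \<Longrightarrow> norm u = 1 \<Longrightarrow> g *v u \<noteq> 0"
  by (metis SL_vec_nonzero norm_zero zero_neq_one)

text \<open>
  Cramer's rule makes the inverse action polynomial in the matrix and the vector, hence jointly
  continuous.
\<close>

lemma matrix_inv_SL_component:
  fixes g :: "real^'m^'m"
  assumes "g \<in> SL"
  shows "matrix_inv g *v u = (\<chi> k. det (\<chi> i j. if j = k then u$i else g$i$j))"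
  using assms cramer[of g "matrix_inv g *v u" u] SL_inverse(5)[OF assms, of u] by (simp add: SL_def)

lemma continuous_on_det_fun:
  fixes f :: "'a::topological_space \<Rightarrow> real^'m^'m"
  assumes "\<And>i j. continuous_on S (\<lambda>x. f x $ i $ j)"
  shows "continuous_on S (\<lambda>x. det (f x))"
  unfolding det_def by (intro continuous_intros assms)

lemma continuous_on_component2:
  "continuous_on S f \<Longrightarrow> continuous_on S (\<lambda>x. f x $ i $ j)"
  for f :: "'a::topological_space \<Rightarrow> real^'m^'n"
  by (intro continuous_on_component)

lemma closed_SL: "closed (SL :: (real^'m^'m) set)"
proof -
  have "continuous_on UNIV (det :: real^'m^'m \<Rightarrow> real)"
    by (rule continuous_on_det_fun[of UNIV "\<lambda>x. x"]) (intro continuous_intros)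
  from continuous_closed_preimage[OF this closed_UNIV, of "{1}"] show ?thesis
    unfolding SL_def by (simp add: vimage_def)
qed

lemma continuous_on_matrix_vector:
  fixes f :: "'a::topological_space \<Rightarrow> real^'m^'n"
  assumes "continuous_on S f" "continuous_on S h"
  shows "continuous_on S (\<lambda>x. f x *v h x)"
  unfolding matrix_vector_mult_def
  by (intro continuous_on_vec_lambda continuous_on_sum continuous_on_mult continuous_on_component2
      continuous_on_component assms)

lemma continuous_on_inv_action:
  "continuous_on (SL \<times> UNIV) (\<lambda>x :: (real^'m^'m) \<times> (real^'m). matrix_inv (fst x) *v snd x)"
proof -
  have "continuous_on (SL \<times> UNIV) (\<lambda>x :: (real^'m^'m) \<times> (real^'m).
      (\<chi> k. det (\<chi> i j. if j = k then snd x $ i else fst x $ i $ j)) :: real^'m)"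
  proof (intro continuous_on_vec_lambda continuous_on_det_fun)
    fix k i j :: 'm
    show "continuous_on (SL \<times> UNIV) (\<lambda>x :: (real^'m^'m) \<times> (real^'m).
        (\<chi> i j. if j = k then snd x $ i else fst x $ i $ j) $ i $ j)"
      by (cases "j = k") (auto intro!: continuous_on_component continuous_on_fst continuous_on_snd continuous_on_id)
  qed
  then show ?thesis
    by (rule continuous_on_eq) (simp add: matrix_inv_SL_component mem_Times_iff)
qed

lemma sphere_act_sgn: "sphere_act g u = sgn (g *v u)"
  by (simp add: sphere_act_def sgn_div_norm)

lemma sphere_act_mult:
  "g \<in> SL \<Longrightarrow> h \<in> SL \<Longrightarrow> norm u = 1 \<Longrightarrow> sphere_act g (sphere_act h u) = sphere_act (g ** h) u"
  using SL_vec_sphere_nonzero[of h u]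
  by (simp add: sphere_act_sgn sgn_div_norm[of "h *v u"] matrix_vector_mult_scaleR sgn_scaleR
      matrix_vector_mul_assoc)

lemma sphere_act_sphere: "g \<in> SL \<Longrightarrow> norm u = 1 \<Longrightarrow> norm (sphere_act g u) = 1"
  using SL_vec_sphere_nonzero[of g u] by (simp add: sphere_act_sgn norm_sgn)

lemma continuous_on_sphere_act_inv:
  "continuous_on (SL \<times> sphere 0 1) (\<lambda>x :: (real^'m^'m) \<times> (real^'m). sphere_act (matrix_inv (fst x)) (snd x))"
  unfolding sphere_act_def
proof (intro continuous_intros continuous_on_subset[OF continuous_on_inv_action] ballI)
  fix x :: "(real^'m^'m) \<times> (real^'m)" assume "x \<in> SL \<times> sphere 0 1"
  then have "matrix_inv (fst x) \<in> SL" "snd x \<noteq> 0" by (auto simp: SL_inverse(3))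
  from SL_vec_nonzero[OF this] show "norm (matrix_inv (fst x) *v snd x) \<noteq> 0" by simp
qed auto

lemma continuous_on_sphere_act:
  assumes "g \<in> SL"
  shows "continuous_on (sphere 0 1) (sphere_act g)"
  unfolding sphere_act_def
  by (intro continuous_intros continuous_on_matrix_vector ballI) (simp add: SL_vec_sphere_nonzero[OF assms])

lemma measurable_sphere_act:
  assumes "g \<in> SL"
  shows "sphere_act g \<in> measurable sphere_borel sphere_borel"
proof (rule measurable_restrict_space2)
  show "sphere_act g \<in> borel_measurable sphere_borel"
    by (rule borel_measurable_continuous_on_restrict[OF continuous_on_sphere_act[OF assms]])
  show "sphere_act g \<in> space sphere_borel \<rightarrow> sphere 0 1"
    by (simp add: space_restrict_space Pi_iff sphere_act_sphere[OF assms])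
qed

lemma prob_sphere_facts:
  assumes "\<kappa> \<in> space (prob_algebra sphere_borel)"
  shows "prob_space \<kappa>" "sets \<kappa> = sets sphere_borel" "space \<kappa> = sphere 0 1"
  using assms sets_eq_imp_space_eq[of \<kappa> sphere_borel] by (auto simp: space_prob_algebra space_restrict_space)

lemma sphere_continuous_integrable:
  fixes f :: "real^'m \<Rightarrow> real"
  assumes \<kappa>: "\<kappa> \<in> space (prob_algebra sphere_borel)" and f: "continuous_on (sphere 0 1) f"
  shows "integrable \<kappa> f"
proof -
  interpret prob_space \<kappa> using prob_sphere_facts[OF \<kappa>] by simp
  have "f \<in> borel_measurable sphere_borel" by (rule borel_measurable_continuous_on_restrict[OF f])
  then have "f \<in> borel_measurable \<kappa>"
    by (simp cong: measurable_cong_sets add: prob_sphere_facts[OF \<kappa>])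
  moreover obtain C where "\<forall>x\<in>sphere 0 1. norm (f x) \<le> C"
    using compact_imp_bounded[OF compact_continuous_image[OF f compact_sphere]] unfolding bounded_iff by auto
  ultimately show ?thesis
    by (intro integrable_const_bound[of _ C]) (auto simp: prob_sphere_facts[OF \<kappa>])
qed

text \<open>
  The integral of \<open>\<phi>\<close> for the image of \<open>\<kappa>\<close> under the inverse of \<open>g\<close>.
\<close>

abbreviation inv_mean :: "(real^'m) measure \<Rightarrow> (real^'m \<Rightarrow> real) \<Rightarrow> real^'m^'m \<Rightarrow> real" where
  "inv_mean \<kappa> \<phi> g \<equiv> \<integral>u. \<phi> (sphere_act (matrix_inv g) u) \<partial>\<kappa>"

text \<open>
  The integrands converge uniformly, because the action of the inverse is uniformly continuous on the
  compact set formed by the matrices \<open>g i\<close>, their limit, and the sphere.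
\<close>

lemma tendsto_integral_sphere_act_inv:
  fixes \<kappa> :: "nat \<Rightarrow> (real^'m) measure" and \<phi> :: "real^'m \<Rightarrow> real"
  assumes \<kappa>: "\<And>i. \<kappa> i \<in> space (prob_algebra sphere_borel)" "\<kappa>' \<in> space (prob_algebra sphere_borel)"
    and conv: "\<And>f :: real^'m \<Rightarrow> real. continuous_on (sphere 0 1) f \<Longrightarrow> (\<lambda>i. \<integral>u. f u \<partial>\<kappa> i) \<longlonglongrightarrow> (\<integral>u. f u \<partial>\<kappa>')"
    and g: "\<And>i. g i \<in> SL" "g \<longlonglongrightarrow> g'" and \<phi>: "continuous_on UNIV \<phi>"
  shows "(\<lambda>i. inv_mean (\<kappa> i) \<phi> (g i)) \<longlonglongrightarrow> inv_mean \<kappa>' \<phi> g'"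
proof -
  let ?\<Psi> = "\<lambda>x. \<phi> (sphere_act (matrix_inv (fst x)) (snd x))"
  have g': "g' \<in> SL" using closed_SL g by (meson closed_sequentially)
  have \<Psi>: "continuous_on (SL \<times> sphere 0 1) ?\<Psi>"
    by (rule continuous_on_compose2[OF \<phi> continuous_on_sphere_act_inv]) simp
  let ?C = "insert g' (range g) \<times> (sphere 0 1 :: (real^'m) set)"
  have "compact ?C" by (intro compact_Times compact_sequence_with_limit[OF g(2)] compact_sphere)
  moreover have "continuous_on ?C ?\<Psi>" by (rule continuous_on_subset[OF \<Psi>]) (use g g' in auto)
  ultimately have uc: "uniformly_continuous_on ?C ?\<Psi>" by (intro compact_uniformly_continuous)
  have cont: "continuous_on (sphere 0 1) (\<lambda>u. \<phi> (sphere_act (matrix_inv h) u))" if "h \<in> SL" for h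
    by (rule continuous_on_compose2[OF \<phi> continuous_on_sphere_act]) (use that in \<open>auto intro: SL_inverse\<close>)
  have "(\<lambda>i. inv_mean (\<kappa> i) \<phi> (g i) - inv_mean (\<kappa> i) \<phi> g') \<longlonglongrightarrow> 0"
  proof (rule LIMSEQ_I)
    fix e :: real assume "e > 0"
    then have "e / 2 > 0" by simp
    with uc obtain d where d: "d > 0"
      "\<And>x x'. x \<in> ?C \<Longrightarrow> x' \<in> ?C \<Longrightarrow> dist x' x < d \<Longrightarrow> dist (?\<Psi> x') (?\<Psi> x) < e / 2"
      unfolding uniformly_continuous_on_def by metis
    from metric_LIMSEQ_D[OF g(2) d(1)] obtain N where N: "\<And>i. i \<ge> N \<Longrightarrow> dist (g i) g' < d" by auto
    have "norm (inv_mean (\<kappa> i) \<phi> (g i) - inv_mean (\<kappa> i) \<phi> g' - 0) < e"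
      if i: "i \<ge> N" for i
    proof -
      interpret prob_space "\<kappa> i" using prob_sphere_facts[OF \<kappa>(1)] by simp
      let ?D = "\<lambda>u. \<phi> (sphere_act (matrix_inv (g i)) u) - \<phi> (sphere_act (matrix_inv g') u)"
      note int = sphere_continuous_integrable[OF \<kappa>(1) cont]
      have "\<bar>?D u\<bar> \<le> e / 2" if "u \<in> space (\<kappa> i)" for u
      proof -
        have "u \<in> sphere 0 1" using that by (simp add: prob_sphere_facts[OF \<kappa>(1)])
        with d(2)[of "(g', u)" "(g i, u)"] N[OF i] show ?thesis
          by (auto simp: dist_Pair_Pair dist_real_def)
      qed
      then have "\<bar>\<integral>u. ?D u \<partial>\<kappa> i\<bar> \<le> e / 2"
        using integral_abs_bound[of "\<kappa> i" ?D] integral_le_const[of "\<lambda>u. \<bar>?D u\<bar>" "e / 2"]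
          int[OF g(1)] int[OF g'] by (auto intro: order_trans)
      then show ?thesis using int[OF g(1)[of i], of i] int[OF g', of i] \<open>e > 0\<close> by simp
    qed
    then show "\<exists>N. \<forall>i\<ge>N. norm (inv_mean (\<kappa> i) \<phi> (g i) - inv_mean (\<kappa> i) \<phi> g' - 0) < e"
      by blast
  qed
  from tendsto_add[OF this conv[OF cont[OF g']]] show ?thesis by simp
qed

lemma subgroup_stabiliser:
  assumes \<kappa>: "\<kappa> \<in> space (prob_algebra sphere_borel)"
  defines "H \<equiv> {g :: real^'m^'m. g \<in> SL \<and> distr \<kappa> sphere_borel (sphere_act g) = \<kappa>}"
  shows "subgroup H SL_group" "closed H"
proof -
  note k = prob_sphere_facts[OF \<kappa>]
  have meas: "sphere_act g \<in> measurable \<kappa> sphere_borel" if "g \<in> SL" for g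
    using measurable_sphere_act[OF that] by (simp cong: measurable_cong_sets add: k)
  have comp: "distr \<kappa> sphere_borel (sphere_act (g ** h)) = distr (distr \<kappa> sphere_borel (sphere_act h)) sphere_borel (sphere_act g)"
    if "g \<in> SL" "h \<in> SL" for g h :: "real^'m^'m"
  proof -
    have "distr (distr \<kappa> sphere_borel (sphere_act h)) sphere_borel (sphere_act g)
        = distr \<kappa> sphere_borel (sphere_act g \<circ> sphere_act h)"
      by (rule distr_distr[OF measurable_sphere_act meas]) (use that in auto)
    also have "\<dots> = distr \<kappa> sphere_borel (sphere_act (g ** h))"
      by (rule distr_cong) (use that in \<open>simp_all add: k sphere_act_mult\<close>)
    finally show ?thesis by simp
  qed
  have one: "distr \<kappa> sphere_borel (sphere_act (mat 1)) = \<kappa>"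
  proof -
    have "distr \<kappa> sphere_borel (sphere_act (mat 1)) = distr \<kappa> \<kappa> (\<lambda>x. x)"
      by (rule distr_cong) (auto simp: k sphere_act_def)
    then show ?thesis by simp
  qed
  have inv: "inv\<^bsub>SL_group\<^esub> g = matrix_inv g" if "g \<in> SL" for g :: "real^'m^'m"
    by (rule group.inv_equality[OF group_SL_group]) (use SL_inverse[OF that] that in \<open>auto simp: SL_group_def\<close>)
  show "subgroup H SL_group"
  proof
    show "H \<subseteq> carrier SL_group" by (auto simp: H_def SL_group_def)
    show "x \<otimes>\<^bsub>SL_group\<^esub> y \<in> H" if "x \<in> H" "y \<in> H" for x y
      using that by (auto simp: H_def SL_group_def SL_mult comp)
    show "\<one>\<^bsub>SL_group\<^esub> \<in> H" by (simp add: H_def SL_group_def one)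
    show "inv\<^bsub>SL_group\<^esub> x \<in> H" if "x \<in> H" for x
    proof -
      from that have x: "x \<in> SL" "distr \<kappa> sphere_borel (sphere_act x) = \<kappa>" by (auto simp: H_def)
      have "distr \<kappa> sphere_borel (sphere_act (matrix_inv x)) = \<kappa>"
        using comp[of "matrix_inv x" x] x SL_inverse[OF x(1)] one by simp
      then show ?thesis using x by (simp add: inv H_def SL_inverse)
    qed
  qed
  show "closed H"
    unfolding closed_sequential_limits
  proof (intro allI impI)
    fix g l assume gl: "(\<forall>n. g n \<in> H) \<and> g \<longlonglongrightarrow> l"
    then have g: "\<And>n. g n \<in> SL" "\<And>n. distr \<kappa> sphere_borel (sphere_act (g n)) = \<kappa>" by (auto simp: H_def)
    have l: "l \<in> SL" using closed_SL g gl by (meson closed_sequentially)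
    interpret prob_space \<kappa> using k by simp
    have "distr \<kappa> sphere_borel (sphere_act l) = \<kappa>"
    proof (rule prob_eqI_continuous_integrals[where K="sphere 0 1"])
      show "distr \<kappa> sphere_borel (sphere_act l) \<in> space (prob_algebra sphere_borel)"
        using prob_space_distr[OF meas[OF l]] by (simp add: space_prob_algebra)
      fix f :: "real^'m \<Rightarrow> real" assume f: "continuous_on UNIV f" "\<And>x. 0 \<le> f x \<and> f x \<le> 1"
      have fm: "f \<in> borel_measurable sphere_borel"
        by (intro measurable_restrict_space1 borel_measurable_continuous_onI f)
      have "(\<lambda>n. \<integral>u. f (sphere_act (g n) u) \<partial>\<kappa>) \<longlonglongrightarrow> (\<integral>u. f (sphere_act l u) \<partial>\<kappa>)"
      proof (rule integral_dominated_convergence[where w="\<lambda>_. 1"])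
        show "AE u in \<kappa>. (\<lambda>n. f (sphere_act (g n) u)) \<longlonglongrightarrow> f (sphere_act l u)"
        proof (rule AE_I2)
          fix u assume "u \<in> space \<kappa>"
          then have "u \<noteq> 0" by (auto simp: k)
          then have "l *v u \<noteq> 0" by (rule SL_vec_nonzero[OF l])
          have "(\<lambda>n. g n *v u) \<longlonglongrightarrow> l *v u"
          proof -
            have "continuous_on UNIV (\<lambda>h :: real^'m^'m. h *v u)"
              by (intro continuous_on_matrix_vector continuous_intros)
            from continuous_on_tendsto_compose[OF this conjunct2[OF gl]] show ?thesis by simp
          qed
          then have "(\<lambda>n. sphere_act (g n) u) \<longlonglongrightarrow> sphere_act l u"
            unfolding sphere_act_def using \<open>l *v u \<noteq> 0\<close> by (intro tendsto_intros) auto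
          then show "(\<lambda>n. f (sphere_act (g n) u)) \<longlonglongrightarrow> f (sphere_act l u)"
            by (rule continuous_on_tendsto_compose[OF f(1)]) auto
        qed
      qed (use f g l meas fm in \<open>auto intro: measurable_compose\<close>)
      moreover have "(\<integral>u. f (sphere_act h u) \<partial>\<kappa>) = (\<integral>u. f u \<partial>distr \<kappa> sphere_borel (sphere_act h))" if "h \<in> SL" for h
        by (rule integral_distr[symmetric, OF meas[OF that] fm])
      ultimately show "(\<integral>u. f u \<partial>distr \<kappa> sphere_borel (sphere_act l)) = (\<integral>u. f u \<partial>\<kappa>)"
        using g l by (simp add: LIMSEQ_const_iff)
    qed (use \<kappa> in auto)
    then show "l \<in> H" using l by (simp add: H_def)
  qed
qed

text \<open>
  If the images of \<open>\<kappa>\<close> under the inverses of two matrices \<open>g\<close> and \<open>h\<close> of the support coincide, then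
  \<open>g h\<^sup>-\<^sup>1\<close> preserves \<open>\<kappa>\<close>; and the stabiliser of \<open>\<kappa>\<close> is a closed subgroup, so it contains the
  closed group generated by these products.
\<close>

lemma preserves_closed_group:
  fixes \<nu> :: "(real^'m^'m) measure"
  assumes \<kappa>: "\<kappa> \<in> space (prob_algebra sphere_borel)"
    and eq: "\<And>g h \<phi>. g \<in> supp_SL \<nu> \<Longrightarrow> h \<in> supp_SL \<nu> \<Longrightarrow> continuous_on (UNIV :: (real^'m) set) \<phi> \<Longrightarrow>
      (\<And>x. 0 \<le> \<phi> x \<and> \<phi> x \<le> (1::real)) \<Longrightarrow>
      inv_mean \<kappa> \<phi> g = inv_mean \<kappa> \<phi> h"
  shows "preserves (closed_group_of \<nu>) \<kappa>"
proof -
  note k = prob_sphere_facts[OF \<kappa>]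
  interpret prob_space \<kappa> using k by simp
  let ?H = "{g :: real^'m^'m. g \<in> SL \<and> distr \<kappa> sphere_borel (sphere_act g) = \<kappa>}"
  have meas: "sphere_act g \<in> measurable \<kappa> sphere_borel" if "g \<in> SL" for g
    using measurable_sphere_act[OF that] by (simp cong: measurable_cong_sets add: k)
  have "closed_group_of \<nu> \<subseteq> ?H"
    unfolding closed_group_of_def
  proof (rule hull_minimal)
    show "subgroup ?H SL_group \<and> closed ?H" using subgroup_stabiliser[OF \<kappa>] by simp
    have "g ** matrix_inv h \<in> ?H" if gh: "g \<in> supp_SL \<nu>" "h \<in> supp_SL \<nu>" for g h
    proof -
      have SL: "g \<in> SL" "h \<in> SL" using gh by (auto simp: supp_SL_def)
      note inv = SL_inverse[OF SL(1)] SL_inverse[OF SL(2)]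
      have SL': "g ** matrix_inv h \<in> SL" using SL inv by (simp add: SL_mult)
      have "\<kappa> = distr \<kappa> sphere_borel (sphere_act (g ** matrix_inv h))"
      proof (rule prob_eqI_continuous_integrals[where K="sphere 0 1"])
        show "distr \<kappa> sphere_borel (sphere_act (g ** matrix_inv h)) \<in> space (prob_algebra sphere_borel)"
          using prob_space_distr[OF meas[OF SL']] by (simp add: space_prob_algebra)
        fix f :: "real^'m \<Rightarrow> real" assume f: "continuous_on UNIV f" "\<And>x. 0 \<le> f x \<and> f x \<le> 1"
        have fm: "f \<in> borel_measurable sphere_borel"
          by (intro measurable_restrict_space1 borel_measurable_continuous_onI f)
        have "continuous_on (sphere 0 1) (\<lambda>u. f (sphere_act g u))"
          by (rule continuous_on_compose2[OF f(1) continuous_on_sphere_act[OF SL(1)]]) simp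
        \<comment> \<open>The hypothesis is applied to the test function composed with the action of \<open>g\<close>.\<close>
        from Tietze_closed_interval_1[OF this, of UNIV 0 1] f(2) obtain \<phi> where
          \<phi>: "continuous_on UNIV \<phi>" "\<And>u. u \<in> sphere 0 1 \<Longrightarrow> \<phi> u = f (sphere_act g u)" "\<And>x. \<phi> x \<in> {0..1}"
          by (auto simp: cbox_interval)
        have *: "inv_mean \<kappa> \<phi> a = (\<integral>u. f (sphere_act (g ** matrix_inv a) u) \<partial>\<kappa>)"
          if "a \<in> SL" for a
          using SL_inverse[OF that] SL(1)
          by (intro Bochner_Integration.integral_cong)
            (simp_all add: k \<phi>(2) sphere_act_sphere sphere_act_mult)
        have "(\<integral>u. f u \<partial>\<kappa>) = (\<integral>u. f (sphere_act (mat 1) u) \<partial>\<kappa>)"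
          by (rule Bochner_Integration.integral_cong) (auto simp: k sphere_act_def)
        also have "\<dots> = inv_mean \<kappa> \<phi> g"
          using *[OF SL(1)] inv by simp
        also have "\<dots> = inv_mean \<kappa> \<phi> h"
          by (rule eq[OF gh \<phi>(1)]) (use \<phi>(3) in auto)
        also have "\<dots> = (\<integral>u. f (sphere_act (g ** matrix_inv h) u) \<partial>\<kappa>)"
          by (rule *[OF SL(2)])
        also have "\<dots> = (\<integral>u. f u \<partial>distr \<kappa> sphere_borel (sphere_act (g ** matrix_inv h)))"
          by (rule integral_distr[symmetric, OF meas[OF SL'] fm])
        finally show "(\<integral>u. f u \<partial>\<kappa>) = (\<integral>u. f u \<partial>distr \<kappa> sphere_borel (sphere_act (g ** matrix_inv h)))" .
      qed (use \<kappa> in auto)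
      then show ?thesis using SL' by simp
    qed
    then show "{g ** matrix_inv h |g h. g \<in> supp_SL \<nu> \<and> h \<in> supp_SL \<nu>} \<subseteq> ?H" by blast
  qed
  then show ?thesis unfolding preserves_def by blast
qed

section \<open>Half-densities\<close>

lemma homogeneous_measurable [measurable_dest]: "homogeneous p f \<Longrightarrow> f \<in> borel_measurable borel"
  by (simp add: homogeneous_def)

lemma homogeneous_scale: "homogeneous p f \<Longrightarrow> t > 0 \<Longrightarrow> f (t *\<^sub>R v) = ennreal (t powr p) * f v"
  by (simp add: homogeneous_def)

lemma homogeneous_mult:
  assumes "homogeneous p f" "homogeneous q h"
  shows "homogeneous (p + q) (\<lambda>v. f v * h v)"
  unfolding homogeneous_def
proof (intro conjI allI impI)
  show "(\<lambda>v. f v * h v) \<in> borel_measurable borel"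
    using assms by (intro borel_measurable_times_ennreal) (auto simp: homogeneous_def)
  fix t :: real and v assume "t > 0"
  have "ennreal (t powr (p + q)) = ennreal (t powr p) * ennreal (t powr q)"
    by (simp add: powr_add ennreal_mult)
  moreover have "f (t *\<^sub>R v) * h (t *\<^sub>R v) = (ennreal (t powr p) * f v) * (ennreal (t powr q) * h v)"
    using \<open>t > 0\<close> by (simp only: homogeneous_scale[OF assms(1)] homogeneous_scale[OF assms(2)])
  moreover have "(a * x) * (b * y) = (a * b) * (x * y)" for a b x y :: ennreal
    by (simp only: ac_simps)
  ultimately show "f (t *\<^sub>R v) * h (t *\<^sub>R v) = ennreal (t powr (p + q)) * (f v * h v)"
    by presburger
qed

lemma homogeneous_square: "homogeneous p f \<Longrightarrow> homogeneous (2 * p) (\<lambda>v. (f v)\<^sup>2)"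
  unfolding mult_2 power2_eq_square by (rule homogeneous_mult)

lemma homogeneous_cmult: "homogeneous p f \<Longrightarrow> homogeneous p (\<lambda>v. a * f v)"
  unfolding homogeneous_def by (auto simp: mult.left_commute)

text \<open>
  The square of a function homogeneous of degree \<open>- m / 2\<close> has degree \<open>- m\<close>, the degree for which
  integrals over the shell are invariant under matrices of determinant 1.
\<close>

abbreviation half_density :: "(real^'m \<Rightarrow> ennreal) \<Rightarrow> bool" where
  "half_density \<equiv> homogeneous (- real CARD('m) / 2)"

abbreviation sq_norm :: "(real^'m \<Rightarrow> ennreal) \<Rightarrow> ennreal" where
  "sq_norm b \<equiv> \<integral>\<^sup>+v. (b v)\<^sup>2 \<partial>shell"

abbreviation average :: "(real^'m^'m) measure \<Rightarrow> (real^'m \<Rightarrow> ennreal) \<Rightarrow> real^'m \<Rightarrow> ennreal" where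
  "average \<nu> b \<equiv> \<lambda>v. \<integral>\<^sup>+g. b (g *v v) \<partial>\<nu>"

lemma half_density_isometry:
  fixes b :: "real^'m \<Rightarrow> ennreal"
  assumes "half_density b" "g \<in> SL"
  shows "(\<integral>\<^sup>+v. (b (g *v v))\<^sup>2 \<partial>shell) = sq_norm b"
proof (rule nn_integral_shell_SL[OF _ assms(2), of "\<lambda>v. (b v)\<^sup>2"])
  show "homogeneous (- real CARD('m)) (\<lambda>v. (b v)\<^sup>2)"
    using homogeneous_square[OF assms(1)] by simp
qed

lemma AE_shell_nonzero: "AE v in shell. v \<noteq> (0::real^'m)"
  using AE_shell_annulus by eventually_elim (auto simp: annulus_def)

text \<open>
  The value at 0 is an arbitrary unit vector, so that the map goes to the sphere everywhere.
\<close>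

definition direction :: "real^'m \<Rightarrow> real^'m" where
  "direction v = (if v = 0 then axis undefined 1 else sgn v)"

lemma norm_direction [simp]: "norm (direction v) = 1"
  by (simp add: direction_def norm_sgn)

lemma measurable_sgn_vec [measurable]: "sgn \<in> borel_measurable (borel :: (real^'m) measure)"
proof -
  have "(\<lambda>v::real^'m. v /\<^sub>R norm v) \<in> borel_measurable borel" by measurable
  then show ?thesis by (simp add: sgn_div_norm[abs_def])
qed

lemma measurable_direction [measurable]: "direction \<in> measurable borel sphere_borel"
proof (rule measurable_restrict_space2)
  show "direction \<in> borel_measurable (borel :: (real^'m) measure)"
    unfolding direction_def[abs_def] by measurable
qed simp

text \<open>
  For a unit half-density \<open>b\<close>, these are the measures whose near invariance under the matrices
  expresses that the translates of \<open>b\<close> almost coincide.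
\<close>

definition sphere_law :: "(real^'m \<Rightarrow> ennreal) \<Rightarrow> (real^'m) measure" where
  "sphere_law b = distr (density shell (\<lambda>v. (b v)\<^sup>2)) sphere_borel direction"

lemma sphere_law_prob:
  assumes b: "half_density b" "sq_norm b = 1"
  shows "sphere_law b \<in> space (prob_algebra sphere_borel)"
proof -
  have [measurable]: "b \<in> borel_measurable borel" using b by (simp add: homogeneous_def)
  have "prob_space (density shell (\<lambda>v. (b v)\<^sup>2))"
    by (rule prob_spaceI) (simp add: emeasure_density b)
  then have "prob_space (sphere_law b)"
    unfolding sphere_law_def by (rule prob_space.prob_space_distr) simp
  then show ?thesis by (simp add: space_prob_algebra sphere_law_def)
qed

lemma sgn_matrix_sgn: "v \<noteq> 0 \<Longrightarrow> sgn (A *v sgn v) = sgn (A *v v)" for A :: "real^'m^'m"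
  by (simp add: sgn_div_norm[of v] matrix_vector_mult_scaleR sgn_scaleR)

text \<open>
  Moving the measure by the inverse of \<open>g\<close> amounts to composing the half-density with \<open>g\<close>: the
  integrand is homogeneous of degree \<open>- m\<close>, so \<open>g\<close> can be substituted in the integral over the shell.
\<close>

lemma integral_sphere_law_act_inv:
  fixes b :: "real^'m \<Rightarrow> ennreal" and \<phi> :: "real^'m \<Rightarrow> real"
  assumes b: "half_density b" "sq_norm b = 1" and g: "g \<in> SL"
    and [measurable]: "\<phi> \<in> borel_measurable borel" and \<phi>: "\<And>x. 0 \<le> \<phi> x \<and> \<phi> x \<le> 1"
  shows "inv_mean (sphere_law b) \<phi> g
     = enn2real (\<integral>\<^sup>+v. ennreal (\<phi> (sgn v)) * (b (g *v v))\<^sup>2 \<partial>shell)"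
proof -
  have [measurable]: "b \<in> borel_measurable borel" using b by (simp add: homogeneous_def)
  note gi = SL_inverse[OF g]
  interpret prob_space "sphere_law b" using prob_sphere_facts[OF sphere_law_prob[OF b]] by simp
  have \<phi>m: "(\<lambda>u. \<phi> (sphere_act (matrix_inv g) u)) \<in> borel_measurable sphere_borel"
  proof -
    have "sphere_act (matrix_inv g) \<in> measurable sphere_borel borel"
      using measurable_sphere_act[OF gi(3)] by (simp add: measurable_restrict_space2_iff)
    then show ?thesis by measurable
  qed
  then have \<phi>m': "(\<lambda>u. \<phi> (sphere_act (matrix_inv g) u)) \<in> borel_measurable (sphere_law b)"
    by (simp add: sphere_law_def)
  have "inv_mean (sphere_law b) \<phi> g
      = enn2real (\<integral>\<^sup>+u. ennreal (\<phi> (sphere_act (matrix_inv g) u)) \<partial>sphere_law b)"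
    by (rule integral_eq_nn_integral[OF \<phi>m']) (simp add: \<phi>)
  also have "(\<integral>\<^sup>+u. ennreal (\<phi> (sphere_act (matrix_inv g) u)) \<partial>sphere_law b)
      = (\<integral>\<^sup>+v. (b v)\<^sup>2 * ennreal (\<phi> (sphere_act (matrix_inv g) (direction v))) \<partial>shell)"
  proof -
    have "(\<lambda>v. \<phi> (sphere_act (matrix_inv g) (direction v))) \<in> borel_measurable borel"
      by (rule measurable_compose[OF measurable_direction \<phi>m])
    then show ?thesis
      unfolding sphere_law_def using \<phi>m by (simp add: nn_integral_distr nn_integral_density)
  qed
  also have "\<dots> = (\<integral>\<^sup>+v. ennreal (\<phi> (sgn (matrix_inv g *v v))) * (b v)\<^sup>2 \<partial>shell)"
    by (rule nn_integral_cong_AE, use AE_shell_nonzero in eventually_elim)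
      (simp add: direction_def sphere_act_sgn sgn_matrix_sgn mult.commute)
  also have "\<dots> = (\<integral>\<^sup>+v. ennreal (\<phi> (sgn (matrix_inv g *v (g *v v)))) * (b (g *v v))\<^sup>2 \<partial>shell)"
  proof (rule nn_integral_shell_SL[OF _ g, symmetric])
    have "homogeneous 0 (\<lambda>v. ennreal (\<phi> (sgn (matrix_inv g *v v))))"
      unfolding homogeneous_def by (auto simp: matrix_vector_mult_scaleR sgn_scaleR)
    from homogeneous_mult[OF this homogeneous_square[OF b(1)]]
    show "homogeneous (- real CARD('m)) (\<lambda>v. ennreal (\<phi> (sgn (matrix_inv g *v v))) * (b v)\<^sup>2)" by simp
  qed
  finally show ?thesis by (simp add: gi)
qed

lemma integral_Cauchy_Schwarz:
  fixes f h :: "'a \<Rightarrow> real"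
  assumes [measurable]: "f \<in> borel_measurable M" "h \<in> borel_measurable M"
    and int: "integrable M (\<lambda>x. (f x)\<^sup>2)" "integrable M (\<lambda>x. (h x)\<^sup>2)"
  shows "integrable M (\<lambda>x. f x * h x)" "(\<integral>x. \<bar>f x * h x\<bar> \<partial>M)\<^sup>2 \<le> (\<integral>x. (f x)\<^sup>2 \<partial>M) * (\<integral>x. (h x)\<^sup>2 \<partial>M)"
proof -
  show i: "integrable M (\<lambda>x. f x * h x)"
  proof (rule Bochner_Integration.integrable_bound[OF Bochner_Integration.integrable_add[OF int]])
    show "AE x in M. norm (f x * h x) \<le> norm ((f x)\<^sup>2 + (h x)\<^sup>2)"
    proof (rule AE_I2)
      fix x
      have "0 \<le> (\<bar>f x\<bar> - \<bar>h x\<bar>)\<^sup>2" by simp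
      then have "2 * (\<bar>f x\<bar> * \<bar>h x\<bar>) \<le> (f x)\<^sup>2 + (h x)\<^sup>2" by (simp add: power2_diff)
      moreover have "0 \<le> \<bar>f x\<bar> * \<bar>h x\<bar>" by simp
      ultimately have "\<bar>f x\<bar> * \<bar>h x\<bar> \<le> (f x)\<^sup>2 + (h x)\<^sup>2" by linarith
      then show "norm (f x * h x) \<le> norm ((f x)\<^sup>2 + (h x)\<^sup>2)" by (simp add: abs_mult)
    qed
  qed measurable
  have "(\<integral>\<^sup>+x. ennreal \<bar>f x\<bar> * ennreal \<bar>h x\<bar> \<partial>M)\<^sup>2 \<le> (\<integral>\<^sup>+x. (ennreal \<bar>f x\<bar>)\<^sup>2 \<partial>M) * (\<integral>\<^sup>+x. (ennreal \<bar>h x\<bar>)\<^sup>2 \<partial>M)"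
    by (rule Cauchy_Schwarz_nn_integral) auto
  also have "(\<integral>\<^sup>+x. ennreal \<bar>f x\<bar> * ennreal \<bar>h x\<bar> \<partial>M) = ennreal (\<integral>x. \<bar>f x * h x\<bar> \<partial>M)"
    using nn_integral_eq_integral[OF integrable_abs[OF i]] by (simp add: ennreal_mult abs_mult)
  also have "(\<integral>\<^sup>+x. (ennreal \<bar>f x\<bar>)\<^sup>2 \<partial>M) = ennreal (\<integral>x. (f x)\<^sup>2 \<partial>M)"
    using nn_integral_eq_integral[OF int(1)] by (simp add: ennreal_power)
  also have "(\<integral>\<^sup>+x. (ennreal \<bar>h x\<bar>)\<^sup>2 \<partial>M) = ennreal (\<integral>x. (h x)\<^sup>2 \<partial>M)"
    using nn_integral_eq_integral[OF int(2)] by (simp add: ennreal_power)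
  finally show "(\<integral>x. \<bar>f x * h x\<bar> \<partial>M)\<^sup>2 \<le> (\<integral>x. (f x)\<^sup>2 \<partial>M) * (\<integral>x. (h x)\<^sup>2 \<partial>M)"
    by (simp add: ennreal_power ennreal_mult[symmetric] Bochner_Integration.integral_nonneg)
qed

text \<open>
  Two unit vectors of \<open>L\<^sup>2\<close> with inner product close to 1 define probability densities \<open>x\<^sup>2\<close> and \<open>y\<^sup>2\<close>
  that are close in total variation: factor \<open>x\<^sup>2 - y\<^sup>2 = (x - y) (x + y)\<close> and apply the
  Cauchy-Schwarz inequality. The squared norms of the two factors are \<open>2 - 2 I\<close> and \<open>2 + 2 I\<close>, where
  \<open>I\<close> is the inner product.
\<close>

lemma square_density_distance:
  fixes x y :: "'a \<Rightarrow> ennreal" and \<phi> :: "'a \<Rightarrow> real"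
  assumes [measurable]: "x \<in> borel_measurable M" "y \<in> borel_measurable M" "\<phi> \<in> borel_measurable M"
    and x: "(\<integral>\<^sup>+v. (x v)\<^sup>2 \<partial>M) = 1" and y: "(\<integral>\<^sup>+v. (y v)\<^sup>2 \<partial>M) = 1" and \<phi>: "\<And>v. 0 \<le> \<phi> v \<and> \<phi> v \<le> 1"
  shows "(enn2real (\<integral>\<^sup>+v. ennreal (\<phi> v) * (x v)\<^sup>2 \<partial>M) - enn2real (\<integral>\<^sup>+v. ennreal (\<phi> v) * (y v)\<^sup>2 \<partial>M))\<^sup>2
     \<le> 4 * (1 - (enn2real (\<integral>\<^sup>+v. x v * y v \<partial>M))\<^sup>2)"
proof -
  define x' y' where "x' v = enn2real (x v)" and "y' v = enn2real (y v)" for v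
  have [measurable]: "x' \<in> borel_measurable M" "y' \<in> borel_measurable M" by (auto simp: x'_def[abs_def] y'_def[abs_def])
  have nn: "x' v \<ge> 0" "y' v \<ge> 0" for v by (auto simp: x'_def y'_def)
  have fin: "AE v in M. z v = ennreal (enn2real (z v))" if [measurable]: "z \<in> borel_measurable M" and "(\<integral>\<^sup>+v. (z v)\<^sup>2 \<partial>M) = 1" for z
  proof -
    have "AE v in M. (z v)\<^sup>2 \<noteq> \<infinity>" by (rule nn_integral_PInf_AE) (use that(2) in auto)
    then show ?thesis by eventually_elim (auto simp: ennreal_enn2real_if)
  qed
  have ax: "AE v in M. x v = ennreal (x' v)" and ay: "AE v in M. y v = ennreal (y' v)"
    unfolding x'_def y'_def by (auto intro!: fin x y)
  have sq: "integrable M (\<lambda>v. (z v)\<^sup>2) \<and> (\<integral>v. (z v)\<^sup>2 \<partial>M) = 1"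
    if [measurable]: "z \<in> borel_measurable M" and z: "AE v in M. w v = ennreal (z v)" "(\<integral>\<^sup>+v. (w v)\<^sup>2 \<partial>M) = 1" "\<And>v. z v \<ge> 0" for z w
  proof -
    have "(\<integral>\<^sup>+v. ennreal ((z v)\<^sup>2) \<partial>M) = (\<integral>\<^sup>+v. (w v)\<^sup>2 \<partial>M)"
      by (rule nn_integral_cong_AE, use z(1) in eventually_elim) (simp add: ennreal_power z)
    then have *: "(\<integral>\<^sup>+v. ennreal ((z v)\<^sup>2) \<partial>M) = ennreal 1" using z by simp
    have "integrable M (\<lambda>v. (z v)\<^sup>2)" by (rule integrableI_nn_integral_finite[OF _ _ *]) auto
    moreover have "(\<integral>v. (z v)\<^sup>2 \<partial>M) = 1" using * by (subst integral_eq_nn_integral) auto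
    ultimately show ?thesis by simp
  qed
  note sx = sq[OF _ ax x nn(1)] and sy = sq[OF _ ay y nn(2)]
  have ix: "integrable M (\<lambda>v. (x' v)\<^sup>2)" and iy: "integrable M (\<lambda>v. (y' v)\<^sup>2)" using sx sy by auto
  have ixy: "integrable M (\<lambda>v. x' v * y' v)" by (rule integral_Cauchy_Schwarz) (use ix iy in auto)
  define I where "I = (\<integral>v. x' v * y' v \<partial>M)"
  have I: "enn2real (\<integral>\<^sup>+v. x v * y v \<partial>M) = I"
  proof -
    have "(\<integral>\<^sup>+v. x v * y v \<partial>M) = (\<integral>\<^sup>+v. ennreal (x' v * y' v) \<partial>M)"
      by (rule nn_integral_cong_AE, use ax ay in eventually_elim) (simp add: ennreal_mult nn)
    then show ?thesis unfolding I_def by (subst integral_eq_nn_integral) (auto simp: nn)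
  qed
  have w: "enn2real (\<integral>\<^sup>+v. ennreal (\<phi> v) * (w v)\<^sup>2 \<partial>M) = (\<integral>v. \<phi> v * (z v)\<^sup>2 \<partial>M)"
    if [measurable]: "z \<in> borel_measurable M" and z: "AE v in M. w v = ennreal (z v)" "\<And>v. z v \<ge> 0" for z w
  proof -
    have "(\<integral>\<^sup>+v. ennreal (\<phi> v) * (w v)\<^sup>2 \<partial>M) = (\<integral>\<^sup>+v. ennreal (\<phi> v * (z v)\<^sup>2) \<partial>M)"
      by (rule nn_integral_cong_AE, use z(1) in eventually_elim) (simp add: ennreal_mult \<phi> ennreal_power z)
    then show ?thesis by (subst integral_eq_nn_integral) (auto simp: \<phi>)
  qed
  have i\<phi>: "integrable M (\<lambda>v. \<phi> v * (z v)\<^sup>2)"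
    if "integrable M (\<lambda>v. (z v)\<^sup>2)" and [measurable]: "z \<in> borel_measurable M" for z :: "'a \<Rightarrow> real"
    by (rule Bochner_Integration.integrable_bound[OF that(1)])
      (use \<phi> in \<open>auto simp: abs_mult intro!: mult_left_le_one_le\<close>)
  have idiff: "integrable M (\<lambda>v. (x' v - y' v)\<^sup>2)" "(\<integral>v. (x' v - y' v)\<^sup>2 \<partial>M) = 2 - 2 * I"
    and isum: "integrable M (\<lambda>v. (x' v + y' v)\<^sup>2)" "(\<integral>v. (x' v + y' v)\<^sup>2 \<partial>M) = 2 + 2 * I"
  proof -
    show "integrable M (\<lambda>v. (x' v - y' v)\<^sup>2)" "integrable M (\<lambda>v. (x' v + y' v)\<^sup>2)"
      using ix iy ixy by (simp_all add: power2_diff power2_sum mult.assoc)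
    show "(\<integral>v. (x' v - y' v)\<^sup>2 \<partial>M) = 2 - 2 * I" "(\<integral>v. (x' v + y' v)\<^sup>2 \<partial>M) = 2 + 2 * I"
      using ix iy ixy sx sy by (simp_all add: power2_diff power2_sum mult.assoc I_def)
  qed
  have ip: "integrable M (\<lambda>v. (x' v - y' v) * (x' v + y' v))"
    by (rule integral_Cauchy_Schwarz(1)) (use idiff isum in auto)
  have "\<bar>(\<integral>v. \<phi> v * (x' v)\<^sup>2 \<partial>M) - (\<integral>v. \<phi> v * (y' v)\<^sup>2 \<partial>M)\<bar>
      = \<bar>\<integral>v. \<phi> v * (x' v)\<^sup>2 - \<phi> v * (y' v)\<^sup>2 \<partial>M\<bar>"
    by (subst Bochner_Integration.integral_diff) (use i\<phi> ix iy in auto)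
  also have "\<dots> \<le> (\<integral>v. \<bar>\<phi> v * (x' v)\<^sup>2 - \<phi> v * (y' v)\<^sup>2\<bar> \<partial>M)"
    by (rule integral_abs_bound)
  also have "\<dots> \<le> (\<integral>v. \<bar>(x' v - y' v) * (x' v + y' v)\<bar> \<partial>M)"
  proof (rule integral_mono)
    show "integrable M (\<lambda>v. \<bar>\<phi> v * (x' v)\<^sup>2 - \<phi> v * (y' v)\<^sup>2\<bar>)"
      by (intro integrable_abs Bochner_Integration.integrable_diff i\<phi> ix iy) auto
    show "integrable M (\<lambda>v. \<bar>(x' v - y' v) * (x' v + y' v)\<bar>)" by (rule integrable_abs[OF ip])
    fix v
    have "\<phi> v * (x' v)\<^sup>2 - \<phi> v * (y' v)\<^sup>2 = \<phi> v * ((x' v - y' v) * (x' v + y' v))"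
      by (simp add: power2_eq_square algebra_simps)
    then show "\<bar>\<phi> v * (x' v)\<^sup>2 - \<phi> v * (y' v)\<^sup>2\<bar> \<le> \<bar>(x' v - y' v) * (x' v + y' v)\<bar>"
      using \<phi>[of v] by (simp only: abs_mult abs_of_nonneg) (rule mult_left_le_one_le, simp_all)
  qed
  finally have "\<bar>(\<integral>v. \<phi> v * (x' v)\<^sup>2 \<partial>M) - (\<integral>v. \<phi> v * (y' v)\<^sup>2 \<partial>M)\<bar>\<^sup>2
      \<le> (\<integral>v. \<bar>(x' v - y' v) * (x' v + y' v)\<bar> \<partial>M)\<^sup>2"
    by (rule power_mono) simp
  also have "\<dots> \<le> (2 - 2 * I) * (2 + 2 * I)"
    using integral_Cauchy_Schwarz(2)[OF _ _ idiff(1) isum(1)] idiff isum by simp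
  also have "\<dots> = 4 * (1 - I\<^sup>2)" by (simp add: algebra_simps power2_eq_square)
  finally show ?thesis
    unfolding I by (simp add: w[OF _ ax nn(1)] w[OF _ ay nn(2)])
qed

section \<open>Averages over a distribution without invariant measure\<close>

lemma measurable_matrix_vector_pair [measurable (raw)]:
  fixes f :: "'a \<Rightarrow> real^'m^'m"
  assumes "f \<in> borel_measurable M" "h \<in> borel_measurable M"
  shows "(\<lambda>x. f x *v h x) \<in> borel_measurable M"
  by (rule borel_measurable_continuous_Pair[OF assms]) (intro continuous_on_matrix_vector continuous_intros)

lemma measurable_SL_borel_imp_borel:
  "f \<in> measurable M SL_borel \<Longrightarrow> f \<in> borel_measurable M"
  by (simp add: measurable_restrict_space2_iff)

definition pairing :: "(real^'m \<Rightarrow> ennreal) \<Rightarrow> real^'m^'m \<Rightarrow> real^'m^'m \<Rightarrow> ennreal" where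
  "pairing b g h = (\<integral>\<^sup>+v. b (g *v v) * b (h *v v) \<partial>shell)"

lemma ennreal_half_le: "2 * x \<le> y + y \<Longrightarrow> x \<le> (y::ennreal)"
proof (cases x; cases y)
  fix r q assume "2 * x \<le> y + y" and *: "x = ennreal r" "0 \<le> r" "y = ennreal q" "0 \<le> q"
  moreover have "ennreal (2 * r) = 2 * ennreal r" using * by (simp add: ennreal_mult)
  moreover have "ennreal (q + q) = ennreal q + ennreal q" using * by (simp only: ennreal_plus)
  ultimately have "ennreal (2 * r) \<le> ennreal (q + q)" by (simp only:)
  then have "2 * r \<le> q + q" using * by (subst (asm) ennreal_le_iff) auto
  then show ?thesis using * by simp
next
  fix q assume "2 * x \<le> y + y" "x = top_class.top" "y = ennreal q"
  then show ?thesis by (simp add: ennreal_mult_top top_unique)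
qed auto

lemma pairing_le:
  fixes b :: "real^'m \<Rightarrow> ennreal"
  assumes b: "half_density b" and g: "g \<in> SL" "h \<in> SL"
  shows "pairing b g h \<le> sq_norm b"
proof -
  have [measurable]: "b \<in> borel_measurable borel" using b by (simp add: homogeneous_def)
  have "2 * pairing b g h = (\<integral>\<^sup>+v. 2 * b (g *v v) * b (h *v v) \<partial>shell)"
    unfolding pairing_def by (subst nn_integral_cmult[symmetric]) (auto simp: mult.assoc)
  also have "\<dots> \<le> (\<integral>\<^sup>+v. (b (g *v v))\<^sup>2 + (b (h *v v))\<^sup>2 \<partial>shell)"
    by (intro nn_integral_mono sum_of_squares_ge_ennreal)
  also have "\<dots> = sq_norm b + sq_norm b"
    by (subst nn_integral_add) (simp_all add: half_density_isometry[OF b g(1)] half_density_isometry[OF b g(2)])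
  finally show ?thesis by (rule ennreal_half_le)
qed

lemma prob_SL_facts:
  assumes "\<nu> \<in> space (prob_algebra SL_borel)"
  shows "prob_space \<nu>" "sets \<nu> = sets SL_borel" "space \<nu> = SL"
  using assms sets_eq_imp_space_eq[of \<nu> SL_borel] by (auto simp: space_prob_algebra space_restrict_space)

lemma measurable_fst_SL:
  assumes "sets \<nu> = sets (SL_borel :: (real^'m^'m) measure)"
  shows "fst \<in> borel_measurable (\<nu> \<Otimes>\<^sub>M N)"
proof -
  have "(\<lambda>g. g) \<in> borel_measurable \<nu>"
    by (subst measurable_cong_sets[OF assms refl]) (rule measurable_restrict_space1, simp)
  then show ?thesis by (rule measurable_compose[OF measurable_fst])
qed

lemma avg_measurable:
  fixes b :: "real^'m \<Rightarrow> ennreal"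
  assumes \<nu>: "\<nu> \<in> space (prob_algebra SL_borel)" and [measurable]: "b \<in> borel_measurable borel"
  shows "(\<lambda>v. \<integral>\<^sup>+g. b (g *v v) \<partial>\<nu>) \<in> borel_measurable borel"
proof -
  note k = prob_SL_facts[OF \<nu>]
  interpret prob_space \<nu> by (rule k)
  have "(\<lambda>g. g) \<in> borel_measurable \<nu>"
    by (subst measurable_cong_sets[OF k(2) refl]) (rule measurable_restrict_space1, simp)
  from measurable_compose[OF measurable_snd this]
  have [measurable]: "snd \<in> borel_measurable (borel \<Otimes>\<^sub>M \<nu>)" .
  have "(\<lambda>x. b (snd x *v fst x)) \<in> borel_measurable (borel \<Otimes>\<^sub>M \<nu>)" by measurable
  then show ?thesis by (intro borel_measurable_nn_integral) (simp add: case_prod_beta)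
qed

text \<open>
  The square of an average is the average of the inner products over independent pairs, so the
  average is shorter than \<open>b\<close> as soon as the translates differ on a set of pairs of positive
  probability.
\<close>

lemma avg_square:
  fixes b :: "real^'m \<Rightarrow> ennreal"
  assumes \<nu>: "\<nu> \<in> space (prob_algebra SL_borel)" and [measurable]: "b \<in> borel_measurable borel"
  shows "sq_norm (average \<nu> b) = (\<integral>\<^sup>+g. \<integral>\<^sup>+h. pairing b g h \<partial>\<nu> \<partial>\<nu>)"
proof -
  note k = prob_SL_facts[OF \<nu>]
  interpret prob_space \<nu> by (rule k)
  interpret sh: finite_measure shell by (rule finite_measure_shell)
  interpret pair_sigma_finite \<nu> shell ..
  have [measurable]: "fst \<in> borel_measurable (\<nu> \<Otimes>\<^sub>M shell)"
    by (rule measurable_fst_SL[OF k(2)])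
  have "(\<lambda>v. v) \<in> borel_measurable (shell :: (real^'m) measure)" by simp
  from measurable_compose[OF measurable_snd this]
  have [measurable]: "snd \<in> borel_measurable (\<nu> \<Otimes>\<^sub>M (shell :: (real^'m) measure))" .
  have [measurable]: "(\<lambda>(g, v). b (g *v v)) \<in> borel_measurable (\<nu> \<Otimes>\<^sub>M shell)"
    unfolding case_prod_beta by measurable
  define T where "T v = (\<integral>\<^sup>+g. b (g *v v) \<partial>\<nu>)" for v
  have T[measurable]: "T \<in> borel_measurable shell"
    unfolding T_def using avg_measurable[OF \<nu>, of b] by (simp cong: measurable_cong_sets)
  have [measurable]: "(\<lambda>g. g) \<in> borel_measurable \<nu>"
    by (subst measurable_cong_sets[OF k(2) refl]) (rule measurable_restrict_space1, simp)
  have "sq_norm (average \<nu> b) = (\<integral>\<^sup>+v. \<integral>\<^sup>+g. b (g *v v) * T v \<partial>\<nu> \<partial>shell)"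
    by (intro nn_integral_cong) (simp add: nn_integral_multc power2_eq_square T_def)
  also have "\<dots> = (\<integral>\<^sup>+g. \<integral>\<^sup>+v. b (g *v v) * T v \<partial>shell \<partial>\<nu>)"
    by (rule Fubini') (simp add: case_prod_beta)
  also have "\<dots> = (\<integral>\<^sup>+g. \<integral>\<^sup>+v. \<integral>\<^sup>+h. b (g *v v) * b (h *v v) \<partial>\<nu> \<partial>shell \<partial>\<nu>)"
    by (intro nn_integral_cong) (simp add: nn_integral_cmult T_def)
  also have "\<dots> = (\<integral>\<^sup>+g. \<integral>\<^sup>+h. \<integral>\<^sup>+v. b (g *v v) * b (h *v v) \<partial>shell \<partial>\<nu> \<partial>\<nu>)"
    by (intro nn_integral_cong Fubini') (simp add: case_prod_beta)
  finally show ?thesis unfolding pairing_def .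
qed

lemma avg_square_le:
  fixes b :: "real^'m \<Rightarrow> ennreal"
  assumes \<nu>: "\<nu> \<in> space (prob_algebra SL_borel)" and b: "half_density b"
  shows "sq_norm (average \<nu> b) \<le> sq_norm b"
proof -
  note k = prob_SL_facts[OF \<nu>]
  interpret prob_space \<nu> by (rule k)
  let ?B = "sq_norm b"
  have "sq_norm (average \<nu> b) \<le> (\<integral>\<^sup>+g. \<integral>\<^sup>+h. ?B \<partial>\<nu> \<partial>\<nu>)"
    unfolding avg_square[OF \<nu> homogeneous_measurable[OF b]]
    by (intro nn_integral_mono pairing_le[OF b]) (simp_all only: k)
  then show ?thesis by (simp add: emeasure_space_1)
qed

lemma openin_weak_topology:
  fixes f :: "'a::topological_space \<Rightarrow> real"
  assumes "continuous_on S f" "bounded (f ` S)" "open U"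
  shows "openin (weak_topology S) {\<nu> \<in> space (prob_algebra (restrict_space borel S)). (\<integral>x. f x \<partial>\<nu>) \<in> U}"
  unfolding weak_topology_def
  by (rule topology_generated_by_Basis, rule CollectI, rule exI[of _ f], rule exI[of _ U], intro conjI refl assms)

text \<open>
  An independent pair falls into \<open>U \<times> V\<close> with probability at least \<open>c\<^sup>2\<close>, and then the inner product
  is at most \<open>1 - \<tau>\<close>; for all other pairs it is at most 1.
\<close>

lemma far_pair_bound:
  fixes b :: "real^'m \<Rightarrow> ennreal"
  assumes \<nu>: "\<nu> \<in> space (prob_algebra SL_borel)" and b: "half_density b" "sq_norm b = 1"
    and UV: "U \<in> sets \<nu>" "V \<in> sets \<nu>" and c: "c \<ge> 0" "measure \<nu> U \<ge> c" "measure \<nu> V \<ge> c"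
    and \<tau>: "0 \<le> \<tau>" "\<tau> \<le> 1" and far: "\<And>g h. g \<in> U \<Longrightarrow> h \<in> V \<Longrightarrow> pairing b g h \<le> ennreal (1 - \<tau>)"
  shows "sq_norm (average \<nu> b) \<le> ennreal (1 - \<tau> * c\<^sup>2)"
proof -
  note k = prob_SL_facts[OF \<nu>]
  interpret prob_space \<nu> by (rule k)
  have bm: "b \<in> borel_measurable borel" using b by (simp add: homogeneous_def)
  define A where "A = sq_norm (average \<nu> b)"
  have cpq: "c * c \<le> measure \<nu> U * measure \<nu> V" using c by (intro mult_mono) auto
  have SLUV: "U \<subseteq> SL" "V \<subseteq> SL" using UV sets.sets_into_space[of _ \<nu>] k by auto
  have "A = (\<integral>\<^sup>+g. \<integral>\<^sup>+h. pairing b g h \<partial>\<nu> \<partial>\<nu>)" unfolding A_def by (rule avg_square[OF \<nu> bm])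
  also have "\<dots> \<le> (\<integral>\<^sup>+g. \<integral>\<^sup>+h. ennreal (1 - \<tau> * (indicator U g * indicator V h)) \<partial>\<nu> \<partial>\<nu>)"
  proof (intro nn_integral_mono)
    fix g h assume "g \<in> space \<nu>" "h \<in> space \<nu>"
    then show "pairing b g h \<le> ennreal (1 - \<tau> * (indicator U g * indicator V h))"
      using far[of g h] pairing_le[OF b(1), of g h] b(2) by (auto simp: k indicator_def)
  qed
  also have "\<dots> = (\<integral>\<^sup>+g. ennreal (1 - \<tau> * (indicator U g * measure \<nu> V)) \<partial>\<nu>)"
  proof (intro nn_integral_cong)
    fix g
    have "(\<integral>\<^sup>+h. ennreal (1 - \<tau> * (indicator U g * indicator V h)) \<partial>\<nu>)
        = ennreal (\<integral>h. 1 - \<tau> * (indicator U g * indicator V h) \<partial>\<nu>)"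
      using UV \<tau> by (intro nn_integral_eq_integral AE_I2) (auto simp: indicator_def intro!: integrable_const_bound[of _ 1])
    also have "(\<integral>h. 1 - \<tau> * (indicator U g * indicator V h) \<partial>\<nu>) = 1 - \<tau> * (indicator U g * measure \<nu> V)"
      using UV by (subst Bochner_Integration.integral_diff) (auto simp: prob_space emeasure_eq_measure)
    finally show "(\<integral>\<^sup>+h. ennreal (1 - \<tau> * (indicator U g * indicator V h)) \<partial>\<nu>) = ennreal (1 - \<tau> * (indicator U g * measure \<nu> V))" .
  qed
  also have "\<dots> = ennreal (\<integral>g. 1 - \<tau> * (indicator U g * measure \<nu> V) \<partial>\<nu>)"
  proof (intro nn_integral_eq_integral AE_I2)
    show "integrable \<nu> (\<lambda>g. 1 - \<tau> * (indicator U g * measure \<nu> V))" using UV by (auto simp: emeasure_eq_measure)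
    show "0 \<le> 1 - \<tau> * (indicator U g * measure \<nu> V)" for g
      using mult_le_one[of \<tau> "measure \<nu> V"] \<tau> prob_le_1[of V] by (auto simp: indicator_def)
  qed
  also have "(\<integral>g. 1 - \<tau> * (indicator U g * measure \<nu> V) \<partial>\<nu>) = 1 - \<tau> * (measure \<nu> U * measure \<nu> V)"
    using UV by (subst Bochner_Integration.integral_diff) (auto simp: prob_space emeasure_eq_measure)
  also have "ennreal \<dots> \<le> ennreal (1 - \<tau> * c\<^sup>2)"
    using mult_left_mono[OF cpq \<tau>(1)] by (intro ennreal_leI) (simp add: power2_eq_square)
  finally show ?thesis unfolding A_def .
qed

text \<open>
  Continuous functions below the indicator of a ball: integrals of continuous functions are what a
  weak neighbourhood controls.
\<close>

definition bump :: "'a::metric_space \<Rightarrow> real \<Rightarrow> 'a \<Rightarrow> real" where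
  "bump q d x = max 0 (1 - dist x q / d)"

lemma bump_bounds: "d > 0 \<Longrightarrow> 0 \<le> bump q d x \<and> bump q d x \<le> indicator (ball q d) x"
  by (auto simp: bump_def indicator_def dist_commute field_simps)

lemma continuous_bump: "continuous_on S (bump q d)"
  unfolding bump_def[abs_def] by (cases "d = 0") (auto intro!: continuous_intros)

lemma bump_measurable:
  fixes q :: "real^'m^'m"
  assumes "sets \<nu> = sets SL_borel"
  shows "bump q d \<in> borel_measurable \<nu>"
  by (subst measurable_cong_sets[OF assms refl])
    (intro measurable_restrict_space1 borel_measurable_continuous_onI continuous_bump)

lemma SL_ball_sets:
  fixes q :: "real^'m^'m"
  assumes "sets \<nu> = sets SL_borel"
  shows "ball q d \<inter> SL \<in> sets \<nu>"
  unfolding assms by (auto simp: sets_restrict_space)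

lemma bump_integral:
  fixes \<nu> :: "(real^'m^'m) measure"
  assumes \<nu>: "\<nu> \<in> space (prob_algebra SL_borel)" and d: "d > 0"
  shows "integrable \<nu> (bump q d)" "(\<integral>x. bump q d x \<partial>\<nu>) \<le> measure \<nu> (ball q d \<inter> SL)"
    "q \<in> supp_SL \<nu> \<Longrightarrow> 0 < (\<integral>x. bump q d x \<partial>\<nu>)"
proof -
  note k = prob_SL_facts[OF \<nu>]
  interpret prob_space \<nu> by (rule k)
  have b1: "0 \<le> bump q d x \<and> bump q d x \<le> 1" for x
    using d by (auto simp: bump_def)
  show int: "integrable \<nu> (bump q d)"
    by (rule integrable_const_bound[of _ 1]) (use b1 bump_measurable[OF k(2)] in auto)
  have iB: "integrable \<nu> (indicator (ball q r \<inter> SL) :: _ \<Rightarrow> real)" for r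
    using SL_ball_sets[OF k(2)] by (auto simp: emeasure_eq_measure)
  have mB: "(\<integral>x. indicator (ball q r \<inter> SL) x \<partial>\<nu>) = measure \<nu> (ball q r \<inter> SL)" for r
    by (simp add: k(3) Int_assoc)
  have "(\<integral>x. bump q d x \<partial>\<nu>) \<le> (\<integral>x. indicator (ball q d \<inter> SL) x \<partial>\<nu>)"
    by (rule integral_mono[OF int iB]) (use bump_bounds[OF d, of q] in \<open>auto simp: k indicator_def\<close>)
  then show "(\<integral>x. bump q d x \<partial>\<nu>) \<le> measure \<nu> (ball q d \<inter> SL)" by (simp only: mB)
  assume "q \<in> supp_SL \<nu>"
  then have "emeasure \<nu> (ball q (d/2) \<inter> SL) > 0" using d by (auto simp: supp_SL_def)
  then have pos: "measure \<nu> (ball q (d/2) \<inter> SL) > 0" by (simp add: emeasure_eq_measure)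
  have "(\<integral>x. 1/2 * indicator (ball q (d/2) \<inter> SL) x \<partial>\<nu>) \<le> (\<integral>x. bump q d x \<partial>\<nu>)"
  proof (rule integral_mono[OF _ int])
    show "integrable \<nu> (\<lambda>x. 1/2 * indicator (ball q (d/2) \<inter> SL) x :: real)"
      using iB by (rule integrable_mult_right)
    show "1/2 * indicator (ball q (d/2) \<inter> SL) x \<le> bump q d x" for x
      using d b1[of x] by (auto simp: indicator_def bump_def dist_commute field_simps)
  qed
  then show "0 < (\<integral>x. bump q d x \<partial>\<nu>)" using pos mB[of "d/2"] by simp
qed

text \<open>
  The neighbourhoods \<open>W N\<close> force a measure to give mass to the balls of radius \<open>d N\<close> around the first
  \<open>N + 1\<close> points of a dense sequence of the support of \<open>\<nu>\<close>. If the average almost kept the norm for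
  some measure in each \<open>W N\<close>, each two of these balls would contain a pair of matrices whose
  translates of \<open>b N\<close> almost coincide; a weak limit of the laws \<open>sphere_law (b N)\<close> would then be
  preserved by the group of \<open>\<nu>\<close>.
\<close>

theorem weak_neighbourhood_contraction:
  fixes \<nu> :: "(real^'m^'m) measure"
  assumes \<nu>: "\<nu> \<in> space (prob_algebra SL_borel)"
    and noinv: "\<not> (\<exists>\<kappa>\<in>space (prob_algebra sphere_borel). preserves (closed_group_of \<nu>) \<kappa>)"
  obtains W \<epsilon> where "openin (weak_topology SL) W" "\<nu> \<in> W" "\<epsilon> > 0"
    "\<And>\<nu>' b. \<nu>' \<in> W \<Longrightarrow> half_density b \<Longrightarrow> sq_norm b = 1 \<Longrightarrow>
        sq_norm (average \<nu>' b) \<le> ennreal (1 - \<epsilon>)"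
proof (rule ccontr)
  assume neg: "\<not> thesis"
  let ?S = "supp_SL \<nu>"
  have S_SL: "?S \<subseteq> SL" by (auto simp: supp_SL_def)
  obtain T where T: "countable T" "T \<subseteq> ?S" "?S \<subseteq> closure T" by (rule separable)
  have Sne: "?S \<noteq> {}"
  proof
    assume "?S = {}"
    \<comment> \<open>An empty support would generate the trivial group, which preserves a point mass.\<close>
    have "return sphere_borel (axis undefined 1 :: real^'m) \<in> space (prob_algebra sphere_borel)"
      by (auto simp: space_prob_algebra space_restrict_space intro!: prob_space_return)
    moreover have "preserves (closed_group_of \<nu>) (return sphere_borel (axis undefined 1))"
      by (rule preserves_closed_group[OF calculation]) (use \<open>?S = {}\<close> in auto)
    ultimately show False using noinv by blast
  qed
  then have "T \<noteq> {}" using T(3) by auto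
  define q where "q = from_nat_into T"
  have qT: "range q = T" unfolding q_def by (rule range_from_nat_into) fact+
  then have qS: "q k \<in> ?S" "q k \<in> SL" for k using T(2) S_SL by auto
  define d where "d N = 1 / real (Suc N)" for N
  have d: "d N > 0" "d N \<le> 1" for N by (auto simp: d_def)
  define c where "c N = Min ((\<lambda>k. \<integral>x. bump (q k) (d N) x \<partial>\<nu>) ` {..N}) / 2" for N
  have c: "c N > 0" "\<And>k. k \<le> N \<Longrightarrow> c N < (\<integral>x. bump (q k) (d N) x \<partial>\<nu>)" for N
  proof -
    have pos: "0 < (\<integral>x. bump (q k) (d N) x \<partial>\<nu>)" for k by (rule bump_integral(3)[OF \<nu> d(1) qS(1)])
    have "0 < Min ((\<lambda>k. \<integral>x. bump (q k) (d N) x \<partial>\<nu>) ` {..N})" using pos by (subst Min_gr_iff) auto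
    then show "c N > 0" by (simp add: c_def)
    show "c N < (\<integral>x. bump (q k) (d N) x \<partial>\<nu>)" if "k \<le> N" for k
    proof -
      have "2 * c N \<le> (\<integral>x. bump (q k) (d N) x \<partial>\<nu>)" unfolding c_def using that by simp
      then show ?thesis using \<open>c N > 0\<close> by linarith
    qed
  qed
  define W where "W N = (\<Inter>k\<in>{..N}. {\<nu>' \<in> space (prob_algebra SL_borel). (\<integral>x. bump (q k) (d N) x \<partial>\<nu>') \<in> {c N<..}})" for N
  have W: "openin (weak_topology SL) (W N)" for N
    unfolding W_def
  proof (rule openin_INT2, goal_cases)
    case (3 k)
    have "bounded (bump (q k) (d N) ` SL)" for k
      using d(1)[of N] by (intro boundedI[of _ 1]) (auto simp: bump_def)
    then show ?case by (intro openin_weak_topology continuous_bump) auto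
  qed auto
  have "\<nu> \<in> W N" for N using c \<nu> by (auto simp: W_def)
  have "\<exists>\<nu>' b. \<nu>' \<in> W N \<and> half_density b \<and> sq_norm b = 1 \<and>
        \<not> sq_norm (average \<nu>' b) \<le> ennreal (1 - d N * (c N)\<^sup>2)" for N
  proof (rule ccontr)
    assume "\<nexists>\<nu>' b. \<nu>' \<in> W N \<and> half_density b \<and> sq_norm b = 1 \<and>
        \<not> sq_norm (average \<nu>' b) \<le> ennreal (1 - d N * (c N)\<^sup>2)"
    then have thesis using W[of N] \<open>\<nu> \<in> W N\<close> c(1)[of N] d(1)[of N]
      by (intro that[of "W N" "d N * (c N)\<^sup>2"]) auto
    with neg show False ..
  qed
  then obtain \<nu>' b where \<nu>': "\<And>N. \<nu>' N \<in> W N" and b: "\<And>N. half_density (b N :: real^'m \<Rightarrow> ennreal)"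
    "\<And>N. sq_norm (b N) = 1" and
    big: "\<And>N. \<not> (\<integral>\<^sup>+v. (\<integral>\<^sup>+g. b N (g *v v) \<partial>\<nu>' N)\<^sup>2 \<partial>shell) \<le> ennreal (1 - d N * (c N)\<^sup>2)"
    by metis
  have \<nu>'P: "\<nu>' N \<in> space (prob_algebra SL_borel)" for N using \<nu>'[of N] by (auto simp: W_def)
  \<comment> \<open>Otherwise these two balls alone would shorten the average too much.\<close>
  have near: "\<exists>g h. g \<in> SL \<and> h \<in> SL \<and> dist g (q k) < d N \<and> dist h (q k') < d N \<and>
      pairing (b N) g h > ennreal (1 - d N)" if "k \<le> N" "k' \<le> N" for k k' N
  proof (rule ccontr)
    assume far: "\<nexists>g h. g \<in> SL \<and> h \<in> SL \<and> dist g (q k) < d N \<and> dist h (q k') < d N \<and>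
      pairing (b N) g h > ennreal (1 - d N)"
    have mass: "c N \<le> measure (\<nu>' N) (ball (q k) (d N) \<inter> SL)" if "k \<le> N" for k
    proof -
      have "c N < (\<integral>x. bump (q k) (d N) x \<partial>\<nu>' N)" using \<nu>'[of N] that by (auto simp: W_def)
      also have "\<dots> \<le> measure (\<nu>' N) (ball (q k) (d N) \<inter> SL)" by (rule bump_integral(2)[OF \<nu>'P d(1)])
      finally show ?thesis by simp
    qed
    have "(\<integral>\<^sup>+v. (\<integral>\<^sup>+g. b N (g *v v) \<partial>\<nu>' N)\<^sup>2 \<partial>shell) \<le> ennreal (1 - d N * (c N)\<^sup>2)"
    proof (rule far_pair_bound[OF \<nu>'P b])
      show "ball (q k) (d N) \<inter> SL \<in> sets (\<nu>' N)" "ball (q k') (d N) \<inter> SL \<in> sets (\<nu>' N)"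
        by (rule SL_ball_sets[OF prob_SL_facts(2)[OF \<nu>'P]])+
      show "c N \<ge> 0" "0 \<le> d N" "d N \<le> 1" using c(1)[of N] d[of N] by auto
      show "c N \<le> measure (\<nu>' N) (ball (q k) (d N) \<inter> SL)" "c N \<le> measure (\<nu>' N) (ball (q k') (d N) \<inter> SL)"
        by (rule mass[OF \<open>k \<le> N\<close>], rule mass[OF \<open>k' \<le> N\<close>])
      show "pairing (b N) g h \<le> ennreal (1 - d N)"
        if "g \<in> ball (q k) (d N) \<inter> SL" "h \<in> ball (q k') (d N) \<inter> SL" for g h
      proof -
        have "g \<in> SL" "h \<in> SL" "dist g (q k) < d N" "dist h (q k') < d N"
          using that by (auto simp: dist_commute)
        with far show ?thesis by (meson not_less)
      qed
    qed
    with big show False by blast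
  qed
  obtain r \<kappa>' where r: "strict_mono r" and \<kappa>': "\<kappa>' \<in> space (prob_algebra sphere_borel)"
    and conv: "\<And>f :: real^'m \<Rightarrow> real. continuous_on (sphere 0 1) f \<Longrightarrow>
       (\<lambda>i. \<integral>x. f x \<partial>sphere_law (b (r i))) \<longlonglongrightarrow> (\<integral>x. f x \<partial>\<kappa>')"
    using prob_compact_weakly_sequentially_compact[OF compact_sphere, of "\<lambda>i. sphere_law (b i)"]
      sphere_law_prob[OF b] by metis
  have d0: "(\<lambda>i. d (r i)) \<longlonglongrightarrow> 0"
    using LIMSEQ_subseq_LIMSEQ[OF LIMSEQ_inverse_real_of_nat r] by (simp add: d_def o_def inverse_eq_divide)
  have same: "inv_mean \<kappa>' \<phi> (q k) = inv_mean \<kappa>' \<phi> (q k')"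
    if \<phi>: "continuous_on UNIV \<phi>" "\<And>x. 0 \<le> \<phi> x \<and> \<phi> x \<le> 1" for \<phi> :: "real^'m \<Rightarrow> real" and k k'
  proof -
    have "\<exists>g h. g \<in> SL \<and> h \<in> SL \<and> dist g (q k) < d N \<and> dist h (q k') < d N \<and>
      (max k k' \<le> N \<longrightarrow> pairing (b N) g h > ennreal (1 - d N))" for N
    proof (cases "max k k' \<le> N")
      case True
      then show ?thesis using near[of k N k'] by auto
    next
      case False
      then show ?thesis using qS(2) d(1)[of N]
        by - (rule exI[of _ "q k"], rule exI[of _ "q k'"], auto)
    qed
    then obtain g h where gh: "\<And>N. g N \<in> SL" "\<And>N. h N \<in> SL" "\<And>N. dist (g N) (q k) < d N" "\<And>N. dist (h N) (q k') < d N"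
      "\<And>N. max k k' \<le> N \<Longrightarrow> pairing (b N) (g N) (h N) > ennreal (1 - d N)" by metis
    have lim: "(\<lambda>i. f (r i)) \<longlonglongrightarrow> l" if "\<And>N. dist (f N) l < d N" for f and l :: "real^'m^'m"
    proof (rule tendstoI)
      fix e :: real assume "e > 0"
      with d0 have "\<forall>\<^sub>F i in sequentially. d (r i) < e" by (rule order_tendstoD)
      then show "\<forall>\<^sub>F i in sequentially. dist (f (r i)) l < e"
        by eventually_elim (use that in \<open>metis less_trans\<close>)
    qed
    let ?I = "\<lambda>i f. inv_mean (sphere_law (b (r i))) \<phi> (f (r i))"
    have lg: "(\<lambda>i. ?I i g) \<longlonglongrightarrow> inv_mean \<kappa>' \<phi> (q k)"
      by (rule tendsto_integral_sphere_act_inv[OF sphere_law_prob[OF b] \<kappa>' conv gh(1) lim[OF gh(3)] \<phi>(1)])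
    have lh: "(\<lambda>i. ?I i h) \<longlonglongrightarrow> inv_mean \<kappa>' \<phi> (q k')"
      by (rule tendsto_integral_sphere_act_inv[OF sphere_law_prob[OF b] \<kappa>' conv gh(2) lim[OF gh(4)] \<phi>(1)])
    have [measurable]: "\<phi> \<in> borel_measurable borel" by (rule borel_measurable_continuous_onI[OF \<phi>(1)])
    have bnd: "(inv_mean (sphere_law (b N)) \<phi> (g N)
         - inv_mean (sphere_law (b N)) \<phi> (h N))\<^sup>2 \<le> 8 * d N" if N: "max k k' \<le> N" for N
    proof -
      have [measurable]: "b N \<in> borel_measurable borel" using b(1)[of N] by (simp add: homogeneous_def)
      have iso: "(\<integral>\<^sup>+v. (b N (a *v v))\<^sup>2 \<partial>shell) = 1" if "a \<in> SL" for a
        using half_density_isometry[OF b(1) that] b(2) by simp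
      let ?p = "enn2real (pairing (b N) (g N) (h N))"
      have p1: "pairing (b N) (g N) (h N) \<le> 1"
        using pairing_le[OF b(1) gh(1) gh(2), of N N N] b(2) by simp
      have "1 - d N \<le> ?p"
        using enn2real_mono[OF less_imp_le[OF gh(5)[OF N]]] p1 d[of N]
        by (simp add: le_less_trans[OF p1])
      then have "(1 - d N)\<^sup>2 \<le> ?p\<^sup>2" using d(2)[of N] by (intro power_mono) auto
      moreover have "(1 - d N)\<^sup>2 = 1 - 2 * d N + (d N)\<^sup>2" by (simp add: power2_diff)
      ultimately have "4 * (1 - ?p\<^sup>2) \<le> 8 * d N"
        using zero_le_power2[of "d N"] by argo
      moreover have "(inv_mean (sphere_law (b N)) \<phi> (g N)
         - inv_mean (sphere_law (b N)) \<phi> (h N))\<^sup>2 \<le> 4 * (1 - ?p\<^sup>2)"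
        unfolding integral_sphere_law_act_inv[OF b gh(1) \<open>\<phi> \<in> _\<close> \<phi>(2)]
          integral_sphere_law_act_inv[OF b gh(2) \<open>\<phi> \<in> _\<close> \<phi>(2)] pairing_def
        by (rule square_density_distance) (use iso gh \<phi> in auto)
      ultimately show ?thesis by linarith
    qed
    have "(\<lambda>i. (?I i g - ?I i h)\<^sup>2) \<longlonglongrightarrow> 0"
    proof (rule tendsto_sandwich[where f="\<lambda>_. 0" and h="\<lambda>i. 8 * d (r i)"])
      show "\<forall>\<^sub>F i in sequentially. (?I i g - ?I i h)\<^sup>2 \<le> 8 * d (r i)"
        using seq_suble[OF r] by (intro eventually_sequentiallyI[of "max k k'"] bnd) (meson order_trans)
      show "(\<lambda>i. 8 * d (r i)) \<longlonglongrightarrow> 0" using tendsto_mult_left[OF d0, of 8] by simp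
    qed auto
    moreover have "(\<lambda>i. (?I i g - ?I i h)\<^sup>2) \<longlonglongrightarrow>
      (inv_mean \<kappa>' \<phi> (q k) - inv_mean \<kappa>' \<phi> (q k'))\<^sup>2"
      by (intro tendsto_intros lg lh)
    ultimately show ?thesis using LIMSEQ_unique by fastforce
  qed
  have "preserves (closed_group_of \<nu>) \<kappa>'"
  proof (rule preserves_closed_group[OF \<kappa>'])
    fix g h and \<phi> :: "real^'m \<Rightarrow> real"
    assume gh: "g \<in> ?S" "h \<in> ?S" and \<phi>: "continuous_on UNIV \<phi>" "\<And>x. 0 \<le> \<phi> x \<and> \<phi> x \<le> 1"
    have *: "inv_mean \<kappa>' \<phi> a = inv_mean \<kappa>' \<phi> (q 0)"
      if a: "a \<in> ?S" for a
    proof -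
      have "a \<in> closure T" using a T(3) by blast
      then obtain t where t: "\<And>i. t i \<in> T" "t \<longlonglongrightarrow> a" unfolding closure_sequential by blast
      have tSL: "t i \<in> SL" for i using t(1) T(2) S_SL by blast
      have "(\<lambda>i. inv_mean \<kappa>' \<phi> (t i)) \<longlonglongrightarrow> inv_mean \<kappa>' \<phi> a"
        by (rule tendsto_integral_sphere_act_inv[OF \<kappa>' \<kappa>' tendsto_const tSL t(2) \<phi>(1)])
      moreover have "inv_mean \<kappa>' \<phi> (t i) = inv_mean \<kappa>' \<phi> (q 0)" for i
      proof -
        obtain k where "t i = q k" using t(1)[of i] qT by auto
        then show ?thesis using same[OF \<phi>, of k 0] by simp
      qed
      ultimately show ?thesis by (simp add: LIMSEQ_const_iff)
    qed
    show "inv_mean \<kappa>' \<phi> g = inv_mean \<kappa>' \<phi> h"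
      using *[OF gh(1)] *[OF gh(2)] by simp
  qed
  with noinv \<kappa>' show False by blast
qed

text \<open>
  Finitely many of the neighbourhoods of \<open>weak_neighbourhood_contraction\<close> cover \<open>M\<close>. The number 1/2
  enters the minimum to keep \<open>\<epsilon>\<close> below 1 even if \<open>M\<close> is empty; the right-hand side is then infinite
  whenever the norm of \<open>b\<close> is.
\<close>

theorem uniform_average_contraction:
  fixes M :: "(real^'m^'m) measure set"
  assumes M: "compactin (weak_topology SL) M"
    and noinv: "\<And>\<nu>. \<nu> \<in> M \<Longrightarrow> \<not> (\<exists>\<kappa>\<in>space (prob_algebra sphere_borel). preserves (closed_group_of \<nu>) \<kappa>)"
  obtains \<epsilon> where "0 < \<epsilon>" "\<epsilon> < 1"
    "\<And>\<nu> b. \<nu> \<in> M \<Longrightarrow> half_density b \<Longrightarrow>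
        sq_norm (average \<nu> b) \<le> ennreal (1 - \<epsilon>) * sq_norm b"
proof -
  have MP: "\<nu> \<in> space (prob_algebra SL_borel)" if "\<nu> \<in> M" for \<nu>
    using compactin_subset_topspace[OF M] that by (auto simp: topspace_weak_topology)
  define good :: "(real^'m^'m) measure set \<Rightarrow> real \<Rightarrow> bool" where "good W \<epsilon> \<longleftrightarrow> (\<forall>\<nu>'\<in>W. \<forall>b :: real^'m \<Rightarrow> ennreal. half_density b \<longrightarrow> sq_norm b = 1 \<longrightarrow>
        sq_norm (average \<nu>' b) \<le> ennreal (1 - \<epsilon>))" for W \<epsilon>
  let ?\<U> = "{W. openin (weak_topology SL) W \<and> (\<exists>\<epsilon>>0. good W \<epsilon>)}"
  have "M \<subseteq> \<Union>?\<U>"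
  proof
    fix \<nu> assume "\<nu> \<in> M"
    from weak_neighbourhood_contraction[OF MP[OF this] noinv[OF this]] show "\<nu> \<in> \<Union>?\<U>"
      unfolding good_def by (smt (verit) UnionI mem_Collect_eq)
  qed
  then obtain \<F> where \<F>: "finite \<F>" "\<F> \<subseteq> ?\<U>" "M \<subseteq> \<Union>\<F>"
    using compactinD[OF M, of ?\<U>] by auto
  from \<F>(2) have "\<forall>W\<in>\<F>. \<exists>\<epsilon>>0. good W \<epsilon>" by blast
  then obtain e where e: "\<And>W. W \<in> \<F> \<Longrightarrow> e W > 0 \<and> good W (e W)" by metis
  define \<epsilon> where "\<epsilon> = Min (insert (1/2) (e ` \<F>))"
  have \<epsilon>: "0 < \<epsilon>" "\<epsilon> \<le> 1/2" "\<And>W. W \<in> \<F> \<Longrightarrow> \<epsilon> \<le> e W"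
    unfolding \<epsilon>_def using \<F>(1) e by (auto simp only: Min_gr_iff finite_insert finite_imageI insert_not_empty intro!: Min_le) auto
  have "sq_norm (average \<nu> b) \<le> ennreal (1 - \<epsilon>) * sq_norm b"
    if \<nu>: "\<nu> \<in> M" and b: "half_density b" for \<nu> and b :: "real^'m \<Rightarrow> ennreal"
  proof -
    have [measurable]: "b \<in> borel_measurable borel" using b by (simp add: homogeneous_def)
    note k = prob_SL_facts[OF MP[OF \<nu>]]
    have [measurable]: "(\<lambda>g. g) \<in> borel_measurable \<nu>"
      by (subst measurable_cong_sets[OF k(2) refl]) (rule measurable_restrict_space1, simp)
    let ?B = "sq_norm b"
    obtain W where W: "W \<in> \<F>" "\<nu> \<in> W" using \<F>(3) \<nu> by blast
    have unit: "sq_norm (average \<nu> b') \<le> ennreal (1 - \<epsilon>)"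
      if "half_density b'" "sq_norm b' = 1" for b' :: "real^'m \<Rightarrow> ennreal"
    proof -
      have "sq_norm (average \<nu> b') \<le> ennreal (1 - e W)"
        using e[OF W(1)] W(2) that unfolding good_def by blast
      also have "\<dots> \<le> ennreal (1 - \<epsilon>)" using \<epsilon>(3)[OF W(1)] by (intro ennreal_leI) simp
      finally show ?thesis .
    qed
    show ?thesis
    proof (cases ?B)
      case top
      then show ?thesis using \<epsilon> by (simp add: ennreal_mult_top)
    next
      case (real B)
      show ?thesis
      proof (cases "B = 0")
        case True
        then show ?thesis using avg_square_le[OF MP[OF \<nu>] b] real by simp
      next
        case False
        with real have B: "B > 0" by simp
        define a where "a = ennreal (1 / sqrt B)"
        define b' where "b' v = a * b v" for v
        have a2: "a\<^sup>2 = ennreal (1 / B)"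
          using B by (simp add: a_def ennreal_power power_divide)
        have b': "half_density b'" unfolding b'_def by (rule homogeneous_cmult[OF b])
        have "sq_norm b' = a\<^sup>2 * ?B"
          unfolding b'_def by (subst nn_integral_cmult[symmetric]) (auto simp: power_mult_distrib)
        also have "\<dots> = 1" using B by (simp add: a2 real ennreal_mult[symmetric])
        finally have n: "sq_norm b' = 1" .
        have m: "(\<lambda>v. \<integral>\<^sup>+g. b (g *v v) \<partial>\<nu>) \<in> borel_measurable shell"
          using avg_measurable[OF MP[OF \<nu>], of b] by (simp cong: measurable_cong_sets)
        have "sq_norm (average \<nu> b') = (\<integral>\<^sup>+v. a\<^sup>2 * (\<integral>\<^sup>+g. b (g *v v) \<partial>\<nu>)\<^sup>2 \<partial>shell)"
          unfolding b'_def by (intro nn_integral_cong) (simp add: nn_integral_cmult power_mult_distrib)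
        also have "\<dots> = a\<^sup>2 * sq_norm (average \<nu> b)"
          by (rule nn_integral_cmult) (use m in measurable)
        finally have "ennreal B * (a\<^sup>2 * sq_norm (average \<nu> b)) \<le> ennreal B * ennreal (1 - \<epsilon>)"
          using unit[OF b' n] by (intro mult_left_mono) auto
        moreover have "ennreal B * (a\<^sup>2 * x) = x" for x
          using B by (simp add: a2 ennreal_mult[symmetric] mult.assoc[symmetric])
        ultimately show ?thesis using real by (simp add: mult.commute)
      qed
    qed
  qed
  then show thesis using \<epsilon>(1,2) by (intro that[of \<epsilon>]) auto
qed

section \<open>Contraction by a Markov kernel\<close>

lemma ennreal_square_neq_top: "(x::ennreal)\<^sup>2 = \<infinity> \<longleftrightarrow> x = \<infinity>"
  by (auto simp: power2_eq_square ennreal_mult_eq_top_iff)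

lemma ennreal_square_eq: "x = ennreal y \<Longrightarrow> 0 \<le> y \<Longrightarrow> x\<^sup>2 = ennreal (y\<^sup>2)"
  by (simp add: ennreal_power)

lemma (in prob_space) square_integrable_imp_integrable:
  fixes f :: "'a \<Rightarrow> real"
  assumes "f \<in> borel_measurable M" "integrable M (\<lambda>x. (f x)\<^sup>2)"
  shows "integrable M f"
  using integral_Cauchy_Schwarz(1)[OF assms(1) _ assms(2), of "\<lambda>_. 1"] by simp

lemma (in prob_space) nn_integral_square_Jensen:
  assumes "f \<in> borel_measurable M"
  shows "(\<integral>\<^sup>+x. f x \<partial>M)\<^sup>2 \<le> (\<integral>\<^sup>+x. (f x)\<^sup>2 \<partial>M)"
  using Cauchy_Schwarz_nn_integral[OF assms, of "\<lambda>_. 1"] by (simp add: emeasure_space_1)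

lemma (in prob_space) finite_second_moment:
  fixes f :: "'a \<Rightarrow> ennreal"
  assumes [measurable]: "f \<in> borel_measurable M" and fin: "(\<integral>\<^sup>+x. (f x)\<^sup>2 \<partial>M) \<noteq> \<infinity>"
  defines "f' \<equiv> \<lambda>x. enn2real (f x)"
  shows "AE x in M. f x = ennreal (f' x)" "f' \<in> borel_measurable M" "integrable M (\<lambda>x. (f' x)\<^sup>2)" "integrable M f'"
    "(\<integral>\<^sup>+x. (f x)\<^sup>2 \<partial>M) = ennreal (\<integral>x. (f' x)\<^sup>2 \<partial>M)" "(\<integral>\<^sup>+x. f x \<partial>M) = ennreal (\<integral>x. f' x \<partial>M)"
proof -
  have "AE x in M. (f x)\<^sup>2 \<noteq> \<infinity>" by (rule nn_integral_PInf_AE) (use fin in auto)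
  then show ae: "AE x in M. f x = ennreal (f' x)"
    by eventually_elim (auto simp: f'_def ennreal_enn2real_if ennreal_square_neq_top)
  show m[measurable]: "f' \<in> borel_measurable M" unfolding f'_def by measurable
  have sq: "(\<integral>\<^sup>+x. (f x)\<^sup>2 \<partial>M) = (\<integral>\<^sup>+x. ennreal ((f' x)\<^sup>2) \<partial>M)"
    by (rule nn_integral_cong_AE, use ae in eventually_elim) (erule ennreal_square_eq, simp add: f'_def)
  show i2: "integrable M (\<lambda>x. (f' x)\<^sup>2)"
    using fin unfolding sq by (intro integrableI_nonneg) (auto simp: less_top)
  then show "(\<integral>\<^sup>+x. (f x)\<^sup>2 \<partial>M) = ennreal (\<integral>x. (f' x)\<^sup>2 \<partial>M)"
    unfolding sq by (intro nn_integral_eq_integral) auto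
  show i1: "integrable M f'" by (rule square_integrable_imp_integrable[OF m i2])
  have "(\<integral>\<^sup>+x. f x \<partial>M) = (\<integral>\<^sup>+x. ennreal (f' x) \<partial>M)"
    by (rule nn_integral_cong_AE[OF ae])
  also have "\<dots> = ennreal (\<integral>x. f' x \<partial>M)" by (rule nn_integral_eq_integral[OF i1]) (simp add: f'_def)
  finally show "(\<integral>\<^sup>+x. f x \<partial>M) = ennreal (\<integral>x. f' x \<partial>M)" .
qed

text \<open>
  The subtraction truncates at 0, so the first integral sees only the positive part of the deviation;
  this costs nothing below, and keeps all functions nonnegative.
\<close>

lemma (in prob_space) nn_integral_variance:
  fixes f :: "'a \<Rightarrow> ennreal"
  assumes [measurable]: "f \<in> borel_measurable M"
  shows "(\<integral>\<^sup>+x. (f x - (\<integral>\<^sup>+y. f y \<partial>M))\<^sup>2 \<partial>M) + (\<integral>\<^sup>+x. f x \<partial>M)\<^sup>2 \<le> (\<integral>\<^sup>+x. (f x)\<^sup>2 \<partial>M)"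
proof (cases "(\<integral>\<^sup>+x. (f x)\<^sup>2 \<partial>M) = \<infinity>")
  case False
  note F = finite_second_moment[OF assms False]
  let ?f = "\<lambda>x. enn2real (f x)"
  let ?m = "\<integral>x. ?f x \<partial>M"
  have m: "0 \<le> ?m" by (intro Bochner_Integration.integral_nonneg) simp
  have id: "integrable M (\<lambda>x. (?f x - ?m)\<^sup>2)" "(\<integral>x. (?f x - ?m)\<^sup>2 \<partial>M) = (\<integral>x. (?f x)\<^sup>2 \<partial>M) - ?m\<^sup>2"
    using F(3,4) variance_eq[OF F(4,3)] by (simp_all add: power2_diff)
  have "(\<integral>\<^sup>+x. (f x - (\<integral>\<^sup>+y. f y \<partial>M))\<^sup>2 \<partial>M) \<le> (\<integral>\<^sup>+x. ennreal ((?f x - ?m)\<^sup>2) \<partial>M)"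
  proof (rule nn_integral_mono_AE, use F(1) in eventually_elim)
    fix x assume "f x = ennreal (?f x)"
    then have "f x - (\<integral>\<^sup>+y. f y \<partial>M) = ennreal (?f x - ?m)"
      using m unfolding F(6) by (metis ennreal_minus)
    then show "(f x - (\<integral>\<^sup>+y. f y \<partial>M))\<^sup>2 \<le> ennreal ((?f x - ?m)\<^sup>2)"
      by (cases "?f x - ?m \<ge> 0") (auto simp: ennreal_power ennreal_neg)
  qed
  also have "\<dots> = ennreal ((\<integral>x. (?f x)\<^sup>2 \<partial>M) - ?m\<^sup>2)"
    using id by (subst nn_integral_eq_integral) auto
  finally have "(\<integral>\<^sup>+x. (f x - (\<integral>\<^sup>+y. f y \<partial>M))\<^sup>2 \<partial>M) + (\<integral>\<^sup>+x. f x \<partial>M)\<^sup>2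
      \<le> ennreal ((\<integral>x. (?f x)\<^sup>2 \<partial>M) - ?m\<^sup>2) + ennreal (?m\<^sup>2)"
    unfolding F(6) using m by (simp add: ennreal_power add_right_mono)
  also have "\<dots> = ennreal (\<integral>x. (?f x)\<^sup>2 \<partial>M)"
  proof -
    have "0 \<le> (\<integral>x. (?f x - ?m)\<^sup>2 \<partial>M)" by (intro Bochner_Integration.integral_nonneg) simp
    then show ?thesis unfolding id(2) by (subst ennreal_plus[symmetric]) auto
  qed
  finally show ?thesis by (simp add: F(5))
qed simp

locale kernel_transition =
  fixes X :: "'x measure" and \<mu> \<mu>' :: "'x measure" and \<kappa> :: "'x \<Rightarrow> 'x measure"
  assumes \<mu>: "\<mu> \<in> space (prob_algebra X)" and \<mu>': "\<mu>' \<in> space (prob_algebra X)"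
    and \<kappa>: "\<kappa> \<in> measurable X (prob_algebra X)"
    and image: "\<And>f. f \<in> borel_measurable X \<Longrightarrow> (\<integral>\<^sup>+x. \<integral>\<^sup>+y. f y \<partial>\<kappa> x \<partial>\<mu>) = (\<integral>\<^sup>+y. f y \<partial>\<mu>')"
begin

lemma sets_eq [measurable_cong, simp]: "sets \<mu> = sets X" "sets \<mu>' = sets X"
  using \<mu> \<mu>' by (auto simp: space_prob_algebra)

lemma space_eq: "space \<mu> = space X" "space \<mu>' = space X"
  using sets_eq_imp_space_eq[of \<mu> X] sets_eq_imp_space_eq[of \<mu>' X] by simp_all

sublocale \<mu>: prob_space \<mu> using \<mu> by (simp add: space_prob_algebra)
sublocale \<mu>': prob_space \<mu>' using \<mu>' by (simp add: space_prob_algebra)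

lemma kernel_prob: "x \<in> space X \<Longrightarrow> prob_space (\<kappa> x) \<and> sets (\<kappa> x) = sets X"
  using measurable_space[OF \<kappa>, of x] by (auto simp: space_prob_algebra)

lemma kernel_subprob [measurable]: "\<kappa> \<in> measurable X (subprob_algebra X)"
  by (rule measurable_prob_algebraD[OF \<kappa>])

lemma kernel_nn_measurable [measurable]:
  "f \<in> borel_measurable X \<Longrightarrow> (\<lambda>x. \<integral>\<^sup>+y. f y \<partial>\<kappa> x) \<in> borel_measurable X"
  by (rule measurable_compose[OF kernel_subprob nn_integral_measurable_subprob_algebra])

lemma kernel_measurable:
  "x \<in> space X \<Longrightarrow> f \<in> borel_measurable X \<Longrightarrow> f \<in> borel_measurable (\<kappa> x)"
  using kernel_prob[of x] by (simp cong: measurable_cong_sets)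

lemma kernel_op_measurable:
  assumes [measurable]: "f \<in> borel_measurable X"
  shows "kernel_op \<kappa> f \<in> borel_measurable X"
proof -
  have "(\<lambda>x. if (\<integral>\<^sup>+y. ennreal \<bar>f y\<bar> \<partial>\<kappa> x) < \<infinity>
      then enn2real (\<integral>\<^sup>+y. ennreal (f y) \<partial>\<kappa> x) - enn2real (\<integral>\<^sup>+y. ennreal (- f y) \<partial>\<kappa> x) else 0) \<in> borel_measurable X"
    by measurable
  then show ?thesis
  proof (rule measurable_cong[THEN iffD1, rotated])
    fix x assume x: "x \<in> space X"
    note m = kernel_measurable[OF x assms]
    show "(if (\<integral>\<^sup>+y. ennreal \<bar>f y\<bar> \<partial>\<kappa> x) < \<infinity>
      then enn2real (\<integral>\<^sup>+y. ennreal (f y) \<partial>\<kappa> x) - enn2real (\<integral>\<^sup>+y. ennreal (- f y) \<partial>\<kappa> x) else 0) = kernel_op \<kappa> f x"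
    proof (cases "integrable (\<kappa> x) f")
      case True
      then show ?thesis unfolding kernel_op_def real_lebesgue_integral_def[OF True]
        by (simp add: integrable_iff_bounded)
    next
      case False
      then show ?thesis using m by (simp add: kernel_op_def integrable_iff_bounded not_integrable_integral_eq)
    qed
  qed
qed

lemma kernel_op_square_le:
  assumes f[measurable]: "f \<in> borel_measurable X" and int: "integrable \<mu>' (\<lambda>x. (f x)\<^sup>2)"
  shows "integrable \<mu> (\<lambda>x. (kernel_op \<kappa> f x)\<^sup>2)" "(\<integral>x. (kernel_op \<kappa> f x)\<^sup>2 \<partial>\<mu>) \<le> (\<integral>x. (f x)\<^sup>2 \<partial>\<mu>')"
proof -
  have [measurable]: "kernel_op \<kappa> f \<in> borel_measurable X" by (rule kernel_op_measurable[OF f])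
  have pt: "ennreal ((kernel_op \<kappa> f x)\<^sup>2) \<le> (\<integral>\<^sup>+y. ennreal ((f y)\<^sup>2) \<partial>\<kappa> x)" if x: "x \<in> space X" for x
  proof -
    interpret K: prob_space "\<kappa> x" using kernel_prob[OF x] by simp
    note m = kernel_measurable[OF x f]
    have "ennreal \<bar>kernel_op \<kappa> f x\<bar> \<le> (\<integral>\<^sup>+y. ennreal \<bar>f y\<bar> \<partial>\<kappa> x)"
      using integral_norm_bound_ennreal[of "\<kappa> x" f]
      by (cases "integrable (\<kappa> x) f") (simp_all add: kernel_op_def not_integrable_integral_eq)
    then have "(ennreal \<bar>kernel_op \<kappa> f x\<bar>)\<^sup>2 \<le> (\<integral>\<^sup>+y. ennreal \<bar>f y\<bar> \<partial>\<kappa> x)\<^sup>2" by (intro power_mono) auto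
    also have "\<dots> \<le> (\<integral>\<^sup>+y. (ennreal \<bar>f y\<bar>)\<^sup>2 \<partial>\<kappa> x)"
      using m by (intro K.nn_integral_square_Jensen) auto
    finally show ?thesis by (simp add: ennreal_power)
  qed
  have le: "(\<integral>\<^sup>+x. ennreal ((kernel_op \<kappa> f x)\<^sup>2) \<partial>\<mu>) \<le> (\<integral>\<^sup>+x. ennreal ((f x)\<^sup>2) \<partial>\<mu>')"
    by (subst image[symmetric]) (auto intro!: nn_integral_mono pt simp: space_eq)
  also have fe: "\<dots> = ennreal (\<integral>x. (f x)\<^sup>2 \<partial>\<mu>')" by (rule nn_integral_eq_integral[OF int]) simp
  finally have le': "(\<integral>\<^sup>+x. ennreal ((kernel_op \<kappa> f x)\<^sup>2) \<partial>\<mu>) \<le> ennreal (\<integral>x. (f x)\<^sup>2 \<partial>\<mu>')" .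
  show i: "integrable \<mu> (\<lambda>x. (kernel_op \<kappa> f x)\<^sup>2)"
    by (rule integrableI_nonneg) (use le' in \<open>auto intro: le_less_trans\<close>)
  show "(\<integral>x. (kernel_op \<kappa> f x)\<^sup>2 \<partial>\<mu>) \<le> (\<integral>x. (f x)\<^sup>2 \<partial>\<mu>')"
    using le' nn_integral_eq_integral[OF i] by (simp add: ennreal_le_iff)
qed

text \<open>
  The operator norm is a supremum of reals, so it bounds its elements only because the set is
  bounded, which is Jensen's inequality. A function of norm 0 cannot be normalised; there the
  conclusion is Jensen's inequality again.
\<close>

lemma centered_op_norm_bound:
  assumes c: "centered_op_norm \<mu> \<mu>' \<kappa> \<le> c" "0 \<le> c" and f: "f \<in> H_centered \<mu>'"
  shows "(\<integral>x. (kernel_op \<kappa> f x)\<^sup>2 \<partial>\<mu>) \<le> c\<^sup>2 * (\<integral>x. (f x)\<^sup>2 \<partial>\<mu>')"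
proof -
  let ?S = "{H_norm \<mu> (kernel_op \<kappa> f) | f. f \<in> H_centered \<mu>' \<and> H_norm \<mu>' f \<le> 1}"
  have HX: "h \<in> borel_measurable X" "integrable \<mu>' (\<lambda>x. (h x)\<^sup>2)" if "h \<in> H_centered \<mu>'" for h
    using that by (auto simp: H_centered_def cong: measurable_cong_sets)
  have le: "H_norm \<mu> (kernel_op \<kappa> h) \<le> H_norm \<mu>' h" if "h \<in> H_centered \<mu>'" for h
    unfolding H_norm_def by (rule real_sqrt_le_mono, rule kernel_op_square_le(2)) (use HX[OF that] in auto)
  have bdd: "bdd_above ?S" using le by (intro bdd_aboveI[of _ 1]) (force intro: order_trans)
  have unit: "H_norm \<mu> (kernel_op \<kappa> h) \<le> c" if "h \<in> H_centered \<mu>'" "H_norm \<mu>' h \<le> 1" for h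
    using cSup_upper[OF _ bdd, of "H_norm \<mu> (kernel_op \<kappa> h)"] c(1) that unfolding centered_op_norm_def by fastforce
  let ?s = "H_norm \<mu>' f"
  have s2: "?s\<^sup>2 = (\<integral>x. (f x)\<^sup>2 \<partial>\<mu>')" and s0: "0 \<le> ?s"
    by (simp_all add: H_norm_def)
  show ?thesis
  proof (cases "?s = 0")
    case True
    then show ?thesis using kernel_op_square_le(2)[OF HX[OF f]] s2 by simp
  next
    case False
    with s0 have s: "?s > 0" by simp
    let ?h = "\<lambda>x. (1 / ?s) * f x"
    have hc: "?h \<in> H_centered \<mu>'" using f by (auto simp: H_centered_def power_mult_distrib power_divide)
    have hn: "H_norm \<mu>' ?h = 1"
      using s s2 by (simp add: H_norm_def power_divide real_sqrt_divide)
    have kh: "kernel_op \<kappa> ?h = (\<lambda>x. (1 / ?s) * kernel_op \<kappa> f x)"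
      by (rule ext) (simp only: kernel_op_def integral_mult_right_zero)
    have "(H_norm \<mu> (kernel_op \<kappa> ?h))\<^sup>2 \<le> c\<^sup>2"
      using unit[OF hc] hn by (intro power_mono) (auto simp: H_norm_def)
    also have "(H_norm \<mu> (kernel_op \<kappa> ?h))\<^sup>2 = (\<integral>x. ((1 / ?s) * kernel_op \<kappa> f x)\<^sup>2 \<partial>\<mu>)"
      unfolding kh by (simp add: H_norm_def)
    also have "\<dots> = (\<integral>x. (kernel_op \<kappa> f x)\<^sup>2 \<partial>\<mu>) / ?s\<^sup>2"
      by (simp add: power_mult_distrib power_divide)
    finally show ?thesis using s by (simp add: s2[symmetric] field_simps)
  qed
qed

text \<open>
  Split \<open>f\<close> into its mean \<open>m\<close> and the centered part \<open>f0\<close>. The kernel fixes constants and maps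
  centered functions to centered functions, so the two parts stay orthogonal, and only the second one
  is contracted.
\<close>

theorem kernel_contraction:
  fixes f :: "'x \<Rightarrow> ennreal"
  assumes c: "centered_op_norm \<mu> \<mu>' \<kappa> \<le> c" "0 < c" "c < 1" and f[measurable]: "f \<in> borel_measurable X"
  shows "(\<integral>\<^sup>+x. (\<integral>\<^sup>+y. f y \<partial>\<kappa> x)\<^sup>2 \<partial>\<mu>)
    \<le> ennreal (c\<^sup>2) * (\<integral>\<^sup>+y. (f y)\<^sup>2 \<partial>\<mu>') + ennreal (1 - c\<^sup>2) * (\<integral>\<^sup>+y. f y \<partial>\<mu>')\<^sup>2"
proof (cases "(\<integral>\<^sup>+y. (f y)\<^sup>2 \<partial>\<mu>') = \<infinity>")
  case True
  then show ?thesis using c by (simp add: ennreal_mult_top)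
next
  case False
  have fm': "f \<in> borel_measurable \<mu>'" by measurable
  note F = \<mu>'.finite_second_moment[OF fm' False]
  define f' where "f' x = enn2real (f x)" for x
  note F = F[folded f'_def]
  have f'[measurable]: "f' \<in> borel_measurable X" unfolding f'_def by measurable
  define m where "m = (\<integral>x. f' x \<partial>\<mu>')"
  have m0: "0 \<le> m" unfolding m_def by (intro Bochner_Integration.integral_nonneg) (simp add: f'_def)
  define f0 where "f0 x = f' x - m" for x
  have [measurable]: "f0 \<in> borel_measurable X" unfolding f0_def by measurable
  have f0: "f0 \<in> H_centered \<mu>'" and f0sq: "(\<integral>x. (f0 x)\<^sup>2 \<partial>\<mu>') = (\<integral>x. (f' x)\<^sup>2 \<partial>\<mu>') - m\<^sup>2"
  proof -
    have "integrable \<mu>' (\<lambda>x. (f0 x)\<^sup>2)" "(\<integral>x. f0 x \<partial>\<mu>') = 0"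
      using F(3,4) unfolding f0_def by (simp_all add: power2_diff \<mu>'.prob_space m_def[symmetric])
    moreover have "(\<integral>x. (f0 x)\<^sup>2 \<partial>\<mu>') = (\<integral>x. (f' x)\<^sup>2 \<partial>\<mu>') - m\<^sup>2"
      using \<mu>'.variance_eq[OF F(4,3)] by (simp add: f0_def m_def)
    ultimately show "f0 \<in> H_centered \<mu>'" "(\<integral>x. (f0 x)\<^sup>2 \<partial>\<mu>') = (\<integral>x. (f' x)\<^sup>2 \<partial>\<mu>') - m\<^sup>2"
      by (auto simp: H_centered_def)
  qed
  let ?k = "kernel_op \<kappa> f0"
  have [measurable]: "?k \<in> borel_measurable X" by (rule kernel_op_measurable) measurable
  have ae: "AE x in \<mu>. (\<integral>\<^sup>+y. f y \<partial>\<kappa> x) = ennreal (m + ?k x) \<and> 0 \<le> m + ?k x"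
  proof -
    have "(\<integral>\<^sup>+x. \<integral>\<^sup>+y. (f y)\<^sup>2 \<partial>\<kappa> x \<partial>\<mu>) \<noteq> \<infinity>" using False by (subst image) auto
    then have "AE x in \<mu>. (\<integral>\<^sup>+y. (f y)\<^sup>2 \<partial>\<kappa> x) \<noteq> \<infinity>" by (intro nn_integral_PInf_AE) auto
    with AE_space[of \<mu>] show ?thesis
    proof eventually_elim
      fix x assume x: "x \<in> space \<mu>" and fin: "(\<integral>\<^sup>+y. (f y)\<^sup>2 \<partial>\<kappa> x) \<noteq> \<infinity>"
      then have xX: "x \<in> space X" by (simp add: space_eq)
      interpret K: prob_space "\<kappa> x" using kernel_prob[OF xX] by simp
      note G = K.finite_second_moment[OF kernel_measurable[OF xX f] fin, folded f'_def]
      have "?k x = (\<integral>y. f' y \<partial>\<kappa> x) - m"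
        unfolding kernel_op_def f0_def using G(4) by (simp add: K.prob_space)
      moreover have "0 \<le> (\<integral>y. f' y \<partial>\<kappa> x)" by (intro Bochner_Integration.integral_nonneg) (simp add: f'_def)
      ultimately show "(\<integral>\<^sup>+y. f y \<partial>\<kappa> x) = ennreal (m + ?k x) \<and> 0 \<le> m + ?k x" using G(6) by simp
    qed
  qed
  have k2: "integrable \<mu> (\<lambda>x. (?k x)\<^sup>2)" and kc: "(\<integral>x. (?k x)\<^sup>2 \<partial>\<mu>) \<le> c\<^sup>2 * (\<integral>x. (f0 x)\<^sup>2 \<partial>\<mu>')"
    using kernel_op_square_le(1)[of f0] centered_op_norm_bound[OF c(1) _ f0] f0 c
    by (auto simp: H_centered_def)
  have k1: "integrable \<mu> ?k" by (rule \<mu>.square_integrable_imp_integrable[OF _ k2]) measurable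
  have kmean: "(\<integral>x. ?k x \<partial>\<mu>) = 0"
  proof -
    have "ennreal m = (\<integral>\<^sup>+x. \<integral>\<^sup>+y. f y \<partial>\<kappa> x \<partial>\<mu>)" using F(6) by (simp add: image m_def)
    also have "\<dots> = (\<integral>\<^sup>+x. ennreal (m + ?k x) \<partial>\<mu>)"
      by (rule nn_integral_cong_AE, use ae in eventually_elim) simp
    also have "\<dots> = ennreal (\<integral>x. m + ?k x \<partial>\<mu>)"
      by (rule nn_integral_eq_integral) (use k1 ae in auto)
    finally have "m = (\<integral>x. m + ?k x \<partial>\<mu>)"
      using m0 by (subst (asm) ennreal_inj) (auto intro!: integral_nonneg_AE eventually_mono[OF ae])
    then show ?thesis using k1 by (simp add: \<mu>.prob_space)
  qed
  have int: "integrable \<mu> (\<lambda>x. (m + ?k x)\<^sup>2)" "(\<integral>x. (m + ?k x)\<^sup>2 \<partial>\<mu>) = m\<^sup>2 + (\<integral>x. (?k x)\<^sup>2 \<partial>\<mu>)"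
    using k1 k2 kmean by (simp_all add: power2_sum \<mu>.prob_space)
  have "(\<integral>\<^sup>+x. (\<integral>\<^sup>+y. f y \<partial>\<kappa> x)\<^sup>2 \<partial>\<mu>) = (\<integral>\<^sup>+x. ennreal ((m + ?k x)\<^sup>2) \<partial>\<mu>)"
    by (rule nn_integral_cong_AE, use ae in eventually_elim) (simp add: ennreal_power)
  also have "\<dots> = ennreal (m\<^sup>2 + (\<integral>x. (?k x)\<^sup>2 \<partial>\<mu>))"
    using int by (subst nn_integral_eq_integral) auto
  also have "\<dots> \<le> ennreal (c\<^sup>2 * (\<integral>x. (f' x)\<^sup>2 \<partial>\<mu>') + (1 - c\<^sup>2) * m\<^sup>2)"
    using kc unfolding f0sq by (intro ennreal_leI) (simp add: algebra_simps)
  also have "\<dots> = ennreal (c\<^sup>2) * ennreal (\<integral>x. (f' x)\<^sup>2 \<partial>\<mu>') + ennreal (1 - c\<^sup>2) * (ennreal m)\<^sup>2"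
  proof -
    have "c\<^sup>2 \<le> 1" using c by (simp add: power_le_one)
    then show ?thesis using m0 by (simp add: ennreal_plus ennreal_mult ennreal_power)
  qed
  finally show ?thesis using F(5,6) by (simp add: m_def)
qed

lemma kernel_contraction_weak:
  assumes f[measurable]: "f \<in> borel_measurable X"
  shows "(\<integral>\<^sup>+x. (\<integral>\<^sup>+y. f y \<partial>\<kappa> x)\<^sup>2 \<partial>\<mu>) \<le> (\<integral>\<^sup>+y. (f y)\<^sup>2 \<partial>\<mu>')"
proof -
  have "(\<integral>\<^sup>+x. (\<integral>\<^sup>+y. f y \<partial>\<kappa> x)\<^sup>2 \<partial>\<mu>) \<le> (\<integral>\<^sup>+x. \<integral>\<^sup>+y. (f y)\<^sup>2 \<partial>\<kappa> x \<partial>\<mu>)"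
  proof (rule nn_integral_mono)
    fix x assume "x \<in> space \<mu>"
    then have x: "x \<in> space X" by (simp add: space_eq)
    interpret K: prob_space "\<kappa> x" using kernel_prob[OF x] by simp
    show "(\<integral>\<^sup>+y. f y \<partial>\<kappa> x)\<^sup>2 \<le> (\<integral>\<^sup>+y. (f y)\<^sup>2 \<partial>\<kappa> x)"
      by (rule K.nn_integral_square_Jensen[OF kernel_measurable[OF x f]])
  qed
  also have "\<dots> = (\<integral>\<^sup>+y. (f y)\<^sup>2 \<partial>\<mu>')" by (rule image) measurable
  finally show ?thesis .
qed
end

section \<open>Markov chains and products along them\<close>

locale markov =
  fixes P :: "'w measure" and X :: "'x measure" and \<xi> :: "nat \<Rightarrow> 'w \<Rightarrow> 'x" and k :: "nat \<Rightarrow> 'x \<Rightarrow> 'x measure"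
  assumes chain: "markov_chain P X \<xi> k"
begin

sublocale prob_space P using chain by (simp add: markov_chain_def)

lemma state_measurable [measurable]: "i \<ge> 1 \<Longrightarrow> \<xi> i \<in> measurable P X"
  using chain by (simp add: markov_chain_def)

lemma kernel_measurable: "i \<ge> 1 \<Longrightarrow> k i \<in> measurable X (prob_algebra X)"
  using chain by (simp add: markov_chain_def)

lemma kernel_subprob: "i \<ge> 1 \<Longrightarrow> k i \<in> measurable X (subprob_algebra X)"
  by (rule measurable_prob_algebraD[OF kernel_measurable])

abbreviation "past n \<equiv> past_algebra P X \<xi> n"

lemma past_map: "(\<lambda>\<omega>. \<lambda>i\<in>{1..n}. \<xi> i \<omega>) \<in> measurable P (PiM {1..n} (\<lambda>_. X))"
  by (rule measurable_restrict) auto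

lemma past_state [measurable]:
  assumes "1 \<le> i" "i \<le> n"
  shows "\<xi> i \<in> measurable (past n) X"
proof -
  have "(\<lambda>\<omega>. \<lambda>i\<in>{1..n}. \<xi> i \<omega>) \<in> measurable (past n) (PiM {1..n} (\<lambda>_. X))"
    unfolding past_algebra_def using measurable_space[OF past_map] by (intro measurable_vimage_algebra1) auto
  then have "(\<lambda>\<omega>. (\<lambda>i\<in>{1..n}. \<xi> i \<omega>) i) \<in> measurable (past n) X"
    by (rule measurable_compose[OF _ measurable_component_singleton]) (use assms in auto)
  then show ?thesis using assms by simp
qed

lemma past_subalgebra: "subalgebra P (past n)"
proof -
  have sp: "(\<lambda>\<omega>. \<lambda>i\<in>{1..n}. \<xi> i \<omega>) \<in> space P \<rightarrow> space (PiM {1..n} (\<lambda>_. X))"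
    using measurable_space[OF past_map] by auto
  show ?thesis
    unfolding subalgebra_def past_algebra_def sets_vimage_algebra2[OF sp]
    using measurable_sets[OF past_map] by auto
qed

text \<open>
  Both sides integrate \<open>F\<close> against a measure on the product space. On a rectangle the two measures
  agree by the definition of conditional probability, and rectangles generate.
\<close>

lemma markov_property:
  assumes n: "n \<ge> 1" and Y: "Y \<in> measurable (past n) N" and F: "F \<in> borel_measurable (X \<Otimes>\<^sub>M N)"
  shows "(\<integral>\<^sup>+\<omega>. F (\<xi> (n + 1) \<omega>, Y \<omega>) \<partial>P) = (\<integral>\<^sup>+\<omega>. \<integral>\<^sup>+y. F (y, Y \<omega>) \<partial>k n (\<xi> n \<omega>) \<partial>P)"
proof -
  have YP[measurable]: "Y \<in> measurable P N" by (rule measurable_from_subalg[OF past_subalgebra Y])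
  have [measurable]: "\<xi> n \<in> measurable P X" "\<xi> (n + 1) \<in> measurable P X" using n by auto
  interpret past: finite_measure_subalgebra P "past n"
    by standard (rule past_subalgebra)
  have kn: "(\<lambda>\<omega>. k n (\<xi> n \<omega>)) \<in> measurable P (subprob_algebra X)"
    using kernel_subprob[OF n] by measurable
  have ksets: "sets (k n (\<xi> n \<omega>)) = sets X" "prob_space (k n (\<xi> n \<omega>))" if "\<omega> \<in> space P" for \<omega>
    using measurable_space[OF kernel_measurable[OF n] measurable_space[OF \<open>\<xi> n \<in> _\<close> that]]
    by (auto simp: space_prob_algebra)
  define K where "K \<omega> = distr (k n (\<xi> n \<omega>)) (X \<Otimes>\<^sub>M N) (\<lambda>y. (y, Y \<omega>))" for \<omega>
  have K: "K \<in> measurable P (subprob_algebra (X \<Otimes>\<^sub>M N))"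
    unfolding K_def by (rule measurable_distr2[OF _ kn]) measurable
  have Kpair: "(\<lambda>y. (y, Y \<omega>)) \<in> measurable (k n (\<xi> n \<omega>)) (X \<Otimes>\<^sub>M N)" if "\<omega> \<in> space P" for \<omega>
    using measurable_space[OF YP that] by (simp add: ksets(1)[OF that] cong: measurable_cong_sets)
  define D1 where "D1 = distr P (X \<Otimes>\<^sub>M N) (\<lambda>\<omega>. (\<xi> (n + 1) \<omega>, Y \<omega>))"
  define D2 where "D2 = P \<bind> K"
  have "D1 = D2"
  proof (rule measure_eqI_generator_eq[where A="\<lambda>_. space X \<times> space N" and \<Omega>="space X \<times> space N"])
    show "Int_stable {a \<times> b |a b. a \<in> sets X \<and> b \<in> sets N}" by (rule Int_stable_pair_measure_generator)
    show "{a \<times> b |a b. a \<in> sets X \<and> b \<in> sets N} \<subseteq> Pow (space X \<times> space N)" by (rule pair_measure_closed)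
    show "sets D1 = sigma_sets (space X \<times> space N) {a \<times> b |a b. a \<in> sets X \<and> b \<in> sets N}"
      by (simp add: D1_def sets_pair_measure)
    show "sets D2 = sigma_sets (space X \<times> space N) {a \<times> b |a b. a \<in> sets X \<and> b \<in> sets N}"
      unfolding D2_def using sets_bind[OF sets_kernel[OF K] not_empty] by (simp add: sets_pair_measure)
    have D1p: "prob_space D1" unfolding D1_def by (rule prob_space_distr) measurable
    then show "emeasure D1 (space X \<times> space N) \<noteq> \<infinity>" for i :: nat
      using finite_measure.emeasure_finite[OF prob_space.finite_measure] by auto
    fix Z assume "Z \<in> {a \<times> b |a b. a \<in> sets X \<and> b \<in> sets N}"
    then obtain A B where Z: "Z = A \<times> B" and A[measurable]: "A \<in> sets X" and B[measurable]: "B \<in> sets N" by blast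
    let ?f = "\<lambda>\<omega>. indicator B (Y \<omega>) :: real" and ?h = "indicator (\<xi> (n + 1) -` A \<inter> space P) :: _ \<Rightarrow> real"
    have hm: "?h \<in> borel_measurable P" by measurable
    have fm: "?f \<in> borel_measurable (past n)" using Y by measurable
    have fi: "integrable P (\<lambda>\<omega>. ?f \<omega> * ?h \<omega>)"
      by (rule integrable_const_bound[of _ 1]) (use hm in \<open>auto simp: indicator_def\<close>)
    have km: "(\<lambda>\<omega>. measure (k n (\<xi> n \<omega>)) A) \<in> borel_measurable P"
      by (rule measurable_compose[OF kn measurable_measure_subprob_algebra[OF A]])
    have ae: "AE \<omega> in P. real_cond_exp P (past n) ?h \<omega> = measure (k n (\<xi> n \<omega>)) A"
      using chain n A by (simp add: markov_chain_def)
    have "(\<integral>\<omega>. ?f \<omega> * ?h \<omega> \<partial>P) = (\<integral>\<omega>. ?f \<omega> * real_cond_exp P (past n) ?h \<omega> \<partial>P)"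
      by (rule past.real_cond_exp_intg(2)[OF fi fm hm, symmetric])
    also have "\<dots> = (\<integral>\<omega>. ?f \<omega> * measure (k n (\<xi> n \<omega>)) A \<partial>P)"
      by (rule integral_cong_AE) (use ae km in auto)
    finally have eq: "(\<integral>\<omega>. ?f \<omega> * ?h \<omega> \<partial>P) = (\<integral>\<omega>. ?f \<omega> * measure (k n (\<xi> n \<omega>)) A \<partial>P)" .
    have ki: "integrable P (\<lambda>\<omega>. ?f \<omega> * measure (k n (\<xi> n \<omega>)) A)"
      by (rule integrable_const_bound[of _ 1])
        (use km prob_space.prob_le_1[OF ksets(2)] in \<open>auto simp: indicator_def\<close>)
    have "emeasure D1 Z = (\<integral>\<^sup>+\<omega>. ennreal (?f \<omega> * ?h \<omega>) \<partial>P)"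
    proof -
      have "emeasure D1 Z = (\<integral>\<^sup>+z. indicator Z z \<partial>D1)"
        by (subst nn_integral_indicator) (auto simp: D1_def Z)
      also have "\<dots> = (\<integral>\<^sup>+\<omega>. indicator Z (\<xi> (n + 1) \<omega>, Y \<omega>) \<partial>P)"
        unfolding D1_def by (rule nn_integral_distr) (auto simp: Z)
      also have "\<dots> = (\<integral>\<^sup>+\<omega>. ennreal (?f \<omega> * ?h \<omega>) \<partial>P)"
        by (rule nn_integral_cong) (auto simp: Z indicator_def)
      finally show ?thesis .
    qed
    also have "\<dots> = (\<integral>\<^sup>+\<omega>. ennreal (?f \<omega> * measure (k n (\<xi> n \<omega>)) A) \<partial>P)"
      using nn_integral_eq_integral[OF fi] nn_integral_eq_integral[OF ki] eq by simp
    also have "\<dots> = (\<integral>\<^sup>+\<omega>. emeasure (K \<omega>) Z \<partial>P)"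
    proof (rule nn_integral_cong)
      fix \<omega> assume \<omega>: "\<omega> \<in> space P"
      interpret kk: prob_space "k n (\<xi> n \<omega>)" by (rule ksets(2)[OF \<omega>])
      have "emeasure (K \<omega>) Z = emeasure (k n (\<xi> n \<omega>)) ((\<lambda>y. (y, Y \<omega>)) -` Z \<inter> space (k n (\<xi> n \<omega>)))"
        unfolding K_def by (rule emeasure_distr[OF Kpair[OF \<omega>]]) (simp add: Z)
      also have "(\<lambda>y. (y, Y \<omega>)) -` Z \<inter> space (k n (\<xi> n \<omega>)) = (if Y \<omega> \<in> B then A else {})"
        using sets.sets_into_space[OF A] sets_eq_imp_space_eq[OF ksets(1)[OF \<omega>]] by (auto simp: Z)
      finally show "ennreal (?f \<omega> * measure (k n (\<xi> n \<omega>)) A) = emeasure (K \<omega>) Z"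
        by (simp add: indicator_def kk.emeasure_eq_measure)
    qed
    also have "\<dots> = emeasure D2 Z"
      unfolding D2_def by (rule emeasure_bind[OF not_empty K, symmetric]) (simp add: Z)
    finally show "emeasure D1 Z = emeasure D2 Z" .
  qed auto
  have "(\<integral>\<^sup>+\<omega>. F (\<xi> (n + 1) \<omega>, Y \<omega>) \<partial>P) = (\<integral>\<^sup>+z. F z \<partial>D1)"
    unfolding D1_def by (rule nn_integral_distr[symmetric]) (use F in auto)
  also have "\<dots> = (\<integral>\<^sup>+\<omega>. \<integral>\<^sup>+z. F z \<partial>K \<omega> \<partial>P)"
    unfolding \<open>D1 = D2\<close> D2_def by (rule nn_integral_bind[OF F K])
  also have "\<dots> = (\<integral>\<^sup>+\<omega>. \<integral>\<^sup>+y. F (y, Y \<omega>) \<partial>k n (\<xi> n \<omega>) \<partial>P)"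
    unfolding K_def by (intro nn_integral_cong nn_integral_distr Kpair) (use F in auto)
  finally show ?thesis .
qed

abbreviation "law i \<equiv> distr P X (\<xi> i)"

lemma nn_integral_law: "i \<ge> 1 \<Longrightarrow> f \<in> borel_measurable X \<Longrightarrow> (\<integral>\<^sup>+x. f x \<partial>law i) = (\<integral>\<^sup>+\<omega>. f (\<xi> i \<omega>) \<partial>P)"
  by (rule nn_integral_distr) auto

lemma prob_space_law: "i \<ge> 1 \<Longrightarrow> prob_space (law i)"
  by (rule prob_space_distr) auto

lemma kernel_transition_law:
  assumes i: "i \<ge> 1"
  shows "kernel_transition X (law i) (law (i + 1)) (k i)"
proof
  show "law i \<in> space (prob_algebra X)" "law (i + 1) \<in> space (prob_algebra X)"
    using prob_space_law i by (auto simp: space_prob_algebra)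
  show "k i \<in> measurable X (prob_algebra X)" by (rule kernel_measurable[OF i])
  fix f :: "'x \<Rightarrow> ennreal" assume f[measurable]: "f \<in> borel_measurable X"
  have "(\<integral>\<^sup>+x. \<integral>\<^sup>+y. f y \<partial>k i x \<partial>law i) = (\<integral>\<^sup>+\<omega>. \<integral>\<^sup>+y. f y \<partial>k i (\<xi> i \<omega>) \<partial>P)"
    by (rule nn_integral_law[OF i])
      (rule measurable_compose[OF kernel_subprob[OF i] nn_integral_measurable_subprob_algebra[OF f]])
  also have "\<dots> = (\<integral>\<^sup>+\<omega>. f (\<xi> (i + 1) \<omega>) \<partial>P)"
    using markov_property[OF i past_state[OF i order_refl], of "\<lambda>z. f (fst z)"] by simp
  also have "\<dots> = (\<integral>\<^sup>+y. f y \<partial>law (i + 1))"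
    by (rule nn_integral_law[symmetric]) auto
  finally show "(\<integral>\<^sup>+x. \<integral>\<^sup>+y. f y \<partial>k i x \<partial>law i) = (\<integral>\<^sup>+y. f y \<partial>law (i + 1))" .
qed

end

text \<open>
  The values depend on the length only, so the composition with a matrix is bounded below in terms of
  the norm of the matrix.
\<close>

definition base_density :: "real^'m \<Rightarrow> ennreal" where
  "base_density v = ennreal (norm v powr (- real CARD('m) / 2))"

lemma half_density_base: "half_density (base_density :: real^'m \<Rightarrow> ennreal)"
  unfolding homogeneous_def base_density_def by (auto simp: powr_mult ennreal_mult)

text \<open>
  \<open>expected_density k g d i x v\<close> is the conditional expectation of
  \<open>base_density (g (i + d) \<dots> g (i + 1) v)\<close>, given that the chain is at \<open>x\<close> at time \<open>i\<close>. The
  recursion removes the factor with the smallest index, so it runs backwards in time.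
\<close>

primrec expected_density ::
    "(nat \<Rightarrow> 'x \<Rightarrow> 'x measure) \<Rightarrow> (nat \<Rightarrow> 'x \<Rightarrow> real^'m^'m) \<Rightarrow> nat \<Rightarrow> nat \<Rightarrow> 'x \<Rightarrow> real^'m \<Rightarrow> ennreal" where
  "expected_density k g 0 = (\<lambda>i x v. base_density v)"
| "expected_density k g (Suc d) = (\<lambda>i x v. \<integral>\<^sup>+y. expected_density k g d (i + 1) y (g (i + 1) y *v v) \<partial>k i x)"

locale matrix_chain = markov P X \<xi> k for P :: "'w measure" and X :: "'x measure" and \<xi> and k +
  fixes g :: "nat \<Rightarrow> 'x \<Rightarrow> real^'m^'m"
  assumes g: "\<And>i. i \<ge> 1 \<Longrightarrow> g i \<in> measurable X SL_borel"
begin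

lemma g_borel [measurable]: "i \<ge> 1 \<Longrightarrow> g i \<in> borel_measurable X"
  by (rule measurable_SL_borel_imp_borel[OF g])

lemma g_SL: "i \<ge> 1 \<Longrightarrow> x \<in> space X \<Longrightarrow> g i x \<in> SL"
  using measurable_space[OF g, of i x] by (simp add: space_restrict_space)

abbreviation "V \<equiv> expected_density k g"
abbreviation "step \<omega> i \<equiv> g i (\<xi> i \<omega>)"

lemma V_measurable:
  "i \<ge> 1 \<Longrightarrow> (\<lambda>z. V d i (fst z) (snd z)) \<in> borel_measurable (X \<Otimes>\<^sub>M borel)"
proof (induction d arbitrary: i)
  case 0
  have "base_density \<in> borel_measurable (borel :: (real^'m) measure)"
    using half_density_base by (rule homogeneous_measurable)
  from measurable_compose[OF measurable_snd this] show ?case by simp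
next
  case (Suc d)
  have [measurable]: "g (i + 1) \<in> borel_measurable X" by simp
  have [measurable]: "(\<lambda>z. V d (i + 1) (fst z) (snd z)) \<in> borel_measurable (X \<Otimes>\<^sub>M borel)"
    using Suc.IH[of "i + 1"] by simp
  have "(\<lambda>w. (snd w, g (i + 1) (snd w) *v snd (fst w))) \<in> measurable ((X \<Otimes>\<^sub>M borel) \<Otimes>\<^sub>M X) (X \<Otimes>\<^sub>M borel)"
    by measurable
  from measurable_compose[OF this \<open>(\<lambda>z. V d (i + 1) (fst z) (snd z)) \<in> _\<close>]
  have "(\<lambda>w. V d (i + 1) (snd w) (g (i + 1) (snd w) *v snd (fst w))) \<in> borel_measurable ((X \<Otimes>\<^sub>M borel) \<Otimes>\<^sub>M X)"
    by simp
  moreover have "(\<lambda>z. k i (fst z)) \<in> measurable (X \<Otimes>\<^sub>M (borel :: (real^'m) measure)) (subprob_algebra X)"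
    by (rule measurable_compose[OF measurable_fst kernel_subprob[OF Suc.prems]])
  ultimately have "(\<lambda>z. \<integral>\<^sup>+y. V d (i + 1) y (g (i + 1) y *v snd z) \<partial>k i (fst z)) \<in> borel_measurable (X \<Otimes>\<^sub>M borel)"
    by (intro nn_integral_measurable_subprob_algebra2) (simp_all add: case_prod_beta)
  then show ?case by simp
qed

lemma gV_measurable:
  assumes i: "i \<ge> 1"
  shows "(\<lambda>z. V d i (fst z) (g i (fst z) *v snd z)) \<in> borel_measurable (X \<Otimes>\<^sub>M borel)"
proof -
  have [measurable]: "g i \<in> borel_measurable X" using i by simp
  have "(\<lambda>z. (fst z, g i (fst z) *v snd z)) \<in> measurable (X \<Otimes>\<^sub>M borel) (X \<Otimes>\<^sub>M borel)" by measurable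
  from measurable_compose[OF this V_measurable[OF i]] show ?thesis by simp
qed

lemma section_measurable:
  assumes "(\<lambda>z. \<Phi> (fst z) (snd z)) \<in> borel_measurable (X \<Otimes>\<^sub>M borel)"
  shows "(\<lambda>x. \<Phi> x v) \<in> borel_measurable X" "x \<in> space X \<Longrightarrow> \<Phi> x \<in> borel_measurable borel"
proof -
  show "(\<lambda>x. \<Phi> x v) \<in> borel_measurable X"
    using measurable_compose[OF measurable_Pair2'[of v borel X] assms] by simp
  show "\<Phi> x \<in> borel_measurable borel" if "x \<in> space X"
    using measurable_compose[OF measurable_Pair1'[OF that, of borel] assms] by simp
qed

lemma V_half_density: "i \<ge> 1 \<Longrightarrow> x \<in> space X \<Longrightarrow> half_density (V d i x)"
proof (induction d arbitrary: i x)
  case 0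
  have "half_density (base_density :: real^'m \<Rightarrow> ennreal)" by (rule half_density_base)
  then show ?case by simp
next
  case (Suc d)
  have ks: "sets (k i x) = sets X" "space (k i x) = space X"
    using measurable_space[OF kernel_measurable[OF Suc.prems(1)] Suc.prems(2)] sets_eq_imp_space_eq[of "k i x" X]
    by (auto simp: space_prob_algebra)
  have "V (Suc d) i x (t *\<^sub>R v) = ennreal (t powr (- real CARD('m) / 2)) * V (Suc d) i x v" if t: "t > 0" for t v
  proof -
    have "V (Suc d) i x (t *\<^sub>R v)
        = (\<integral>\<^sup>+y. ennreal (t powr (- real CARD('m) / 2)) * V d (i + 1) y (g (i + 1) y *v v) \<partial>k i x)"
      unfolding expected_density.simps
    proof (rule nn_integral_cong)
      fix y assume "y \<in> space (k i x)"
      then have "half_density (V d (i + 1) y)" using Suc.IH[of "i + 1" y] by (simp add: ks)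
      then show "V d (i + 1) y (g (i + 1) y *v t *\<^sub>R v)
          = ennreal (t powr (- real CARD('m) / 2)) * V d (i + 1) y (g (i + 1) y *v v)"
        using homogeneous_scale t by (simp add: matrix_vector_mult_scaleR)
    qed
    also have "\<dots> = ennreal (t powr (- real CARD('m) / 2)) * V (Suc d) i x v"
      unfolding expected_density.simps
      by (rule nn_integral_cmult)
        (use section_measurable(1)[OF gV_measurable[of "i + 1" d]] in \<open>simp add: ks cong: measurable_cong_sets\<close>)
    finally show ?thesis .
  qed
  then show ?case
    unfolding homogeneous_def using section_measurable(2)[OF V_measurable[OF Suc.prems(1)] Suc.prems(2)] by blast
qed

lemma mat_prod_measurable:
  assumes "1 \<le> s"
  shows "s + l \<le> Suc n \<Longrightarrow> (\<lambda>\<omega>. mat_prod (step \<omega>) s l) \<in> borel_measurable (past n)"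
proof (induction l)
  case (Suc l)
  have "(\<lambda>\<omega>. g (s + l) (\<xi> (s + l) \<omega>)) \<in> borel_measurable (past n)"
    by (rule measurable_compose[OF past_state g_borel]) (use assms Suc.prems in auto)
  moreover have "(\<lambda>\<omega>. mat_prod (step \<omega>) s l) \<in> borel_measurable (past n)" using Suc by simp
  moreover have "continuous_on UNIV (\<lambda>x. fst x ** snd x :: real^'m^'m)"
    unfolding matrix_matrix_mult_def
    by (intro continuous_on_vec_lambda continuous_on_sum continuous_on_mult continuous_on_component2 continuous_intros)
  ultimately have "(\<lambda>\<omega>. g (s + l) (\<xi> (s + l) \<omega>) ** mat_prod (step \<omega>) s l) \<in> borel_measurable (past n)"
    by (rule borel_measurable_continuous_Pair)
  then show ?case by simp
qed simp

lemma mat_prod_SL: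
  assumes "1 \<le> s" "\<omega> \<in> space P"
  shows "mat_prod (step \<omega>) s l \<in> SL"
  by (induction l) (use assms measurable_space[OF state_measurable] in \<open>auto intro!: SL_mult g_SL\<close>)

text \<open>
  The conditional expectations of the same product, given the past up to \<open>s + 1\<close> and up to
  \<open>s + 1 + a\<close>, have the same expectation. Each step of the induction is one application of the Markov
  property, with the product of the past factors as the past variable.
\<close>

lemma expectation_V_shift:
  "(\<integral>\<^sup>+\<omega>. V (d + a) (s + 1) (\<xi> (s + 1) \<omega>) (step \<omega> (s + 1) *v v) \<partial>P)
   = (\<integral>\<^sup>+\<omega>. V d (s + 1 + a) (\<xi> (s + 1 + a) \<omega>) (mat_prod (step \<omega>) (s + 1) (a + 1) *v v) \<partial>P)"
proof (induction a arbitrary: d)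
  case (Suc a)
  let ?i = "s + 1 + a"
  let ?Y = "\<lambda>\<omega>. mat_prod (step \<omega>) (s + 1) (a + 1) *v v"
  have "(\<integral>\<^sup>+\<omega>. V (d + Suc a) (s + 1) (\<xi> (s + 1) \<omega>) (step \<omega> (s + 1) *v v) \<partial>P)
     = (\<integral>\<^sup>+\<omega>. V (Suc d) ?i (\<xi> ?i \<omega>) (?Y \<omega>) \<partial>P)"
    using Suc.IH[of "Suc d"] by simp
  also have "\<dots> = (\<integral>\<^sup>+\<omega>. \<integral>\<^sup>+y. V d (?i + 1) y (g (?i + 1) y *v ?Y \<omega>) \<partial>k ?i (\<xi> ?i \<omega>) \<partial>P)"
    by simp
  also have "\<dots> = (\<integral>\<^sup>+\<omega>. V d (?i + 1) (\<xi> (?i + 1) \<omega>) (g (?i + 1) (\<xi> (?i + 1) \<omega>) *v ?Y \<omega>) \<partial>P)"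
  proof -
    have "?Y \<in> borel_measurable (past ?i)"
      using mat_prod_measurable[of "s + 1" "a + 1" ?i] by (intro measurable_matrix_vector_pair) auto
    from markov_property[OF _ this gV_measurable[of "?i + 1" d]] show ?thesis by simp
  qed
  also have "\<dots> = (\<integral>\<^sup>+\<omega>. V d (s + 1 + Suc a) (\<xi> (s + 1 + Suc a) \<omega>) (mat_prod (step \<omega>) (s + 1) (Suc a + 1) *v v) \<partial>P)"
    by (simp add: matrix_vector_mul_assoc)
  finally show ?case .
qed simp

end

section \<open>Contraction over one block\<close>

text \<open>
  The contraction factor of one block. The fraction is the weight \<open>\<theta>\<close> of the convex combination in
  \<open>block_arithmetic\<close>.
\<close>

definition rho :: "real \<Rightarrow> real \<Rightarrow> real" where
  "rho c \<epsilon> = 1 - (1 - c\<^sup>2) * ((1 - c\<^sup>2) / ((1 + 1 / \<epsilon>) + (1 - c\<^sup>2))) * \<epsilon>\<^sup>2"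

lemma rho_bounds:
  assumes "0 < c" "c < 1" "0 < \<epsilon>" "\<epsilon> < 1"
  shows "0 < rho c \<epsilon>" "rho c \<epsilon> < 1"
proof -
  define d where "d = 1 - c\<^sup>2"
  have "c\<^sup>2 < 1" "0 < c\<^sup>2" using assms by (simp_all add: power_less_one_iff)
  then have d: "0 < d" "d < 1" by (auto simp: d_def)
  define \<theta> where "\<theta> = d / ((1 + 1 / \<epsilon>) + d)"
  have \<theta>: "0 < \<theta>" "\<theta> < 1" unfolding \<theta>_def using d assms by (auto simp: field_simps add_pos_pos)
  have e: "0 < \<epsilon>\<^sup>2" "\<epsilon>\<^sup>2 < 1" using assms by (simp_all add: power_less_one_iff)
  have "d * \<theta> < 1" using mult_strict_mono[of d 1 \<theta> 1] d \<theta> by simp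
  then have "d * \<theta> * \<epsilon>\<^sup>2 < 1" using mult_strict_mono[of "d * \<theta>" 1 "\<epsilon>\<^sup>2" 1] d \<theta> e by simp
  moreover have "0 < d * \<theta> * \<epsilon>\<^sup>2" using d \<theta> e by simp
  ultimately show "0 < rho c \<epsilon>" "rho c \<epsilon> < 1" unfolding rho_def d_def[symmetric] \<theta>_def[symmetric] by auto
qed

text \<open>
  The trade-off between the two sources of contraction. Here \<open>x = G - \<beta>\<close> measures how much of the norm
  is not in the mean at the right end of the block. There are two bounds on \<open>\<alpha>\<close>: one decreases in
  \<open>x\<close> (norm lost at the right end), the other grows in \<open>x\<close> but starts below \<open>G\<close> (norm lost by
  averaging). The weight \<open>\<theta>\<close> is chosen so that \<open>x\<close> cancels in their convex combination.
\<close>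

lemma block_arithmetic:
  fixes c \<epsilon> G H \<beta> D \<alpha> R :: real
  assumes c: "0 < c" "c < 1" and \<epsilon>: "0 < \<epsilon>" "\<epsilon> < 1"
    and nn: "0 \<le> G" "0 \<le> D"
    and H: "H \<le> c\<^sup>2 * G + (1 - c\<^sup>2) * \<beta>" and D: "D + \<beta> \<le> H" and \<alpha>H: "\<alpha> \<le> H"
    and \<alpha>: "\<alpha> \<le> (1 + \<epsilon>) * ((1 - \<epsilon>) * \<beta>) + (1 + 1 / \<epsilon>) * D" and R: "R \<le> c\<^sup>2 * H + (1 - c\<^sup>2) * \<alpha>"
  shows "R \<le> rho c \<epsilon> * G"
proof -
  define d where "d = 1 - c\<^sup>2"
  define x where "x = G - \<beta>"
  define C where "C = 1 + 1 / \<epsilon>"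
  define \<theta> where "\<theta> = d / (C + d)"
  have c2: "0 < c\<^sup>2" "c\<^sup>2 < 1" using c by (simp_all add: power_less_one_iff)
  have d: "0 < d" "d < 1" using c2 by (auto simp: d_def)
  have C: "0 < C" using \<epsilon> by (simp add: C_def add_pos_pos)
  have \<theta>: "0 \<le> \<theta>" "\<theta> \<le> 1" "\<theta> * C = (1 - \<theta>) * d"
    using C d by (auto simp: \<theta>_def field_simps)
  have Hx: "H \<le> G - d * x" using H by (simp add: d_def x_def algebra_simps)
  have "0 \<le> c\<^sup>2 * x" using Hx D nn by (simp add: d_def x_def algebra_simps)
  then have x: "0 \<le> x" using c2 by (simp add: zero_le_mult_iff)
  have HG: "H \<le> G" using Hx mult_nonneg_nonneg[of d x] d x by linarith
  have Dx: "D \<le> x" using Hx D mult_nonneg_nonneg[of d x] d x unfolding x_def by linarith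
  have \<alpha>1: "\<alpha> \<le> (1 - \<epsilon>\<^sup>2) * G + C * x"
  proof -
    have "\<epsilon>\<^sup>2 \<le> 1" using \<epsilon> by (simp add: power_le_one)
    then have "(1 - \<epsilon>\<^sup>2) * \<beta> \<le> (1 - \<epsilon>\<^sup>2) * G" using x by (intro mult_left_mono) (auto simp: x_def)
    moreover have "C * D \<le> C * x" using Dx C by simp
    moreover have "(1 + \<epsilon>) * ((1 - \<epsilon>) * \<beta>) = (1 - \<epsilon>\<^sup>2) * \<beta>" by (simp add: algebra_simps power2_eq_square)
    ultimately show ?thesis using \<alpha> unfolding C_def by linarith
  qed
  have "\<alpha> = \<theta> * \<alpha> + (1 - \<theta>) * \<alpha>" by (simp add: algebra_simps)
  also have "\<dots> \<le> \<theta> * ((1 - \<epsilon>\<^sup>2) * G + C * x) + (1 - \<theta>) * (G - d * x)"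
    using \<alpha>1 \<alpha>H Hx \<theta> by (intro add_mono mult_left_mono) auto
  also have "\<dots> = (1 - \<theta> * \<epsilon>\<^sup>2) * G + (\<theta> * C - (1 - \<theta>) * d) * x" by (simp add: algebra_simps)
  also have "\<dots> = (1 - \<theta> * \<epsilon>\<^sup>2) * G" using \<theta>(3) by simp
  finally have "d * \<alpha> \<le> d * ((1 - \<theta> * \<epsilon>\<^sup>2) * G)" using d by simp
  moreover have "c\<^sup>2 * H \<le> c\<^sup>2 * G" using HG c2 by simp
  ultimately have "R \<le> c\<^sup>2 * G + d * ((1 - \<theta> * \<epsilon>\<^sup>2) * G)" using R unfolding d_def by linarith
  also have "\<dots> = rho c \<epsilon> * G"
    unfolding rho_def d_def[symmetric] C_def[symmetric] \<theta>_def[symmetric] by (simp add: d_def algebra_simps)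
  finally show ?thesis .
qed

lemma ennreal_le_add_diff: "x \<le> y + (x - y)" for x y :: ennreal
proof (cases "y \<le> x")
  case True
  then show ?thesis by (simp add: add_diff_inverse_ennreal)
next
  case False
  then show ?thesis by (intro add_increasing2) auto
qed

lemma ennreal_square_sum_le:
  assumes \<epsilon>: "\<epsilon> > 0"
  shows "(x + y)\<^sup>2 \<le> ennreal (1 + \<epsilon>) * x\<^sup>2 + ennreal (1 + 1 / \<epsilon>) * (y::ennreal)\<^sup>2"
proof (cases x; cases y)
  fix p q assume x: "x = ennreal p" "0 \<le> p" and y: "y = ennreal q" "0 \<le> q"
  have "0 \<le> (\<epsilon> * p - q)\<^sup>2 / \<epsilon>" using \<epsilon> by simp
  also have "\<dots> = \<epsilon> * p\<^sup>2 + q\<^sup>2 / \<epsilon> - 2 * p * q" using \<epsilon> by (simp add: power2_eq_square field_simps)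
  finally have "(p + q)\<^sup>2 \<le> (1 + \<epsilon>) * p\<^sup>2 + (1 + 1 / \<epsilon>) * q\<^sup>2"
    by (simp add: power2_sum algebra_simps)
  then have "ennreal ((p + q)\<^sup>2) \<le> ennreal ((1 + \<epsilon>) * p\<^sup>2 + (1 + 1 / \<epsilon>) * q\<^sup>2)" by (rule ennreal_leI)
  also have "ennreal ((p + q)\<^sup>2) = (x + y)\<^sup>2" using x y by (simp add: ennreal_power ennreal_plus[symmetric] del: ennreal_plus)
  also have "ennreal ((1 + \<epsilon>) * p\<^sup>2 + (1 + 1 / \<epsilon>) * q\<^sup>2) = ennreal (1 + \<epsilon>) * x\<^sup>2 + ennreal (1 + 1 / \<epsilon>) * y\<^sup>2"
    using x y \<epsilon> by (subst ennreal_plus) (simp_all add: ennreal_mult ennreal_power)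
  finally show ?thesis .
qed (use \<epsilon> in \<open>auto simp: ennreal_mult_eq_top_iff ennreal_mult_top power2_eq_square top_unique add_pos_pos\<close>)

context matrix_chain
begin

text \<open>
  The squared norm of a random half-density at time \<open>i\<close>.
\<close>

definition energy :: "nat \<Rightarrow> ('x \<Rightarrow> real^'m \<Rightarrow> ennreal) \<Rightarrow> ennreal" where
  "energy i \<Phi> = (\<integral>\<^sup>+x. \<integral>\<^sup>+v. (\<Phi> x v)\<^sup>2 \<partial>shell \<partial>law i)"

lemma swap_law_shell:
  assumes i: "i \<ge> 1" and m: "(\<lambda>z. \<Phi> (fst z) (snd z)) \<in> borel_measurable (X \<Otimes>\<^sub>M borel)"
  shows "(\<integral>\<^sup>+x. \<integral>\<^sup>+v. \<Phi> x v \<partial>shell \<partial>law i) = (\<integral>\<^sup>+v. \<integral>\<^sup>+x. \<Phi> x v \<partial>law i \<partial>shell)"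
proof -
  interpret L: prob_space "law i" by (rule prob_space_law[OF i])
  interpret sh: finite_measure shell by (rule finite_measure_shell)
  interpret pair_sigma_finite "law i" shell ..
  have "sets (law i \<Otimes>\<^sub>M shell) = sets (X \<Otimes>\<^sub>M borel)" by (intro sets_pair_measure_cong) auto
  then have "case_prod \<Phi> \<in> borel_measurable (law i \<Otimes>\<^sub>M shell)"
    using m by (simp add: case_prod_beta' cong: measurable_cong_sets)
  from Fubini'[OF this] show ?thesis by simp
qed

lemma average_over_law_measurable:
  assumes i: "i \<ge> 1" and m: "(\<lambda>z. \<Phi> (fst z) (snd z)) \<in> borel_measurable (X \<Otimes>\<^sub>M borel)"
  shows "(\<lambda>v. \<integral>\<^sup>+x. \<Phi> x v \<partial>law i) \<in> borel_measurable borel"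
proof -
  interpret L: prob_space "law i" by (rule prob_space_law[OF i])
  have "(\<lambda>z. (snd z, fst z)) \<in> measurable (borel \<Otimes>\<^sub>M law i) (X \<Otimes>\<^sub>M borel)"
    by (rule measurable_Pair) (auto intro: measurable_fst measurable_compose[OF measurable_snd])
  from measurable_compose[OF this m]
  have "(\<lambda>z. \<Phi> (snd z) (fst z)) \<in> borel_measurable (borel \<Otimes>\<^sub>M law i)" by simp
  then show ?thesis by (intro L.borel_measurable_nn_integral) (simp add: case_prod_beta')
qed

lemma square_measurable:
  "(\<lambda>z. \<Phi> (fst z) (snd z)) \<in> borel_measurable (X \<Otimes>\<^sub>M borel) \<Longrightarrow>
   (\<lambda>z. (\<Phi> (fst z) (snd z))\<^sup>2) \<in> borel_measurable (X \<Otimes>\<^sub>M (borel :: (real^'m) measure))"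
  for \<Phi> :: "'x \<Rightarrow> real^'m \<Rightarrow> ennreal"
  by measurable

lemma energy_step:
  assumes i: "i \<ge> 1"
  shows "(\<integral>\<^sup>+v. \<integral>\<^sup>+x. (V d i x (g i x *v v))\<^sup>2 \<partial>law i \<partial>shell) = energy i (V d i)"
proof -
  have "(\<integral>\<^sup>+v. \<integral>\<^sup>+x. (V d i x (g i x *v v))\<^sup>2 \<partial>law i \<partial>shell) = (\<integral>\<^sup>+x. \<integral>\<^sup>+v. (V d i x (g i x *v v))\<^sup>2 \<partial>shell \<partial>law i)"
    by (rule swap_law_shell[OF i square_measurable[OF gV_measurable[OF i]], symmetric])
  also have "\<dots> = energy i (V d i)"
    unfolding energy_def
    by (intro nn_integral_cong half_density_isometry V_half_density g_SL) (use i in auto)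
  finally show ?thesis .
qed

lemma energy_swap:
  "i \<ge> 1 \<Longrightarrow> energy i (V d i) = (\<integral>\<^sup>+v. \<integral>\<^sup>+x. (V d i x v)\<^sup>2 \<partial>law i \<partial>shell)"
  unfolding energy_def by (rule swap_law_shell[OF _ square_measurable[OF V_measurable]])

lemma energy_Suc_le:
  assumes i: "i \<ge> 1"
  shows "energy i (V (Suc d) i) \<le> energy (i + 1) (V d (i + 1))"
proof -
  interpret kernel_transition X "law i" "law (i + 1)" "k i" by (rule kernel_transition_law[OF i])
  have "energy i (V (Suc d) i) \<le> (\<integral>\<^sup>+v. \<integral>\<^sup>+x. (V d (i + 1) x (g (i + 1) x *v v))\<^sup>2 \<partial>law (i + 1) \<partial>shell)"
    unfolding energy_swap[OF i] unfolding expected_density.simps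
    by (intro nn_integral_mono kernel_contraction_weak section_measurable(1)[OF gV_measurable]) simp
  then show ?thesis by (simp add: energy_step)
qed

lemma energy_mono: "i \<ge> 1 \<Longrightarrow> energy i (V (d + a) i) \<le> energy (i + a) (V d (i + a))"
proof (induction a arbitrary: d)
  case (Suc a)
  have "energy i (V (Suc d + a) i) \<le> energy (i + a) (V (Suc d) (i + a))" by (rule Suc.IH[OF Suc.prems])
  also have "\<dots> \<le> energy (i + a + 1) (V d (i + a + 1))" by (rule energy_Suc_le) (use Suc.prems in simp)
  finally show ?case by simp
qed simp

text \<open>
  The block has the times \<open>s + 1, \<dots>, e\<close> with \<open>e = s + l\<close>. At its right end, \<open>h\<close> is the conditional
  expectation given the state at time \<open>e\<close>, \<open>b\<close> is its mean and \<open>\<delta>\<close> is the positive part of its deviation;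
  \<open>a\<close> is the mean at the left end. The five numbered estimates are the hypotheses of
  \<open>block_arithmetic\<close>. In the last one, \<open>h \<le> b + \<delta>\<close> splits \<open>a\<close> into the average of the deterministic
  half-density \<open>b\<close> over the distribution of the block product, which \<open>T\<close> shortens, and the average of
  \<open>\<delta>\<close>, which the isometry property bounds by the deviation itself.
\<close>

theorem block_contraction:
  assumes s: "s \<ge> 1" and l: "l \<ge> 1" and c: "0 < c" "c < 1" and \<epsilon>: "0 < \<epsilon>" "\<epsilon> < 1"
    and K1: "centered_op_norm (law s) (law (s + 1)) (k s) \<le> c"
    and K2: "centered_op_norm (law (s + l)) (law (s + l + 1)) (k (s + l)) \<le> c"
    and T: "\<And>b :: real^'m \<Rightarrow> ennreal. half_density b \<Longrightarrow>
      sq_norm (average (prod_distr P \<xi> g (s + 1) l) b) \<le> ennreal (1 - \<epsilon>) * sq_norm b"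
  shows "energy s (V (Suc d + l) s) \<le> ennreal (rho c \<epsilon>) * energy (s + l + 1) (V d (s + l + 1))"
proof -
  define e where "e = s + l"
  have e: "e \<ge> 1" using s by (simp add: e_def)
  obtain l' where l': "l = Suc l'" using l by (cases l) auto
  interpret S: kernel_transition X "law s" "law (s + 1)" "k s" by (rule kernel_transition_law[OF s])
  interpret E: kernel_transition X "law e" "law (e + 1)" "k e" by (rule kernel_transition_law[OF e])
  interpret sh: finite_measure shell by (rule finite_measure_shell)
  let ?G = "energy (e + 1) (V d (e + 1))"
  define h where "h = V (Suc d) e"
  define b where "b v = (\<integral>\<^sup>+x. h x v \<partial>law e)" for v
  define \<delta> where "\<delta> x v = h x v - b v" for x v
  define A where "A \<omega> = mat_prod (step \<omega>) (s + 1) l" for \<omega>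
  let ?H = "energy e h"
  let ?\<beta> = "sq_norm b"
  let ?D = "\<integral>\<^sup>+v. \<integral>\<^sup>+x. (\<delta> x v)\<^sup>2 \<partial>law e \<partial>shell"
  define a where "a v = (\<integral>\<^sup>+x. V (d + l) (s + 1) x (g (s + 1) x *v v) \<partial>law (s + 1))" for v
  let ?\<alpha> = "sq_norm a"
  let ?R = "energy s (V (Suc d + l) s)"

  have hm: "(\<lambda>z. h (fst z) (snd z)) \<in> borel_measurable (X \<Otimes>\<^sub>M borel)"
    unfolding h_def by (rule V_measurable[OF e])
  have bm[measurable]: "b \<in> borel_measurable borel"
    unfolding b_def by (rule average_over_law_measurable[OF e hm])
  have \<delta>m: "(\<lambda>z. \<delta> (fst z) (snd z)) \<in> borel_measurable (X \<Otimes>\<^sub>M borel)"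
    unfolding \<delta>_def using hm by measurable
  have am[measurable]: "a \<in> borel_measurable borel"
    unfolding a_def by (rule average_over_law_measurable[OF _ gV_measurable]) auto
  have hh: "half_density (h x)" if "x \<in> space X" for x
    unfolding h_def by (rule V_half_density[OF e that])
  have bh: "half_density b"
    unfolding homogeneous_def
  proof (intro conjI allI impI bm)
    fix t :: real and v assume t: "t > 0"
    have "b (t *\<^sub>R v) = (\<integral>\<^sup>+x. ennreal (t powr (- real CARD('m) / 2)) * h x v \<partial>law e)"
      unfolding b_def by (rule nn_integral_cong) (simp add: homogeneous_scale[OF hh t])
    also have "\<dots> = ennreal (t powr (- real CARD('m) / 2)) * b v"
      unfolding b_def by (rule nn_integral_cmult) (use section_measurable(1)[OF hm] in simp)
    finally show "b (t *\<^sub>R v) = ennreal (t powr (- real CARD('m) / 2)) * b v" .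
  qed
  have \<delta>h: "half_density (\<delta> x)" if x: "x \<in> space X" for x
    unfolding homogeneous_def
  proof (intro conjI allI impI)
    show "\<delta> x \<in> borel_measurable borel" by (rule section_measurable(2)[OF \<delta>m x])
    fix t :: real and v assume t: "t > 0"
    then show "\<delta> x (t *\<^sub>R v) = ennreal (t powr (- real CARD('m) / 2)) * \<delta> x v"
      unfolding \<delta>_def homogeneous_scale[OF hh[OF x] t] homogeneous_scale[OF bh t]
      by (subst ennreal_right_diff_distrib) auto
  qed

  have bG: "b v = (\<integral>\<^sup>+y. V d (e + 1) y (g (e + 1) y *v v) \<partial>law (e + 1))" for v
    unfolding b_def h_def expected_density.simps
    by (rule E.image[OF section_measurable(1)[OF gV_measurable]]) simp
  have 1: "?H \<le> ennreal (c\<^sup>2) * ?G + ennreal (1 - c\<^sup>2) * ?\<beta>"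
  proof -
    have "?H = (\<integral>\<^sup>+v. \<integral>\<^sup>+x. (h x v)\<^sup>2 \<partial>law e \<partial>shell)"
      unfolding h_def by (rule energy_swap[OF e])
    also have "\<dots> \<le> (\<integral>\<^sup>+v. ennreal (c\<^sup>2) * (\<integral>\<^sup>+y. (V d (e + 1) y (g (e + 1) y *v v))\<^sup>2 \<partial>law (e + 1))
         + ennreal (1 - c\<^sup>2) * (b v)\<^sup>2 \<partial>shell)"
      unfolding h_def expected_density.simps bG
      by (intro nn_integral_mono E.kernel_contraction section_measurable(1)[OF gV_measurable])
        (use K2 c in \<open>auto simp: e_def\<close>)
    also have "\<dots> = ennreal (c\<^sup>2) * (\<integral>\<^sup>+v. \<integral>\<^sup>+y. (V d (e + 1) y (g (e + 1) y *v v))\<^sup>2 \<partial>law (e + 1) \<partial>shell)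
         + ennreal (1 - c\<^sup>2) * ?\<beta>"
      using average_over_law_measurable[OF _ square_measurable[OF gV_measurable], of "e + 1" "e + 1" d]
      by (simp add: nn_integral_add nn_integral_cmult cong: measurable_cong_sets)
    finally show ?thesis by (simp add: energy_step)
  qed
  have 2: "?D + ?\<beta> \<le> ?H"
  proof -
    have "?D + ?\<beta> = (\<integral>\<^sup>+v. (\<integral>\<^sup>+x. (\<delta> x v)\<^sup>2 \<partial>law e) + (b v)\<^sup>2 \<partial>shell)"
      using average_over_law_measurable[OF e square_measurable[OF \<delta>m]]
      by (intro nn_integral_add[symmetric]) (simp_all cong: measurable_cong_sets)
    also have "\<dots> \<le> (\<integral>\<^sup>+v. \<integral>\<^sup>+x. (h x v)\<^sup>2 \<partial>law e \<partial>shell)"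
      unfolding \<delta>_def b_def
      by (intro nn_integral_mono E.\<mu>.nn_integral_variance) (use section_measurable(1)[OF hm] in simp)
    also have "\<dots> = ?H" unfolding h_def by (rule energy_swap[OF e, symmetric])
    finally show ?thesis .
  qed
  have NF: "energy (s + 1) (V (d + l) (s + 1)) \<le> ?H"
    using energy_mono[of "s + 1" "Suc d" l'] by (simp add: h_def l' e_def)
  have 3: "?R \<le> ennreal (c\<^sup>2) * ?H + ennreal (1 - c\<^sup>2) * ?\<alpha>"
  proof -
    have "?R = (\<integral>\<^sup>+v. \<integral>\<^sup>+x. (V (Suc d + l) s x v)\<^sup>2 \<partial>law s \<partial>shell)"
      by (rule energy_swap[OF s])
    also have "\<dots> \<le> (\<integral>\<^sup>+v. ennreal (c\<^sup>2) * (\<integral>\<^sup>+y. (V (d + l) (s + 1) y (g (s + 1) y *v v))\<^sup>2 \<partial>law (s + 1))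
         + ennreal (1 - c\<^sup>2) * (a v)\<^sup>2 \<partial>shell)"
      unfolding add_Suc expected_density.simps a_def
      by (intro nn_integral_mono S.kernel_contraction section_measurable(1)[OF gV_measurable])
        (use K1 c in auto)
    also have "\<dots> = ennreal (c\<^sup>2) * (\<integral>\<^sup>+v. \<integral>\<^sup>+y. (V (d + l) (s + 1) y (g (s + 1) y *v v))\<^sup>2 \<partial>law (s + 1) \<partial>shell)
         + ennreal (1 - c\<^sup>2) * ?\<alpha>"
      using average_over_law_measurable[OF _ square_measurable[OF gV_measurable], of "s + 1" "s + 1" "d + l"]
      by (simp add: nn_integral_add nn_integral_cmult cong: measurable_cong_sets)
    also have "\<dots> \<le> ennreal (c\<^sup>2) * ?H + ennreal (1 - c\<^sup>2) * ?\<alpha>"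
      using NF by (intro add_mono mult_left_mono) (simp_all add: energy_step)
    finally show ?thesis .
  qed
  have 4: "?\<alpha> \<le> ?H"
  proof -
    have "?\<alpha> \<le> (\<integral>\<^sup>+v. \<integral>\<^sup>+x. (V (d + l) (s + 1) x (g (s + 1) x *v v))\<^sup>2 \<partial>law (s + 1) \<partial>shell)"
      unfolding a_def
      by (intro nn_integral_mono S.\<mu>'.nn_integral_square_Jensen)
        (use section_measurable(1)[OF gV_measurable[of "s + 1" "d + l"]] in simp)
    also have "\<dots> \<le> ?H" using NF by (simp add: energy_step)
    finally show ?thesis .
  qed
  have Ameas[measurable]: "A \<in> borel_measurable P"
    unfolding A_def using measurable_from_subalg[OF past_subalgebra mat_prod_measurable[of "s + 1" l "s + l"]] by simp
  have ASL: "A \<omega> \<in> SL" if "\<omega> \<in> space P" for \<omega>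
    unfolding A_def using mat_prod_SL[OF _ that] by simp
  have xe[measurable]: "\<xi> e \<in> measurable P X" using e by simp
  have aE: "a v = (\<integral>\<^sup>+\<omega>. h (\<xi> e \<omega>) (A \<omega> *v v) \<partial>P)" for v
  proof -
    have "a v = (\<integral>\<^sup>+\<omega>. V (d + l) (s + 1) (\<xi> (s + 1) \<omega>) (step \<omega> (s + 1) *v v) \<partial>P)"
      unfolding a_def by (rule nn_integral_law[OF _ section_measurable(1)[OF gV_measurable]]) auto
    also have "\<dots> = (\<integral>\<^sup>+\<omega>. h (\<xi> e \<omega>) (A \<omega> *v v) \<partial>P)"
      using expectation_V_shift[of "Suc d" l' s v] by (simp add: h_def A_def l' e_def)
    finally show ?thesis .
  qed
  have joint: "(\<lambda>z. \<Phi> (\<xi> e (fst z)) (A (fst z) *v snd z)) \<in> borel_measurable (P \<Otimes>\<^sub>M borel)"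
    if "(\<lambda>z. \<Phi> (fst z) (snd z)) \<in> borel_measurable (X \<Otimes>\<^sub>M borel)" for \<Phi> :: "'x \<Rightarrow> real^'m \<Rightarrow> ennreal"
  proof -
    have "(\<lambda>z. (\<xi> e (fst z), A (fst z) *v snd z)) \<in> measurable (P \<Otimes>\<^sub>M borel) (X \<Otimes>\<^sub>M borel)" by measurable
    from measurable_compose[OF this that] show ?thesis by simp
  qed
  have sectP: "(\<lambda>\<omega>. \<Phi> (\<xi> e \<omega>) (A \<omega> *v v)) \<in> borel_measurable P"
    if "(\<lambda>z. \<Phi> (fst z) (snd z)) \<in> borel_measurable (X \<Otimes>\<^sub>M borel)" for \<Phi> :: "'x \<Rightarrow> real^'m \<Rightarrow> ennreal" and v
    using measurable_compose[OF measurable_Pair2'[of v borel P] joint[OF that]] by simp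
  have 5: "?\<alpha> \<le> ennreal (1 + \<epsilon>) * (ennreal (1 - \<epsilon>) * ?\<beta>) + ennreal (1 + 1 / \<epsilon>) * ?D"
  proof -
    have bA: "(\<integral>\<^sup>+\<omega>. b (A \<omega> *v v) \<partial>P) = (\<integral>\<^sup>+B. b (B *v v) \<partial>prod_distr P \<xi> g (s + 1) l)" for v
    proof -
      have "A \<in> measurable P SL_borel"
        by (rule measurable_restrict_space2) (use ASL in auto)
      moreover have "(\<lambda>B. b (B *v v)) \<in> borel_measurable SL_borel"
      proof (rule measurable_restrict_space1)
        have "(\<lambda>B. B *v v) \<in> borel_measurable (borel :: (real^'m^'m) measure)"
          by (rule measurable_matrix_vector_pair) auto
        then show "(\<lambda>B. b (B *v v)) \<in> borel_measurable borel" by measurable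
      qed
      ultimately show ?thesis
        unfolding prod_distr_def A_def by (subst nn_integral_distr) auto
    qed
    have \<delta>int: "(\<integral>\<^sup>+v. (\<integral>\<^sup>+\<omega>. \<delta> (\<xi> e \<omega>) (A \<omega> *v v) \<partial>P)\<^sup>2 \<partial>shell) \<le> ?D"
    proof -
      interpret pair_sigma_finite P shell ..
      have "(\<integral>\<^sup>+v. (\<integral>\<^sup>+\<omega>. \<delta> (\<xi> e \<omega>) (A \<omega> *v v) \<partial>P)\<^sup>2 \<partial>shell)
          \<le> (\<integral>\<^sup>+v. \<integral>\<^sup>+\<omega>. (\<delta> (\<xi> e \<omega>) (A \<omega> *v v))\<^sup>2 \<partial>P \<partial>shell)"
        by (intro nn_integral_mono nn_integral_square_Jensen sectP[OF \<delta>m])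
      also have "\<dots> = (\<integral>\<^sup>+\<omega>. \<integral>\<^sup>+v. (\<delta> (\<xi> e \<omega>) (A \<omega> *v v))\<^sup>2 \<partial>shell \<partial>P)"
      proof (rule Fubini')
        have "sets (P \<Otimes>\<^sub>M shell) = sets (P \<Otimes>\<^sub>M (borel :: (real^'m) measure))" by (intro sets_pair_measure_cong) auto
        then show "(\<lambda>(\<omega>, v). (\<delta> (\<xi> e \<omega>) (A \<omega> *v v))\<^sup>2) \<in> borel_measurable (P \<Otimes>\<^sub>M shell)"
          using joint[OF \<delta>m] by (simp add: case_prod_beta' cong: measurable_cong_sets)
      qed
      also have "\<dots> = (\<integral>\<^sup>+\<omega>. \<integral>\<^sup>+v. (\<delta> (\<xi> e \<omega>) v)\<^sup>2 \<partial>shell \<partial>P)"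
        by (intro nn_integral_cong half_density_isometry \<delta>h ASL measurable_space[OF xe])
      also have "\<dots> = (\<integral>\<^sup>+x. \<integral>\<^sup>+v. (\<delta> x v)\<^sup>2 \<partial>shell \<partial>law e)"
      proof (rule nn_integral_law[OF e, symmetric])
        have "sets (X \<Otimes>\<^sub>M shell) = sets (X \<Otimes>\<^sub>M (borel :: (real^'m) measure))" by (intro sets_pair_measure_cong) auto
        then show "(\<lambda>x. \<integral>\<^sup>+v. (\<delta> x v)\<^sup>2 \<partial>shell) \<in> borel_measurable X"
          using square_measurable[OF \<delta>m]
          by (intro sh.borel_measurable_nn_integral) (simp add: case_prod_beta' cong: measurable_cong_sets)
      qed
      also have "\<dots> = ?D" by (rule swap_law_shell[OF e square_measurable[OF \<delta>m]])
      finally show ?thesis .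
    qed
    have mA: "(\<lambda>v. \<integral>\<^sup>+\<omega>. \<Phi> (\<xi> e \<omega>) (A \<omega> *v v) \<partial>P) \<in> borel_measurable shell"
      if "(\<lambda>z. \<Phi> (fst z) (snd z)) \<in> borel_measurable (X \<Otimes>\<^sub>M borel)" for \<Phi> :: "'x \<Rightarrow> real^'m \<Rightarrow> ennreal"
    proof -
      have "(\<lambda>z. \<Phi> (\<xi> e (snd z)) (A (snd z) *v fst z)) \<in> borel_measurable (borel \<Otimes>\<^sub>M P)"
        using measurable_compose[OF measurable_pair_swap' joint[OF that]] by (simp add: case_prod_beta')
      then have "(\<lambda>v. \<integral>\<^sup>+\<omega>. \<Phi> (\<xi> e \<omega>) (A \<omega> *v v) \<partial>P) \<in> borel_measurable borel"
        by (intro borel_measurable_nn_integral) (simp add: case_prod_beta')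
      then show ?thesis by (simp cong: measurable_cong_sets)
    qed
    have bm2: "(\<lambda>z. b (snd z)) \<in> borel_measurable (X \<Otimes>\<^sub>M borel)" by measurable
    have "?\<alpha> \<le> (\<integral>\<^sup>+v. ennreal (1 + \<epsilon>) * (\<integral>\<^sup>+\<omega>. b (A \<omega> *v v) \<partial>P)\<^sup>2
        + ennreal (1 + 1 / \<epsilon>) * (\<integral>\<^sup>+\<omega>. \<delta> (\<xi> e \<omega>) (A \<omega> *v v) \<partial>P)\<^sup>2 \<partial>shell)"
    proof (rule nn_integral_mono)
      fix v
      have "a v \<le> (\<integral>\<^sup>+\<omega>. b (A \<omega> *v v) + \<delta> (\<xi> e \<omega>) (A \<omega> *v v) \<partial>P)"
        unfolding aE \<delta>_def by (intro nn_integral_mono ennreal_le_add_diff)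
      also have "\<dots> = (\<integral>\<^sup>+\<omega>. b (A \<omega> *v v) \<partial>P) + (\<integral>\<^sup>+\<omega>. \<delta> (\<xi> e \<omega>) (A \<omega> *v v) \<partial>P)"
        by (rule nn_integral_add) (use sectP[OF bm2] sectP[OF \<delta>m] in simp_all)
      finally have "(a v)\<^sup>2 \<le> ((\<integral>\<^sup>+\<omega>. b (A \<omega> *v v) \<partial>P) + (\<integral>\<^sup>+\<omega>. \<delta> (\<xi> e \<omega>) (A \<omega> *v v) \<partial>P))\<^sup>2"
        by (rule power_mono) simp
      also note ennreal_square_sum_le[OF \<epsilon>(1)]
      finally show "(a v)\<^sup>2 \<le> ennreal (1 + \<epsilon>) * (\<integral>\<^sup>+\<omega>. b (A \<omega> *v v) \<partial>P)\<^sup>2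
        + ennreal (1 + 1 / \<epsilon>) * (\<integral>\<^sup>+\<omega>. \<delta> (\<xi> e \<omega>) (A \<omega> *v v) \<partial>P)\<^sup>2" .
    qed
    also have "\<dots> = ennreal (1 + \<epsilon>) * (\<integral>\<^sup>+v. (\<integral>\<^sup>+\<omega>. b (A \<omega> *v v) \<partial>P)\<^sup>2 \<partial>shell)
        + ennreal (1 + 1 / \<epsilon>) * (\<integral>\<^sup>+v. (\<integral>\<^sup>+\<omega>. \<delta> (\<xi> e \<omega>) (A \<omega> *v v) \<partial>P)\<^sup>2 \<partial>shell)"
      using mA[OF bm2] mA[OF \<delta>m] by (simp add: nn_integral_add nn_integral_cmult)
    also have "\<dots> \<le> ennreal (1 + \<epsilon>) * (ennreal (1 - \<epsilon>) * ?\<beta>) + ennreal (1 + 1 / \<epsilon>) * ?D"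
      using T[OF bh] \<delta>int unfolding bA by (intro add_mono mult_left_mono) auto
    finally show ?thesis .
  qed

  show ?thesis
  proof (cases "?G = \<infinity>")
    case True
    then show ?thesis using rho_bounds[OF c \<epsilon>] by (simp add: e_def ennreal_mult_top)
  next
    case False
    have HG: "?H \<le> ?G" unfolding h_def by (rule energy_Suc_le[OF e])
    have fin: "x = ennreal (enn2real x)" if "x \<le> ?G" for x
    proof -
      have "x < top_class.top" using that False le_less_trans[of x ?G top_class.top] by (simp add: less_top)
      then show ?thesis by simp
    qed
    have \<beta>H: "?\<beta> \<le> ?H" by (rule order_trans[OF _ 2]) (rule add_increasing, simp_all)
    have DH: "?D \<le> ?H" by (rule order_trans[OF _ 2]) (rule add_increasing2, simp_all)
    have RG: "?R \<le> ?G"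
      using energy_mono[OF s, of d "Suc l"] by (simp add: e_def)
    define G' H' \<beta>' D' \<alpha>' R' where defs: "G' = enn2real ?G" "H' = enn2real ?H" "\<beta>' = enn2real ?\<beta>"
      "D' = enn2real ?D" "\<alpha>' = enn2real ?\<alpha>" "R' = enn2real ?R"
    have eqs: "?G = ennreal G'" "?H = ennreal H'" "?\<beta> = ennreal \<beta>'" "?D = ennreal D'" "?\<alpha> = ennreal \<alpha>'" "?R = ennreal R'"
      unfolding defs
      by (rule fin[OF order_refl], rule fin[OF HG], rule fin[OF order_trans[OF \<beta>H HG]],
        rule fin[OF order_trans[OF DH HG]], rule fin[OF order_trans[OF 4 HG]], rule fin[OF RG])
    have nn: "0 \<le> G'" "0 \<le> H'" "0 \<le> \<beta>'" "0 \<le> D'" "0 \<le> \<alpha>'" "0 \<le> R'" by (simp_all add: defs)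
    have c2: "c\<^sup>2 \<le> 1" using c by (simp add: power_le_one)
    have "R' \<le> rho c \<epsilon> * G'"
    proof (rule block_arithmetic[OF c \<epsilon> nn(1,4)])
      show "H' \<le> c\<^sup>2 * G' + (1 - c\<^sup>2) * \<beta>'"
        using 1 unfolding eqs using nn c2 by (simp add: ennreal_mult[symmetric] ennreal_plus[symmetric] del: ennreal_plus)
      show "D' + \<beta>' \<le> H'"
        using 2 unfolding eqs using nn by (simp add: ennreal_plus[symmetric] del: ennreal_plus)
      show "\<alpha>' \<le> H'" using 4 unfolding eqs using nn by simp
      show "\<alpha>' \<le> (1 + \<epsilon>) * ((1 - \<epsilon>) * \<beta>') + (1 + 1 / \<epsilon>) * D'"
        using 5 unfolding eqs using nn \<epsilon> by (simp add: ennreal_mult[symmetric] ennreal_plus[symmetric] del: ennreal_plus)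
      show "R' \<le> c\<^sup>2 * H' + (1 - c\<^sup>2) * \<alpha>'"
        using 3 unfolding eqs using nn c2 by (simp add: ennreal_mult[symmetric] ennreal_plus[symmetric] del: ennreal_plus)
    qed
    then have "ennreal R' \<le> ennreal (rho c \<epsilon>) * ennreal G'"
      using rho_bounds[OF c \<epsilon>] nn by (simp add: ennreal_mult[symmetric] ennreal_leI)
    then show ?thesis using eqs(1,6) by (simp add: e_def)
  qed
qed

end

section \<open>Exponential growth\<close>

lemma base_density_le_one: "v \<in> annulus \<Longrightarrow> base_density v \<le> 1" for v :: "real^'m"
proof -
  assume "v \<in> annulus"
  then have "norm v powr (- real CARD('m) / 2) \<le> 1 powr (- real CARD('m) / 2)"
    by (intro powr_mono2') (auto simp: annulus_def)
  then show "base_density v \<le> 1" by (simp add: base_density_def ennreal_le_1)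
qed

lemma shell_base_density_le:
  "(\<integral>\<^sup>+v. base_density (v :: real^'m) \<partial>shell) \<le> emeasure shell (UNIV :: (real^'m) set)"
  "(\<integral>\<^sup>+v. (base_density (v :: real^'m))\<^sup>2 \<partial>shell) \<le> emeasure shell (UNIV :: (real^'m) set)"
proof -
  have "(\<integral>\<^sup>+v. base_density (v :: real^'m) \<partial>shell) \<le> (\<integral>\<^sup>+v. 1 \<partial>(shell :: (real^'m) measure))"
    by (rule nn_integral_mono_AE, use AE_shell_annulus in eventually_elim) (rule base_density_le_one)
  then show "(\<integral>\<^sup>+v. base_density (v :: real^'m) \<partial>shell) \<le> emeasure shell (UNIV :: (real^'m) set)" by simp
  have "(\<integral>\<^sup>+v. (base_density (v :: real^'m))\<^sup>2 \<partial>shell) \<le> (\<integral>\<^sup>+v. 1 \<partial>(shell :: (real^'m) measure))"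
    by (rule nn_integral_mono_AE, use AE_shell_annulus in eventually_elim) (intro power_le_one base_density_le_one zero_le)
  then show "(\<integral>\<^sup>+v. (base_density (v :: real^'m))\<^sup>2 \<partial>shell) \<le> emeasure shell (UNIV :: (real^'m) set)" by simp
qed

lemma emeasure_shell_finite: "emeasure shell (UNIV :: (real^'m) set) < \<infinity>"
  using finite_measure.emeasure_finite[OF finite_measure_shell, of UNIV] by (simp add: less_top)

lemma shell_base_density_pos: "0 < (\<integral>\<^sup>+v. base_density v \<partial>(shell :: (real^'m) measure))"
proof (rule ccontr)
  assume "\<not> ?thesis"
  then have z: "(\<integral>\<^sup>+v. base_density v \<partial>(shell :: (real^'m) measure)) = 0" by simp
  have [measurable]: "base_density \<in> borel_measurable (borel :: (real^'m) measure)"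
    by (rule homogeneous_measurable[OF half_density_base])
  have "AE v in (shell :: (real^'m) measure). base_density v = 0"
    using z by (subst (asm) nn_integral_0_iff_AE) auto
  with AE_shell_annulus have "AE v in (shell :: (real^'m) measure). False"
    by eventually_elim (auto simp: base_density_def annulus_def)
  then have "emeasure (shell :: (real^'m) measure) UNIV = 0" by (simp add: AE_iff_measurable[of UNIV])
  then have an: "emeasure lborel (annulus :: (real^'m) set) = 0" by (simp add: shell_def emeasure_density)
  let ?x = "(3/2) *\<^sub>R axis undefined 1 :: real^'m"
  have "ball ?x (1/4) \<subseteq> annulus"
  proof
    fix v assume "v \<in> ball ?x (1/4)"
    then have "norm (?x - v) < 1/4" by (simp add: dist_norm)
    moreover have "norm ?x = 3/2" by simp
    ultimately show "v \<in> annulus"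
      using norm_triangle_ineq2[of ?x v] norm_triangle_ineq2[of v ?x] by (simp add: annulus_def norm_minus_commute)
  qed
  then have "emeasure lborel (ball ?x (1/4)) \<le> emeasure lborel (annulus :: (real^'m) set)"
    by (intro emeasure_mono) auto
  with an have "measure lborel (ball ?x (1/4)) = 0" by (simp add: measure_def)
  then show False using content_ball_pos[of "1/4" ?x] by simp
qed

lemma op_norm_pos:
  assumes "(A :: real^'m^'m) \<in> SL"
  shows "0 < op_norm A" "norm (A *v v) \<le> op_norm A * norm v"
proof -
  have bl: "bounded_linear (\<lambda>v. A *v v)" by (rule matrix_vector_mul_bounded_linear)
  show le: "norm (A *v v) \<le> op_norm A * norm v" for v
    unfolding op_norm_def by (rule onorm[OF bl])
  have "A *v axis undefined 1 \<noteq> 0" by (rule SL_vec_sphere_nonzero[OF assms]) simp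
  then show "0 < op_norm A" using le[of "axis undefined 1"] by (simp add: less_le_trans[of 0 "norm (A *v axis undefined 1)"])
qed

text \<open>
  A negative power turns the upper bound \<open>op_norm A * norm v\<close> on \<open>norm (A *v v)\<close> into a lower bound.
\<close>

lemma op_norm_lower_bound:
  assumes A: "(A :: real^'m^'m) \<in> SL"
  shows "ennreal (op_norm A powr (- real CARD('m) / 2)) * (\<integral>\<^sup>+v. base_density (v :: real^'m) \<partial>shell)
    \<le> (\<integral>\<^sup>+v. base_density (A *v v) \<partial>shell)"
proof -
  have [measurable]: "base_density \<in> borel_measurable (borel :: (real^'m) measure)"
    by (rule homogeneous_measurable[OF half_density_base])
  have "ennreal (op_norm A powr (- real CARD('m) / 2)) * (\<integral>\<^sup>+v. base_density (v :: real^'m) \<partial>shell)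
      = (\<integral>\<^sup>+v. ennreal (op_norm A powr (- real CARD('m) / 2)) * base_density (v :: real^'m) \<partial>shell)"
    by (rule nn_integral_cmult[symmetric]) simp
  also have "\<dots> \<le> (\<integral>\<^sup>+v. base_density (A *v v) \<partial>shell)"
  proof (rule nn_integral_mono_AE, use AE_shell_nonzero in eventually_elim)
    fix v :: "real^'m" assume v: "v \<noteq> 0"
    have "(op_norm A * norm v) powr (- real CARD('m) / 2) \<le> norm (A *v v) powr (- real CARD('m) / 2)"
      using op_norm_pos[OF A] SL_vec_nonzero[OF A v] by (intro powr_mono2') auto
    then show "ennreal (op_norm A powr (- real CARD('m) / 2)) * base_density v \<le> base_density (A *v v)"
      using op_norm_pos(1)[OF A] by (simp add: base_density_def ennreal_mult[symmetric] powr_mult ennreal_leI)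
  qed
  finally show ?thesis .
qed

lemma ennreal_le_of_square_le:
  assumes "q\<^sup>2 \<le> ennreal (x\<^sup>2)" "0 \<le> x"
  shows "q \<le> ennreal x"
proof (rule ccontr)
  assume "\<not> q \<le> ennreal x"
  then have "x < enn2real q \<or> q = top_class.top" by (cases q) (auto simp: not_le ennreal_less_iff assms(2))
  then show False
  proof
    assume "q = top_class.top"
    then show False using assms(1) by (simp add: power2_eq_square top_unique)
  next
    assume *: "x < enn2real q"
    then have q: "q = ennreal (enn2real q)" using assms(2) by (cases q) auto
    have "ennreal (x\<^sup>2) < ennreal ((enn2real q)\<^sup>2)"
      using * assms(2) by (intro ennreal_lessI power_strict_mono) auto
    also have "\<dots> = q\<^sup>2" by (subst (2) q) (rule ennreal_power[symmetric], simp)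
    finally show False using assms(1) by (simp add: not_less)
  qed
qed

lemma mat_prod_cong:
  "(\<And>i. s \<le> i \<Longrightarrow> i < s + l \<Longrightarrow> h i = h' i) \<Longrightarrow> mat_prod h s l = mat_prod h' s l"
  by (induction l) auto

context matrix_chain
begin

text \<open>
  Exchange the expectation with the integral over the shell, and apply the Cauchy-Schwarz inequality
  there and Jensen's inequality over the initial distribution.
\<close>

lemma expected_size_square_le:
  assumes N: "N \<ge> 1"
  shows "(\<integral>\<^sup>+\<omega>. \<integral>\<^sup>+v. base_density (mat_prod (step \<omega>) 1 N *v v) \<partial>shell \<partial>P)\<^sup>2
    \<le> emeasure shell (UNIV :: (real^'m) set) * energy 1 (V (N - 1) 1)"
proof -
  interpret sh: finite_measure shell by (rule finite_measure_shell)
  interpret pair_sigma_finite P shell ..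
  interpret L: prob_space "law 1" by (rule prob_space_law) simp
  have [measurable]: "base_density \<in> borel_measurable (borel :: (real^'m) measure)"
    by (rule homogeneous_measurable[OF half_density_base])
  have Am[measurable]: "(\<lambda>\<omega>. mat_prod (step \<omega>) 1 N) \<in> borel_measurable P"
    using measurable_from_subalg[OF past_subalgebra mat_prod_measurable[of 1 N N]] by simp
  define a where "a v = (\<integral>\<^sup>+x. V (N - 1) 1 x (g 1 x *v v) \<partial>law 1)" for v
  have am: "a \<in> borel_measurable shell"
    unfolding a_def using average_over_law_measurable[OF _ gV_measurable[of 1 "N - 1"], of 1]
    by (simp cong: measurable_cong_sets)
  have a: "a v = (\<integral>\<^sup>+\<omega>. base_density (mat_prod (step \<omega>) 1 N *v v) \<partial>P)" for v
  proof -
    have "a v = (\<integral>\<^sup>+\<omega>. V (N - 1) 1 (\<xi> 1 \<omega>) (step \<omega> 1 *v v) \<partial>P)"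
      unfolding a_def by (rule nn_integral_law[OF _ section_measurable(1)[OF gV_measurable]]) auto
    also have "\<dots> = (\<integral>\<^sup>+\<omega>. base_density (mat_prod (step \<omega>) 1 N *v v) \<partial>P)"
      using expectation_V_shift[of 0 "N - 1" 0 v] N by simp
    finally show ?thesis .
  qed
  have "(\<integral>\<^sup>+\<omega>. \<integral>\<^sup>+v. base_density (mat_prod (step \<omega>) 1 N *v v) \<partial>shell \<partial>P) = (\<integral>\<^sup>+v. a v \<partial>shell)"
    unfolding a
  proof (rule Fubini'[symmetric])
    have "sets (P \<Otimes>\<^sub>M shell) = sets (P \<Otimes>\<^sub>M (borel :: (real^'m) measure))" by (intro sets_pair_measure_cong) auto
    moreover have "(\<lambda>z. base_density (mat_prod (step (fst z)) 1 N *v snd z)) \<in> borel_measurable (P \<Otimes>\<^sub>M borel)"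
      by measurable
    ultimately show "(\<lambda>(\<omega>, v). base_density (mat_prod (step \<omega>) 1 N *v v)) \<in> borel_measurable (P \<Otimes>\<^sub>M shell)"
      by (simp add: case_prod_beta' cong: measurable_cong_sets)
  qed
  also have "(\<integral>\<^sup>+v. a v \<partial>shell)\<^sup>2 \<le> sq_norm a * emeasure shell (UNIV :: (real^'m) set)"
    using Cauchy_Schwarz_nn_integral[OF am, of "\<lambda>_. 1"] by simp
  also have "\<dots> \<le> energy 1 (V (N - 1) 1) * emeasure shell (UNIV :: (real^'m) set)"
  proof (rule mult_right_mono)
    have "sq_norm a \<le> (\<integral>\<^sup>+v. \<integral>\<^sup>+x. (V (N - 1) 1 x (g 1 x *v v))\<^sup>2 \<partial>law 1 \<partial>shell)"
      unfolding a_def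
      by (intro nn_integral_mono L.nn_integral_square_Jensen)
        (use section_measurable(1)[OF gV_measurable[of 1 "N - 1"]] in simp)
    then show "sq_norm a \<le> energy 1 (V (N - 1) 1)" by (simp add: energy_step)
  qed simp
  finally show ?thesis by (simp add: mult.commute)
qed

lemma energy_final_le: "i \<ge> 1 \<Longrightarrow> energy i (V 0 i) \<le> emeasure shell (UNIV :: (real^'m) set)"
proof -
  assume i: "i \<ge> 1"
  interpret L: prob_space "law i" by (rule prob_space_law[OF i])
  have "energy i (V 0 i) = (\<integral>\<^sup>+v. (base_density v)\<^sup>2 \<partial>(shell :: (real^'m) measure)) * emeasure (law i) (space (law i))"
    unfolding energy_def by simp
  then show ?thesis using shell_base_density_le(2)[where 'm='m] by (simp only: L.emeasure_space_1 mult_1_right)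
qed

text \<open>
  Going back from block \<open>J\<close> in steps of two blocks, each step gains the factor \<open>rho c \<epsilon>\<close>. The estimate
  for a block uses the transitions at both of its ends, and the right end of one block may be the left
  end of the next one; with steps of two no transition is used twice.
\<close>

lemma energy_decay:
  fixes n l :: "nat \<Rightarrow> nat"
  assumes l: "\<And>j. j \<ge> 1 \<Longrightarrow> l j \<ge> 1"
    and n_Suc: "\<And>j. j \<ge> 1 \<Longrightarrow> n (j + 1) \<ge> n j + l j"
    and n_pos: "\<And>j. j \<ge> 1 \<Longrightarrow> n j \<ge> 1"
    and c: "0 < c" "c < 1" and \<epsilon>: "0 < \<epsilon>" "\<epsilon> < 1"
    and K1: "\<And>j. j \<ge> 1 \<Longrightarrow> centered_op_norm (law (n j)) (law (n j + 1)) (k (n j)) \<le> c"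
    and K2: "\<And>j. j \<ge> 1 \<Longrightarrow> centered_op_norm (law (n j + l j)) (law (n j + l j + 1)) (k (n j + l j)) \<le> c"
    and T: "\<And>j b. j \<ge> 1 \<Longrightarrow> half_density (b :: real^'m \<Rightarrow> ennreal) \<Longrightarrow>
      sq_norm (average (prod_distr P \<xi> g (n j + 1) (l j)) b) \<le> ennreal (1 - \<epsilon>) * sq_norm b"
  shows "2 * i < J \<Longrightarrow> n (J - 2 * i) \<le> n J + l J \<and>
    energy (n (J - 2 * i)) (V (n J + l J - n (J - 2 * i)) (n (J - 2 * i)))
     \<le> ennreal (rho c \<epsilon> ^ i) * emeasure shell (UNIV :: (real^'m) set)"
proof (induction i)
  case 0
  then have J: "J \<ge> 1" by simp
  have "energy (n J) (V (0 + l J) (n J)) \<le> energy (n J + l J) (V 0 (n J + l J))"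
    by (rule energy_mono[OF n_pos[OF J]])
  also have "\<dots> \<le> emeasure shell (UNIV :: (real^'m) set)" by (rule energy_final_le) (use n_pos[OF J] in simp)
  finally show ?case by simp
next
  case (Suc i)
  define j where "j = J - 2 * Suc i"
  define N where "N = n J + l J"
  have j: "j \<ge> 1" "J - 2 * i = j + 2" using Suc.prems by (auto simp: j_def)
  have IH: "n (j + 2) \<le> N" "energy (n (j + 2)) (V (N - n (j + 2)) (n (j + 2)))
     \<le> ennreal (rho c \<epsilon> ^ i) * emeasure shell (UNIV :: (real^'m) set)"
    using Suc.IH Suc.prems j by (auto simp: N_def)
  let ?e = "n j + l j"
  have e2: "?e + 1 \<le> n (j + 2)"
    using n_Suc[OF j(1)] n_Suc[of "j + 1"] l[of "j + 1"] j(1) by simp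
  define d where "d = N - (?e + 1)"
  have d: "N - n j = Suc d + l j" using e2 IH(1) by (simp add: d_def)
  have "energy (n j) (V (N - n j) (n j)) \<le> ennreal (rho c \<epsilon>) * energy (?e + 1) (V d (?e + 1))"
    unfolding d by (rule block_contraction[OF n_pos[OF j(1)] l[OF j(1)] c \<epsilon> K1[OF j(1)] K2[OF j(1)] T[OF j(1)]])
  also have "\<dots> \<le> ennreal (rho c \<epsilon>) * energy (n (j + 2)) (V (N - n (j + 2)) (n (j + 2)))"
  proof (rule mult_left_mono)
    have "energy (?e + 1) (V ((N - n (j + 2)) + (n (j + 2) - (?e + 1))) (?e + 1))
       \<le> energy (?e + 1 + (n (j + 2) - (?e + 1))) (V (N - n (j + 2)) (?e + 1 + (n (j + 2) - (?e + 1))))"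
      by (rule energy_mono) simp
    moreover have "(N - n (j + 2)) + (n (j + 2) - (?e + 1)) = d" "?e + 1 + (n (j + 2) - (?e + 1)) = n (j + 2)"
      using e2 IH(1) by (simp_all add: d_def)
    ultimately show "energy (?e + 1) (V d (?e + 1)) \<le> energy (n (j + 2)) (V (N - n (j + 2)) (n (j + 2)))"
      by simp
  qed simp
  also have "\<dots> \<le> ennreal (rho c \<epsilon>) * (ennreal (rho c \<epsilon> ^ i) * emeasure shell (UNIV :: (real^'m) set))"
    by (rule mult_left_mono[OF IH(2)]) simp
  also have "\<dots> = ennreal (rho c \<epsilon> ^ Suc i) * emeasure shell (UNIV :: (real^'m) set)"
    using rho_bounds[OF c \<epsilon>] by (simp add: ennreal_mult mult.assoc)
  finally show ?case
    using e2 IH(1) unfolding j_def[symmetric] N_def[symmetric] by simp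
qed

text \<open>
  The integral \<open>Z J\<close> has expectation of order \<open>rho c \<epsilon> powr (J / 4)\<close>: half of the blocks contribute,
  and the energy bounds the square of the expectation. Multiplied by \<open>t ^ J\<close> with
  \<open>t = rho c \<epsilon> powr (- 1 / 8)\<close>, half of this exponential rate, it is still summable, so almost surely
  \<open>t ^ J * Z J\<close> tends to 0, and \<open>op_norm\<close> to the power \<open>- m / 2\<close> is eventually below \<open>t ^ (- J)\<close>.
\<close>

theorem exponential_growth:
  fixes n l :: "nat \<Rightarrow> nat"
  assumes n1: "n 1 \<ge> 1" and l: "\<And>j. j \<ge> 1 \<Longrightarrow> l j \<ge> 1"
    and n_Suc: "\<And>j. j \<ge> 1 \<Longrightarrow> n (j + 1) \<ge> n j + l j"
    and c: "0 < c" "c < 1" and \<epsilon>: "0 < \<epsilon>" "\<epsilon> < 1"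
    and K1: "\<And>j. j \<ge> 1 \<Longrightarrow> centered_op_norm (law (n j)) (law (n j + 1)) (k (n j)) \<le> c"
    and K2: "\<And>j. j \<ge> 1 \<Longrightarrow> centered_op_norm (law (n j + l j)) (law (n j + l j + 1)) (k (n j + l j)) \<le> c"
    and T: "\<And>j b. j \<ge> 1 \<Longrightarrow> half_density (b :: real^'m \<Rightarrow> ennreal) \<Longrightarrow>
      sq_norm (average (prod_distr P \<xi> g (n j + 1) (l j)) b) \<le> ennreal (1 - \<epsilon>) * sq_norm b"
  shows "AE \<omega> in P. liminf (\<lambda>j. ereal (1 / real j * ln (op_norm (mat_prod (step \<omega>) 1 (n j + l j)))))
    \<ge> ereal (- ln (rho c \<epsilon>) / (4 * real CARD('m)))"
proof -
  define \<rho> where "\<rho> = rho c \<epsilon>"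
  have \<rho>: "0 < \<rho>" "\<rho> < 1" unfolding \<rho>_def using rho_bounds[OF c \<epsilon>] by auto
  define q t where "q = \<rho> powr (1/4)" and "t = \<rho> powr (- 1/8)"
  have q: "0 < q" and t: "0 < t" using \<rho> by (auto simp: q_def t_def)
  have tq: "t * q < 1"
  proof -
    have "t * q = \<rho> powr (1/8)" unfolding t_def q_def powr_add[symmetric] by simp
    also have "\<dots> < \<rho> powr 0" using \<rho> by (intro powr_less_mono') auto
    finally show ?thesis using \<rho> by simp
  qed
  have n_pos: "n j \<ge> 1" if "j \<ge> 1" for j
    using that
  proof (induction j rule: dec_induct)
    case (step j)
    then show ?case using n_Suc[of j] by simp
  qed (use n1 in simp)
  define vr where "vr = measure shell (UNIV :: (real^'m) set)"
  have vr: "emeasure shell (UNIV :: (real^'m) set) = ennreal vr" "0 \<le> vr"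
    using finite_measure.emeasure_eq_measure[OF finite_measure_shell] by (auto simp: vr_def)
  define A where "A J \<omega> = mat_prod (step \<omega>) 1 (n J + l J)" for J \<omega>
  define Z where "Z J \<omega> = (\<integral>\<^sup>+v. base_density (A J \<omega> *v v) \<partial>shell)" for J \<omega>
  have Zm: "Z J \<in> borel_measurable P" if "J \<ge> 1" for J
  proof -
    interpret sh: finite_measure shell by (rule finite_measure_shell)
    have [measurable]: "base_density \<in> borel_measurable (borel :: (real^'m) measure)"
      by (rule homogeneous_measurable[OF half_density_base])
    have [measurable]: "A J \<in> borel_measurable P"
      unfolding A_def using measurable_from_subalg[OF past_subalgebra mat_prod_measurable[of 1 "n J + l J" "n J + l J"]] by simp
    have "sets (P \<Otimes>\<^sub>M shell) = sets (P \<Otimes>\<^sub>M (borel :: (real^'m) measure))" by (intro sets_pair_measure_cong) auto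
    moreover have "(\<lambda>z. base_density (A J (fst z) *v snd z)) \<in> borel_measurable (P \<Otimes>\<^sub>M borel)" by measurable
    ultimately show ?thesis
      unfolding Z_def by (intro sh.borel_measurable_nn_integral) (simp add: case_prod_beta' cong: measurable_cong_sets)
  qed
  have EZ: "(\<integral>\<^sup>+\<omega>. Z (i + 2) \<omega> \<partial>P) \<le> ennreal (vr * q ^ i)" for i
  proof (rule ennreal_le_of_square_le)
    let ?J = "i + 2" and ?i = "(i + 1) div 2"
    let ?N = "n ?J + l ?J"
    let ?s = "n (?J - 2 * ?i)"
    have "2 * ?i < ?J" by presburger
    from energy_decay[where n=n and l=l, OF l n_Suc n_pos c \<epsilon> K1 K2 T this]
    have s: "?s \<le> ?N" "energy ?s (V (?N - ?s) ?s) \<le> ennreal (\<rho> ^ ?i) * ennreal vr"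
      by (auto simp: vr \<rho>_def)
    have s1: "?s \<ge> 1" by (rule n_pos) presburger
    have N1: "?N \<ge> 1" using n_pos[of ?J] by simp
    have "(\<integral>\<^sup>+\<omega>. Z ?J \<omega> \<partial>P)\<^sup>2 \<le> ennreal vr * energy 1 (V (?N - 1) 1)"
      unfolding Z_def A_def using expected_size_square_le[OF N1] by (simp add: vr)
    also have "\<dots> \<le> ennreal vr * (ennreal (\<rho> ^ ?i) * ennreal vr)"
    proof (rule mult_left_mono)
      have "energy 1 (V ((?N - ?s) + (?s - 1)) 1) \<le> energy (1 + (?s - 1)) (V (?N - ?s) (1 + (?s - 1)))"
        by (rule energy_mono) simp
      moreover have "(?N - ?s) + (?s - 1) = ?N - 1" "1 + (?s - 1) = ?s" using s(1) s1 by auto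
      ultimately have "energy 1 (V (?N - 1) 1) \<le> energy ?s (V (?N - ?s) ?s)" by simp
      with s(2) show "energy 1 (V (?N - 1) 1) \<le> ennreal (\<rho> ^ ?i) * ennreal vr" by (rule order_trans[rotated])
    qed simp
    also have "\<dots> = ennreal (vr\<^sup>2 * \<rho> ^ ?i)"
      using \<rho> vr(2) by (simp add: ennreal_mult[symmetric] power2_eq_square mult_ac)
    also have "\<dots> \<le> ennreal ((vr * q ^ i)\<^sup>2)"
    proof (rule ennreal_leI)
      have "\<rho> ^ ?i = \<rho> powr real ?i" using \<rho> by (simp add: powr_realpow)
      also have "\<dots> \<le> \<rho> powr (real i / 2)"
        using \<rho> by (intro powr_mono') auto
      also have "\<dots> = (q ^ i)\<^sup>2"
      proof -
        have "(q ^ i)\<^sup>2 = q powr real (i * 2)"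
          unfolding powr_realpow[OF q] by (rule power_mult[symmetric])
        then show ?thesis by (simp add: q_def powr_powr)
      qed
      finally show "vr\<^sup>2 * \<rho> ^ ?i \<le> (vr * q ^ i)\<^sup>2" by (simp add: power_mult_distrib mult_left_mono)
    qed
    finally show "(\<integral>\<^sup>+\<omega>. Z (i + 2) \<omega> \<partial>P)\<^sup>2 \<le> ennreal ((vr * q ^ i)\<^sup>2)" .
    show "0 \<le> vr * q ^ i" using vr q by simp
  qed
  \<comment> \<open>The sum starts at \<open>J = 2\<close>, where the number of pairs of blocks \<open>(J - 1) div 2\<close> is at least \<open>J / 2 - 1\<close>.\<close>
  have "(\<integral>\<^sup>+\<omega>. (\<Sum>i. ennreal (t ^ (i + 2)) * Z (i + 2) \<omega>) \<partial>P) \<noteq> \<infinity>"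
  proof -
    have "(\<integral>\<^sup>+\<omega>. (\<Sum>i. ennreal (t ^ (i + 2)) * Z (i + 2) \<omega>) \<partial>P) = (\<Sum>i. \<integral>\<^sup>+\<omega>. ennreal (t ^ (i + 2)) * Z (i + 2) \<omega> \<partial>P)"
      by (rule nn_integral_suminf) (use Zm in auto)
    also have "\<dots> \<le> (\<Sum>i. ennreal (t\<^sup>2 * vr * (t * q) ^ i))"
    proof (rule suminf_le)
      fix i
      have "(\<integral>\<^sup>+\<omega>. ennreal (t ^ (i + 2)) * Z (i + 2) \<omega> \<partial>P) = ennreal (t ^ (i + 2)) * (\<integral>\<^sup>+\<omega>. Z (i + 2) \<omega> \<partial>P)"
        by (rule nn_integral_cmult) (use Zm in auto)
      also have "\<dots> \<le> ennreal (t ^ (i + 2)) * ennreal (vr * q ^ i)" by (rule mult_left_mono[OF EZ]) simp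
      also have "\<dots> = ennreal (t\<^sup>2 * vr * (t * q) ^ i)"
        using t q vr by (subst ennreal_mult[symmetric]) (auto simp: power_add power_mult_distrib power2_eq_square mult_ac)
      finally show "(\<integral>\<^sup>+\<omega>. ennreal (t ^ (i + 2)) * Z (i + 2) \<omega> \<partial>P) \<le> ennreal (t\<^sup>2 * vr * (t * q) ^ i)" .
    qed auto
    also have "\<dots> < \<infinity>"
    proof -
      have "summable (\<lambda>i. t\<^sup>2 * vr * (t * q) ^ i)"
        using t q tq by (intro summable_mult summable_geometric) (simp add: abs_mult)
      then have "(\<Sum>i. ennreal (t\<^sup>2 * vr * (t * q) ^ i)) \<noteq> top_class.top"
        by (rule ennreal_suminf_neq_top) (use t q vr in simp)
      then show ?thesis by (simp add: less_top)
    qed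
    finally show ?thesis by simp
  qed
  then have "AE \<omega> in P. (\<Sum>i. ennreal (t ^ (i + 2)) * Z (i + 2) \<omega>) \<noteq> \<infinity>"
    by (intro nn_integral_PInf_AE borel_measurable_suminf_order borel_measurable_times_ennreal Zm) auto
  with AE_space show ?thesis
  proof eventually_elim
    fix \<omega> assume \<omega>: "\<omega> \<in> space P" and fin: "(\<Sum>i. ennreal (t ^ (i + 2)) * Z (i + 2) \<omega>) \<noteq> \<infinity>"
    define w where "w = enn2real (\<integral>\<^sup>+v. base_density v \<partial>(shell :: (real^'m) measure))"
    have wfin: "(\<integral>\<^sup>+v. base_density v \<partial>(shell :: (real^'m) measure)) < \<infinity>"
      using shell_base_density_le(1)[where 'm='m] emeasure_shell_finite[where 'm='m] by (rule le_less_trans)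
    then have w: "(\<integral>\<^sup>+v. base_density v \<partial>(shell :: (real^'m) measure)) = ennreal w" by (simp add: w_def)
    have wpos: "0 < w" using shell_base_density_pos[where 'm='m] unfolding w by simp
    define f where "f i = enn2real (ennreal (t ^ (i + 2)) * Z (i + 2) \<omega>)" for i
    have f: "ennreal (t ^ (i + 2)) * Z (i + 2) \<omega> = ennreal (f i)" for i
    proof -
      have "ennreal (t ^ (i + 2)) * Z (i + 2) \<omega> \<noteq> top_class.top"
        using ennreal_suminf_lessD[of "\<lambda>i. ennreal (t ^ (i + 2)) * Z (i + 2) \<omega>" top_class.top i] fin
        by (simp add: less_top)
      then show ?thesis by (simp add: f_def less_top)
    qed
    have "(\<Sum>i. ennreal (f i)) \<noteq> top_class.top" using fin unfolding f by simp
    then have "summable f"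
      by (rule summable_suminf_not_top[rotated]) (simp add: f_def)
    then have "f \<longlonglongrightarrow> 0" by (rule summable_LIMSEQ_zero)
    then have ev: "\<forall>\<^sub>F i in sequentially. f i < w" using wpos by (rule order_tendstoD)
    have main: "- ln \<rho> / (4 * real CARD('m)) \<le> 1 / real (i + 2) * ln (op_norm (A (i + 2) \<omega>))" if fi: "f i < w" for i
    proof -
      let ?B = "A (i + 2) \<omega>" and ?p = "real CARD('m)"
      have B: "?B \<in> SL" unfolding A_def by (rule mat_prod_SL[OF _ \<omega>]) simp
      note op = op_norm_pos(1)[OF B]
      have "ennreal (t ^ (i + 2) * (op_norm ?B powr (- ?p / 2) * w)) = ennreal (t ^ (i + 2)) * (ennreal (op_norm ?B powr (- ?p / 2)) * ennreal w)"
        using t wpos by (simp add: ennreal_mult)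
      also have "\<dots> \<le> ennreal (t ^ (i + 2)) * Z (i + 2) \<omega>"
        using op_norm_lower_bound[OF B] unfolding Z_def w by (rule mult_left_mono) simp
      also have "\<dots> < ennreal w" unfolding f using fi by (simp add: f_def ennreal_lessI wpos)
      finally have "t ^ (i + 2) * (op_norm ?B powr (- ?p / 2) * w) < w"
        using t wpos by (subst (asm) ennreal_less_iff) auto
      then have "t ^ (i + 2) * op_norm ?B powr (- ?p / 2) < 1" using wpos by (simp add: field_simps)
      then have "ln (t ^ (i + 2) * op_norm ?B powr (- ?p / 2)) < ln 1"
        using t op by (subst ln_less_cancel_iff) auto
      then have "real (i + 2) * ln t + (- ?p / 2) * ln (op_norm ?B) < 0"
        using t op by (simp add: ln_mult ln_realpow ln_powr algebra_simps)
      moreover have "ln t = - ln \<rho> / 8" using \<rho> by (simp add: t_def ln_powr)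
      ultimately have "real (i + 2) * (- ln \<rho> / 8) < ?p / 2 * ln (op_norm ?B)" by simp
      then show ?thesis by (simp add: field_simps)
    qed
    have "\<forall>\<^sub>F i in sequentially. - ln \<rho> / (4 * real CARD('m)) \<le> 1 / real (i + 2) * ln (op_norm (A (i + 2) \<omega>))"
      using ev by eventually_elim (rule main)
    then have "\<forall>\<^sub>F j in sequentially. - ln \<rho> / (4 * real CARD('m)) \<le> 1 / real j * ln (op_norm (A j \<omega>))"
      by (subst (asm) eventually_sequentially_seg[of "\<lambda>j. - ln \<rho> / (4 * real CARD('m)) \<le> 1 / real j * ln (op_norm (A j \<omega>))" 2])
    then show "ereal (- ln (rho c \<epsilon>) / (4 * real CARD('m)))
      \<le> liminf (\<lambda>j. ereal (1 / real j * ln (op_norm (mat_prod (step \<omega>) 1 (n j + l j)))))"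
      unfolding A_def \<rho>_def by (intro Liminf_bounded) simp
  qed
qed

end

theorem theorem2p3:
  fixes P :: "'w measure" and X :: "'x measure"
    and \<xi> :: "nat \<Rightarrow> 'w \<Rightarrow> 'x" and k :: "nat \<Rightarrow> 'x \<Rightarrow> 'x measure"
    and \<mu> :: "nat \<Rightarrow> 'x measure"
    and g :: "nat \<Rightarrow> 'x \<Rightarrow> real^'m^'m"
    and n l :: "nat \<Rightarrow> nat" and c :: real
    and M :: "(real^'m^'m) measure set"
  assumes chain: "markov_chain P X \<xi> k"
    and mu: "\<And>i. i \<ge> 1 \<Longrightarrow> \<mu> i = distr P X (\<xi> i)"
    and g: "\<And>i. i \<ge> 1 \<Longrightarrow> g i \<in> measurable X SL_borel"
    and n1: "n 1 \<ge> 1"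
    and l: "\<And>j. j \<ge> 1 \<Longrightarrow> l j \<ge> 1"
    and n_Suc: "\<And>j. j \<ge> 1 \<Longrightarrow> n (j + 1) \<ge> n j + l j"
    and c: "c < 1"
    and K_left: "\<And>j. j \<ge> 1 \<Longrightarrow>
      centered_op_norm (\<mu> (n j)) (\<mu> (n j + 1)) (k (n j)) \<le> c"
    and K_right: "\<And>j. j \<ge> 1 \<Longrightarrow>
      centered_op_norm (\<mu> (n j + l j)) (\<mu> (n j + l j + 1)) (k (n j + l j)) \<le> c"
    and M_compact: "compactin (weak_topology SL) M"
    and nu_in_M: "\<And>j. j \<ge> 1 \<Longrightarrow> prod_distr P \<xi> g (n j + 1) (l j) \<in> M"
    and no_invariant: "\<And>\<nu>. \<nu> \<in> M \<Longrightarrow>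
      \<not> (\<exists>\<kappa>\<in>space (prob_algebra sphere_borel). preserves (closed_group_of \<nu>) \<kappa>)"
  shows "\<exists>r>0. \<forall>g'.
    (\<forall>i\<ge>1. g' i \<in> measurable X SL_borel) \<longrightarrow>
    (\<forall>i\<ge>1. i \<notin> (\<Union>j\<in>{1..}. {n j + l j + 1..n (j + 1)}) \<longrightarrow> g' i = g i) \<longrightarrow>
    (AE \<omega> in P. liminf (\<lambda>j. ereal (1 / real j *
        ln (op_norm (mat_prod (\<lambda>i. g' i (\<xi> i \<omega>)) 1 (n j + l j))))) \<ge> ereal r)"
proof -
  obtain \<epsilon> where \<epsilon>: "0 < \<epsilon>" "\<epsilon> < 1"
    and avg: "\<And>\<nu> b. \<nu> \<in> M \<Longrightarrow> half_density (b :: real^'m \<Rightarrow> ennreal) \<Longrightarrow>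
        sq_norm (average \<nu> b) \<le> ennreal (1 - \<epsilon>) * sq_norm b"
    using uniform_average_contraction[OF M_compact no_invariant] by blast
  \<comment> \<open>The bounds on the kernels are used with a positive constant.\<close>
  define c' where "c' = max c (1/2)"
  have c': "0 < c'" "c' < 1" "c \<le> c'" using c by (auto simp: c'_def)
  have n_pos: "n j \<ge> 1" if "j \<ge> 1" for j
    using that
  proof (induction j rule: dec_induct)
    case (step j)
    then show ?case using n_Suc[of j] by simp
  qed (use n1 in simp)
  have n_mono: "n j \<le> n j'" if "1 \<le> j" "j \<le> j'" for j j'
    using that(2,1)
  proof (induction j' rule: dec_induct)
    case (step i)
    then show ?case using n_Suc[of i] by simp
  qed simp
  \<comment> \<open>Within a block the matrices are those of \<open>g\<close>, so the averages over blocks are the same for \<open>g'\<close>.\<close>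
  have outside_gaps: "i \<notin> (\<Union>j\<in>{1..}. {n j + l j + 1..n (j + 1)})"
    if j: "j \<ge> 1" and i: "n j + 1 \<le> i" "i \<le> n j + l j" for i j
  proof
    assume "i \<in> (\<Union>j\<in>{1..}. {n j + l j + 1..n (j + 1)})"
    then obtain j' where j': "j' \<ge> 1" "n j' + l j' + 1 \<le> i" "i \<le> n (j' + 1)" by auto
    show False
    proof (cases "j' < j")
      case True
      then show False using n_mono[of "j' + 1" j] j' i by simp
    next
      case False
      show False
      proof (cases "j' = j")
        case True
        then show False using j' i by simp
      next
        case False
        with \<open>\<not> j' < j\<close> have "n (j + 1) \<le> n j'" using n_mono[of "j + 1" j'] j by simp
        then show False using n_Suc[OF j] j' i by simp
      qed
    qed
  qed
  show ?thesis
  proof (intro exI[of _ "- ln (rho c' \<epsilon>) / (4 * real CARD('m))"] conjI allI impI)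
    show "0 < - ln (rho c' \<epsilon>) / (4 * real CARD('m))"
      using rho_bounds[OF c'(1,2) \<epsilon>] by (simp add: ln_less_zero divide_neg_pos)
    fix g' :: "nat \<Rightarrow> 'x \<Rightarrow> real^'m^'m"
    assume g': "\<forall>i\<ge>1. g' i \<in> measurable X SL_borel"
      and eq: "\<forall>i\<ge>1. i \<notin> (\<Union>j\<in>{1..}. {n j + l j + 1..n (j + 1)}) \<longrightarrow> g' i = g i"
    interpret matrix_chain P X \<xi> k g'
      by unfold_locales (use chain g' in auto)
    have distr_eq: "prod_distr P \<xi> g' (n j + 1) (l j) = prod_distr P \<xi> g (n j + 1) (l j)" if j: "j \<ge> 1" for j
    proof -
      have "mat_prod (\<lambda>i. g' i (\<xi> i \<omega>)) (n j + 1) (l j) = mat_prod (\<lambda>i. g i (\<xi> i \<omega>)) (n j + 1) (l j)" for \<omega>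
        by (rule mat_prod_cong) (use eq outside_gaps[OF j] in auto)
      then show ?thesis by (simp add: prod_distr_def)
    qed
    show "AE \<omega> in P. ereal (- ln (rho c' \<epsilon>) / (4 * real CARD('m)))
      \<le> liminf (\<lambda>j. ereal (1 / real j * ln (op_norm (mat_prod (\<lambda>i. g' i (\<xi> i \<omega>)) 1 (n j + l j)))))"
    proof (rule exponential_growth[OF n1 l n_Suc c'(1,2) \<epsilon>])
      fix j :: nat assume j: "j \<ge> 1"
      have "n j \<ge> 1" by (rule n_pos[OF j])
      then show "centered_op_norm (law (n j)) (law (n j + 1)) (k (n j)) \<le> c'"
        "centered_op_norm (law (n j + l j)) (law (n j + l j + 1)) (k (n j + l j)) \<le> c'"
        using K_left[OF j] K_right[OF j] c'(3) by (auto simp: mu)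
      fix b :: "real^'m \<Rightarrow> ennreal" assume "half_density b"
      then show "sq_norm (average (prod_distr P \<xi> g' (n j + 1) (l j)) b) \<le> ennreal (1 - \<epsilon>) * sq_norm b"
        unfolding distr_eq[OF j] by (rule avg[OF nu_in_M[OF j]])
    qed
  qed
qed

end
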